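(* Let $N=2m$ with $m\ge 1$, let $B$ be a non-degenerate skew-symmetric $N\times N$ matrix over $\mathbb{C}$, and let $V$ be an irreducible jet module for $\widetilde{H_B}$ with finite dimensional weight spaces. Then $V\simeq V_{\mathbf 0}\otimes\mathcal A$ as an $\widetilde{H_B}$-module, where $V_{\mathbf 0}$ is an irreducible module for a reductive Lie algebra whose semisimple part is $\mathfrak{sp}_{2m}$.
   Context: All is over $\mathbb{C}$; $(\cdot|\cdot)$ is the standard bilinear form $(\mathbf u|\mathbf v)=\sum u_iv_i$ on $\mathbb{C}^N$. $\mathcal A=\mathbb{C}[t_1^{\pm1},\dots,t_N^{\pm1}]$, $t^{\mathbf r}=t_1^{r_1}\cdots t_N^{r_N}$. $\mathrm{Der}\,\mathcal A$ has basis $t^{\mathbf r}d_i$ with $d_i=t_i\frac{d}{dt_i}$; $D(\mathbf u,\mathbf r)=\sum_i u_it^{\mathbf r}d_i$, so $[D(\mathbf u,\mathbf r),D(\mathbf v,\mathbf s)]=D((\mathbf u|\mathbf s)\mathbf v-(\mathbf v|\mathbf r)\mathbf u,\mathbf r+\mathbf s)$. $H_B=\mathrm{span}\{D(B\mathbf r,\mathbf r):\mathbf r\in\mathbb{Z}^N\setminus\{\mathbf 0\}\}$, $\mathcal D=\mathrm{span}\{D(\mathbf u,\mathbf 0):\mathbf u\in\mathbb{C}^N\}$, $\widetilde{H_B}=H_B\oplus\mathcal D\subset\mathrm{Der}\,\mathcal A$. A jet module for $\widetilde{H_B}$ is a vector space with an action of the Lie algebra $\widetilde{H_B}$ and a unital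 associative action of $\mathcal A$ such that $\eta(fv)=\eta(f)v+f(\eta v)$ for $\eta\in\widetilde{H_B}$, $f\in\mathcal A$. Irreducible means irreducible under the joint action of $\widetilde{H_B}$ and $\mathcal A$. Weight spaces are taken with respect to $\mathcal D$, and $V$ is assumed to be the direct sum of its weight spaces. The structure on $V_{\mathbf 0}\otimes\mathcal A$: let $\mathcal T_B$ be the Lie algebra spanned by $T(\mathbf r)$, $\mathbf r\in\mathbb{Z}^N$ ($T(\mathbf 0)=0$, the $T(\mathbf r)$ with $\mathbf r\ne\mathbf 0$ forming a basis), with bracket $[T(\mathbf r),T(\mathbf s)]=(B\mathbf r|\mathbf s)\,(T(\mathbf r+\mathbf s)-T(\mathbf r)-T(\mathbf s))$. The reductive Lie algebra in question is a quotient of $\mathcal T_B$, so $V_{\mathbf 0}$ is a $\mathcal T_B$-module, and for some $\boldsymbol\beta\in\mathbb{C}^N$ the action on $V_{\mathbf 0}\otimes\mathcal A$ is $D(B\mathbf r,\mathbf r)(v\otimes t^{\mathbf k})=(B\mathbf r|\mathbf k+\boldsymbol\beta)\,v\otimes t^{\mathbf k+\mathbf r}+(T(\mathbf r)v)\otimes t^{\mathbf k+\mathbf r}$, $D(\mathbf u,\mathbf 0)(v\otimes t^{\mathbf k})=(\mathbf u|\mathbf k+\boldsymbol\beta)v\otimes t^{\mathbf k}$, $t^{\mathbf r}(v\otimes t^{\mathbf k})=v\otimes t^{\mathbf k+\mathbf r}$. *)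

theory Defs
  imports
    "HOL-Analysis.Analysis"
    "HOL-Library.Poly_Mapping"
    "HOL-Library.Function_Algebras"
begin

section \<open>Complex vector spaces and Lie algebras on carrier sets\<close>

text \<open>
  A complex vector space is a subspace \<open>V\<close> of an ambient space given by the library locale
  \<^locale>\<open>vector_space\<close> with scalars \<open>complex\<close>; the ambient space is the whole type.
\<close>

definition fin_dim :: "(complex \<Rightarrow> 'a::ab_group_add \<Rightarrow> 'a) \<Rightarrow> 'a set \<Rightarrow> bool" where
  "fin_dim sc V \<longleftrightarrow> (\<exists>S. finite S \<and> V \<subseteq> module.span sc S)"

definition linear_on ::
  "(complex \<Rightarrow> 'a::ab_group_add \<Rightarrow> 'a) \<Rightarrow> 'a set \<Rightarrow> (complex \<Rightarrow> 'b::ab_group_add \<Rightarrow> 'b) \<Rightarrow> 'b set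
    \<Rightarrow> ('a \<Rightarrow> 'b) \<Rightarrow> bool" where
  "linear_on sc V sc' W f \<longleftrightarrow>
     (\<forall>x\<in>V. f x \<in> W) \<and>
     (\<forall>x\<in>V. \<forall>y\<in>V. f (x + y) = f x + f y) \<and>
     (\<forall>c. \<forall>x\<in>V. f (sc c x) = sc' c (f x))"

definition direct_sum_of :: "'a::ab_group_add set \<Rightarrow> ('i \<Rightarrow> 'a set) \<Rightarrow> bool" where
  "direct_sum_of V W \<longleftrightarrow>
     (\<forall>i. W i \<subseteq> V) \<and>
     (\<forall>v\<in>V. \<exists>!f. (\<forall>i. f i \<in> W i) \<and> finite {i. f i \<noteq> 0} \<and> v = (\<Sum>i | f i \<noteq> 0. f i))"

locale lie_algebra = vector_space sc
  for sc :: "complex \<Rightarrow> 'a::ab_group_add \<Rightarrow> 'a" +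
  fixes L :: "'a set" and br :: "'a \<Rightarrow> 'a \<Rightarrow> 'a"
  assumes subspace_L: "subspace L"
    and br_linear_right: "x \<in> L \<Longrightarrow> linear_on sc L sc L (\<lambda>y. br x y)"
    and br_linear_left: "y \<in> L \<Longrightarrow> linear_on sc L sc L (\<lambda>x. br x y)"
    and br_self: "x \<in> L \<Longrightarrow> br x x = 0"
    and jacobi: "\<lbrakk>x \<in> L; y \<in> L; z \<in> L\<rbrakk> \<Longrightarrow>
                   br x (br y z) + br y (br z x) + br z (br x y) = 0"

definition lie_hom ::
  "(complex \<Rightarrow> 'a::ab_group_add \<Rightarrow> 'a) \<Rightarrow> 'a set \<Rightarrow> ('a \<Rightarrow> 'a \<Rightarrow> 'a) \<Rightarrow>
   (complex \<Rightarrow> 'b::ab_group_add \<Rightarrow> 'b) \<Rightarrow> 'b set \<Rightarrow> ('b \<Rightarrow> 'b \<Rightarrow> 'b) \<Rightarrow> ('a \<Rightarrow> 'b) \<Rightarrow> bool" where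
  "lie_hom sc L br sc' L' br' \<pi> \<longleftrightarrow>
     linear_on sc L sc' L' \<pi> \<and> (\<forall>x\<in>L. \<forall>y\<in>L. \<pi> (br x y) = br' (\<pi> x) (\<pi> y))"

definition lie_isomorphic ::
  "(complex \<Rightarrow> 'a::ab_group_add \<Rightarrow> 'a) \<Rightarrow> 'a set \<Rightarrow> ('a \<Rightarrow> 'a \<Rightarrow> 'a) \<Rightarrow>
   (complex \<Rightarrow> 'b::ab_group_add \<Rightarrow> 'b) \<Rightarrow> 'b set \<Rightarrow> ('b \<Rightarrow> 'b \<Rightarrow> 'b) \<Rightarrow> bool" where
  "lie_isomorphic sc L br sc' L' br' \<longleftrightarrow>
     (\<exists>\<pi>. lie_hom sc L br sc' L' br' \<pi> \<and> bij_betw \<pi> L L')"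

context lie_algebra
begin

definition ideal :: "'a set \<Rightarrow> bool" where
  "ideal I \<longleftrightarrow> subspace I \<and> I \<subseteq> L \<and> (\<forall>x\<in>L. \<forall>y\<in>I. br x y \<in> I)"

definition center :: "'a set" where
  "center = {x\<in>L. \<forall>y\<in>L. br x y = 0}"

definition derived :: "'a set \<Rightarrow> 'a set" where
  "derived I = span {br x y | x y. x \<in> I \<and> y \<in> I}"

definition solvable :: "'a set \<Rightarrow> bool" where
  "solvable I \<longleftrightarrow> (\<exists>n. (derived ^^ n) I = {0})"

text \<open>The sum of all solvable ideals; in finite dimension it is the largest solvable ideal.\<close>

definition radical :: "'a set" where
  "radical = span (\<Union>{I. ideal I \<and> solvable I})"

definition reductive :: bool where
  "reductive \<longleftrightarrow> fin_dim sc L \<and> radical = center"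

text \<open>A reductive \<open>L\<close> is the direct sum of its center and \<open>[L, L]\<close>, which is semisimple.\<close>

definition semisimple_part :: "'a set" where
  "semisimple_part = derived L"

end

locale lie_module = lie_algebra scL L br + V: vector_space sc
  for scL :: "complex \<Rightarrow> 'a::ab_group_add \<Rightarrow> 'a" and L :: "'a set" and br :: "'a \<Rightarrow> 'a \<Rightarrow> 'a"
    and sc :: "complex \<Rightarrow> 'v::ab_group_add \<Rightarrow> 'v" +
  fixes V :: "'v set" and \<rho> :: "'a \<Rightarrow> 'v \<Rightarrow> 'v"
  assumes subspace_V: "V.subspace V"
    and act_linear: "x \<in> L \<Longrightarrow> linear_on sc V sc V (\<rho> x)"
    and act_linear_left: "v \<in> V \<Longrightarrow> linear_on scL L sc V (\<lambda>x. \<rho> x v)"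
    and act_br: "\<lbrakk>x \<in> L; y \<in> L; v \<in> V\<rbrakk> \<Longrightarrow> \<rho> (br x y) v = \<rho> x (\<rho> y v) - \<rho> y (\<rho> x v)"
begin

definition irreducible :: bool where
  "irreducible \<longleftrightarrow> V \<noteq> {0} \<and>
     (\<forall>W. V.subspace W \<and> W \<subseteq> V \<and> (\<forall>x\<in>L. \<forall>w\<in>W. \<rho> x w \<in> W) \<longrightarrow> W = {0} \<or> W = V)"

end


section \<open>The symplectic Lie algebra\<close>

definition mat_scale :: "complex \<Rightarrow> complex^'k^'l \<Rightarrow> complex^'k^'l" where
  "mat_scale c = map_matrix (\<lambda>a. c * a)"

definition mat_br :: "complex^'k^'k \<Rightarrow> complex^'k^'k \<Rightarrow> complex^'k^'k" where
  "mat_br X Y = X ** Y - Y ** X"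

text \<open>
  The standard symplectic form on \<open>\<complex>\<^sup>2\<^sup>m\<close> in \<open>m \<times> m\<close> blocks, rows and columns indexed by
  \<open>'m + 'm\<close> with \<open>m = CARD('m)\<close>: the blocks are \<open>0, I, -I, 0\<close>.
\<close>

definition sympl_form :: "complex^('m::finite + 'm)^('m + 'm)" where
  "sympl_form = (\<chi> i j. case (i, j) of
       (Inl a, Inr b) \<Rightarrow> if a = b then 1 else 0
     | (Inr a, Inl b) \<Rightarrow> if a = b then -1 else 0
     | _ \<Rightarrow> 0)"

definition sp :: "(complex^('m::finite + 'm)^('m + 'm)) set" where
  "sp = {X. transpose X ** sympl_form + sympl_form ** X = 0}"


section \<open>Laurent polynomials and vector fields on the torus\<close>

text \<open>
  \<open>\<int>\<^sup>N\<close> is \<open>int^'n\<close> with \<open>N = CARD('n)\<close>.  The library multiplication on finitely supported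
  functions is convolution, so \<open>'n laurent\<close> is the ring of Laurent polynomials in \<open>N\<close>
  variables, a function \<open>f\<close> standing for the sum of all \<open>f k t\<^sup>k\<close>.
\<close>

type_synonym 'n laurent = "(int^'n) \<Rightarrow>\<^sub>0 complex"

definition pm_scale ::
  "(complex \<Rightarrow> 'v \<Rightarrow> 'v) \<Rightarrow> complex \<Rightarrow> ('k \<Rightarrow>\<^sub>0 'v) \<Rightarrow> ('k \<Rightarrow>\<^sub>0 'v::ab_group_add)" where
  "pm_scale sc c = Poly_Mapping.map (sc c)"

definition lscale :: "complex \<Rightarrow> ('k \<Rightarrow>\<^sub>0 complex) \<Rightarrow> ('k \<Rightarrow>\<^sub>0 complex)" where
  "lscale = pm_scale (*)"

definition tpow :: "int^'n \<Rightarrow> 'n laurent" where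
  "tpow r = Poly_Mapping.single r 1"

definition cvec :: "int^'n \<Rightarrow> complex^'n" where
  "cvec r = (\<chi> i. of_int (r $ i))"

text \<open>\<open>t\<^sub>i d/dt\<^sub>i\<close> multiplies \<open>t\<^sup>k\<close> by \<open>k\<^sub>i\<close>.\<close>

definition torus_d :: "'n \<Rightarrow> 'n::finite laurent \<Rightarrow> 'n laurent" where
  "torus_d i f = Poly_Mapping.mapp (\<lambda>k c. of_int (k $ i) * c) f"

text \<open>Vector fields are operators on Laurent polynomials, with the commutator as bracket.\<close>

definition D :: "complex^'n \<Rightarrow> int^'n \<Rightarrow> 'n::finite laurent \<Rightarrow> 'n laurent" where
  "D u r f = (\<Sum>i\<in>UNIV. lscale (u $ i) (tpow r * torus_d i f))"

definition op_scale ::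
  "complex \<Rightarrow> ('n laurent \<Rightarrow> 'n laurent) \<Rightarrow> 'n::finite laurent \<Rightarrow> 'n laurent" where
  "op_scale c \<eta> = (\<lambda>f. lscale c (\<eta> f))"

definition op_br ::
  "('n laurent \<Rightarrow> 'n laurent) \<Rightarrow> ('n laurent \<Rightarrow> 'n laurent) \<Rightarrow> 'n::finite laurent \<Rightarrow> 'n laurent" where
  "op_br \<eta> \<theta> = (\<lambda>f. \<eta> (\<theta> f) - \<theta> (\<eta> f))"

definition Ham :: "complex^'n^'n \<Rightarrow> ('n::finite laurent \<Rightarrow> 'n laurent) set" where
  "Ham B = module.span op_scale {D (B *v cvec r) r | r. r \<noteq> 0}"

definition torus_cartan :: "('n::finite laurent \<Rightarrow> 'n laurent) set" where
  "torus_cartan = module.span op_scale {D u 0 | u. True}"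

definition Ham_ext :: "complex^'n^'n \<Rightarrow> ('n::finite laurent \<Rightarrow> 'n laurent) set" where
  "Ham_ext B = {\<eta> + \<theta> | \<eta> \<theta>. \<eta> \<in> Ham B \<and> \<theta> \<in> torus_cartan}"


section \<open>Jet modules\<close>

locale jet_module = lie_module op_scale "Ham_ext B" op_br sc V \<rho>
  for B :: "complex^'n^'n::finite" and sc :: "complex \<Rightarrow> 'v::ab_group_add \<Rightarrow> 'v"
    and V :: "'v set" and \<rho> :: "('n laurent \<Rightarrow> 'n laurent) \<Rightarrow> 'v \<Rightarrow> 'v" +
  fixes \<mu> :: "'n laurent \<Rightarrow> 'v \<Rightarrow> 'v"
  assumes mult_linear: "linear_on sc V sc V (\<mu> f)"
    and mult_linear_left: "v \<in> V \<Longrightarrow> linear_on lscale UNIV sc V (\<lambda>f. \<mu> f v)"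
    and mult_one: "v \<in> V \<Longrightarrow> \<mu> 1 v = v"
    and mult_assoc: "v \<in> V \<Longrightarrow> \<mu> (f * g) v = \<mu> f (\<mu> g v)"
    and leibniz: "\<lbrakk>\<eta> \<in> Ham_ext B; v \<in> V\<rbrakk> \<Longrightarrow> \<rho> \<eta> (\<mu> f v) = \<mu> (\<eta> f) v + \<mu> f (\<rho> \<eta> v)"
begin

definition jet_irreducible :: bool where
  "jet_irreducible \<longleftrightarrow> V \<noteq> {0} \<and>
     (\<forall>W. V.subspace W \<and> W \<subseteq> V \<and> (\<forall>\<eta>\<in>Ham_ext B. \<forall>w\<in>W. \<rho> \<eta> w \<in> W) \<and> (\<forall>f. \<forall>w\<in>W. \<mu> f w \<in> W)
        \<longrightarrow> W = {0} \<or> W = V)"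

text \<open>The linear functionals on the span of the \<open>D u 0\<close> are the maps \<open>D u 0 \<mapsto> (u|\<lambda>)\<close>.\<close>

definition weight_space :: "complex^'n \<Rightarrow> 'v set" where
  "weight_space wt = {v\<in>V. \<forall>u. \<rho> (D u 0) v = sc (scalar_product u wt) v}"

end

definition jet_iso ::
  "complex^'n^'n \<Rightarrow>
   (complex \<Rightarrow> 'v::ab_group_add \<Rightarrow> 'v) \<Rightarrow> 'v set \<Rightarrow> (('n laurent \<Rightarrow> 'n laurent) \<Rightarrow> 'v \<Rightarrow> 'v) \<Rightarrow> ('n laurent \<Rightarrow> 'v \<Rightarrow> 'v) \<Rightarrow>
   (complex \<Rightarrow> 'w::ab_group_add \<Rightarrow> 'w) \<Rightarrow> 'w set \<Rightarrow> (('n laurent \<Rightarrow> 'n laurent) \<Rightarrow> 'w \<Rightarrow> 'w) \<Rightarrow> ('n laurent \<Rightarrow> 'w \<Rightarrow> 'w) \<Rightarrow>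
   ('v \<Rightarrow> 'w) \<Rightarrow> bool" where
  "jet_iso B sc V \<rho> \<mu> sc' V' \<rho>' \<mu>' \<Phi> \<longleftrightarrow>
     linear_on sc V sc' V' \<Phi> \<and> bij_betw \<Phi> V V' \<and>
     (\<forall>\<eta>\<in>Ham_ext B. \<forall>v\<in>V. \<Phi> (\<rho> \<eta> v) = \<rho>' \<eta> (\<Phi> v)) \<and>
     (\<forall>f. \<forall>v\<in>V. \<Phi> (\<mu> f v) = \<mu>' f (\<Phi> v))"


section \<open>The Lie algebra \<open>\<T>\<^sub>B\<close> and the modules \<open>V\<^sub>0 \<otimes> \<A>\<close>\<close>

text \<open>
  \<open>\<T>\<^sub>B\<close> has a basis indexed by the nonzero \<open>r\<close>, hence consists of the finitely supported
  functions on \<open>\<int>\<^sup>N\<close> vanishing at \<open>0\<close>.  (The type is that of Laurent polynomials, but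
  their multiplication plays no role here.)  The bracket is the bilinear extension of the one on the
  \<open>T r\<close>.  A quotient of \<open>\<T>\<^sub>B\<close> is given by a surjective Lie algebra homomorphism from
  \<open>\<T>\<^sub>B\<close>; a finite dimensional quotient can be carried by a subspace of
  \<open>nat \<Rightarrow>\<^sub>0 complex\<close>, a complex vector space of countably infinite dimension.
\<close>

definition T :: "int^'n \<Rightarrow> 'n::finite laurent" where
  "T r = (if r = 0 then 0 else Poly_Mapping.single r 1)"

definition TB :: "'n::finite laurent set" where
  "TB = {x. Poly_Mapping.lookup x 0 = 0}"

definition TB_br :: "complex^'n^'n \<Rightarrow> 'n::finite laurent \<Rightarrow> 'n laurent \<Rightarrow> 'n laurent" where
  "TB_br B x y = (\<Sum>r\<in>Poly_Mapping.keys x. \<Sum>s\<in>Poly_Mapping.keys y.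
      lscale (Poly_Mapping.lookup x r * Poly_Mapping.lookup y s * scalar_product (B *v cvec r) (cvec s))
        (T (r + s) - T r - T s))"

text \<open>
  As \<open>\<A>\<close> has the basis \<open>t\<^sup>k\<close>, elements of \<open>V\<^sub>0 \<otimes> \<A>\<close> are finitely supported functions
  from \<open>\<int>\<^sup>N\<close> to \<open>V\<^sub>0\<close>, with \<open>v \<otimes> t\<^sup>k = Poly_Mapping.single k v\<close>.
  When \<open>V\<^sub>0 \<otimes> \<A> \<simeq> V\<close>, the map \<open>v \<mapsto> v \<otimes> 1\<close> embeds \<open>V\<^sub>0\<close> in \<open>V\<close>, so it is no loss to
  look for \<open>V\<^sub>0\<close> among the subspaces of the ambient space of \<open>V\<close>.
\<close>

definition tensor_laurent :: "'v set \<Rightarrow> ((int^'n) \<Rightarrow>\<^sub>0 'v::ab_group_add) set" where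
  "tensor_laurent V0 = {x. \<forall>k. Poly_Mapping.lookup x k \<in> V0}"

text \<open>
  The jet module structure on \<open>V\<^sub>0 \<otimes> \<A>\<close> determined by an action \<open>\<tau>\<close> of \<open>\<T>\<^sub>B\<close> on \<open>V\<^sub>0\<close>
  and by \<open>\<beta>\<close>; by linearity it is unique.
\<close>

definition tensor_jet_structure ::
  "complex^'n^'n \<Rightarrow> (complex \<Rightarrow> 'v::ab_group_add \<Rightarrow> 'v) \<Rightarrow> 'v set \<Rightarrow> ('n laurent \<Rightarrow> 'v \<Rightarrow> 'v) \<Rightarrow> complex^'n \<Rightarrow>
   (('n laurent \<Rightarrow> 'n laurent) \<Rightarrow> ((int^'n) \<Rightarrow>\<^sub>0 'v) \<Rightarrow> ((int^'n) \<Rightarrow>\<^sub>0 'v)) \<Rightarrow>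
   ('n laurent \<Rightarrow> ((int^'n) \<Rightarrow>\<^sub>0 'v) \<Rightarrow> ((int^'n::finite) \<Rightarrow>\<^sub>0 'v)) \<Rightarrow> bool" where
  "tensor_jet_structure B sc V0 \<tau> \<beta> \<rho> \<mu> \<longleftrightarrow>
     jet_module B (pm_scale sc) (tensor_laurent V0) \<rho> \<mu> \<and>
     (\<forall>v\<in>V0. \<forall>k.
        (\<forall>r. r \<noteq> 0 \<longrightarrow> \<rho> (D (B *v cvec r) r) (Poly_Mapping.single k v) =
           Poly_Mapping.single (k + r) (sc (scalar_product (B *v cvec r) (cvec k + \<beta>)) v)
           + Poly_Mapping.single (k + r) (\<tau> (T r) v)) \<and>
        (\<forall>u. \<rho> (D u 0) (Poly_Mapping.single k v) =
           Poly_Mapping.single k (sc (scalar_product u (cvec k + \<beta>)) v)) \<and>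
        (\<forall>r. \<mu> (tpow r) (Poly_Mapping.single k v) = Poly_Mapping.single (k + r) v))"

end

theory Submission
  imports Defs "HOL-Computational_Algebra.Fundamental_Theorem_Algebra"
begin

text \<open>
  Multiplication by \<open>t\<^sup>r\<close> permutes the weight spaces, so one weight space \<open>V\<^sub>0\<close>, of weight \<open>\<beta>\<close>, generates
  \<open>V\<close> over \<open>\<A>\<close>, and \<open>V\<close> is determined by the operators \<open>T(r) = t\<^sup>-\<^sup>r D(Br, r) - (Br|\<beta>)\<close> on \<open>V\<^sub>0\<close>.  They obey the
  relations of \<open>\<T>\<^sub>B\<close> and act irreducibly.  Extend \<open>T\<close> linearly to \<open>\<A>\<close> by \<open>t\<^sup>r \<mapsto> T(r)\<close> and let \<open>I\<close> be the
  augmentation ideal; then \<open>[T(r), T(g)]\<close> is the image of \<open>(t\<^sup>r - 1) \<partial>\<^sub>r g\<close> when \<open>g \<in> I\<^sup>2\<close>, with \<open>\<partial>\<^sub>r\<close> the derivation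
  \<open>t\<^sup>s \<mapsto> (Br|s) t\<^sup>s\<close>.

  As \<open>V\<^sub>0\<close> is finite dimensional, some nonzero polynomial in \<open>x = t\<^sup>s\<close> annihilates \<open>T\<close> on all lines
  \<open>r + \<int>s\<close> with \<open>(Br|s) \<noteq> 0\<close>.  If \<open>q\<close> is one of minimal degree, the bracket relation shows that it divides
  \<open>(x - 1)\<^sup>3 x q'\<close>, so \<open>q\<close> is a power of \<open>x - 1\<close>; it follows that \<open>T\<close> kills some power of \<open>I\<close>.

  Suppose that \<open>T\<close> kills \<open>I\<^sup>d\<^sup>+\<^sup>1\<close> with \<open>d \<ge> 3\<close>.  Then the operators \<open>T((t\<^sup>s - 1)\<^sup>d)\<close> commute, and each is
  an eigenvector for a nonzero eigenvalue of a suitable inner derivation, hence nilpotent.  So they have a common kernel, which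
  by polarization is killed by \<open>T(I\<^sup>d)\<close>; irreducibility gives \<open>T(I\<^sup>d) = 0\<close>.  Descending, \<open>T\<close> kills
  \<open>I\<^sup>3\<close>, that is, \<open>T(r)\<close> is the sum of a linear and a quadratic function of \<open>r\<close>.  Therefore the action factors through
  \<open>\<T>\<^sub>B \<rightarrow> sp \<oplus> \<complex>\<^sup>N\<close>, \<open>T(r) \<mapsto> (r\<^sup>2/2, r)\<close>.
\<close>

section \<open>Additive endomorphisms\<close>

text \<open>The obstacle is the lines \<open>r + \<int>s\<close> with \<open>(Br|s) = 0\<close>.
  Brackets reach them only through derivatives, and on a coordinate axis an element with a constant
  term need not be a derivative. What survives there is a central operator that is also a
  commutator. In place of traces and Schur's lemma, both its vanishing and the nilpotency of
  eigenvectors come from comparing an annihilating polynomial with its derivative. The exponent 3 is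
  dictated by degrees: for a, b >= 2 a bracket of images of I^a and I^b comes from I^(a+b-2), and 2d
  - 2 >= d + 1 means d >= 3. The linear terms become central because [T(r), T(s)] is (Br|s) T((t^r -
  1)(t^s - 1)), which modulo I^3 has degree two in r and in s. Operators on \<open>V0\<close> are
  extended to the whole type through a linear projection, so that they compose in a ring. A type
  cannot depend on the scalar action \<open>sc\<close>; hence the ring consists of additive maps,
  and linearity is a separate predicate.\<close>

typedef (overloaded) 'v aend = "{f :: 'v::ab_group_add \<Rightarrow> 'v. \<forall>x y. f (x + y) = f x + f y}"
  morphisms app Aend
  by (rule exI[of _ id]) simp

lemma app_add: "app a (x + y) = app a x + app a y"
  using app[of a] by simp

lemma app_Aend: "(\<And>x y. f (x + y) = f x + f y) \<Longrightarrow> app (Aend f) = f"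
  by (simp add: Aend_inverse)

lemma aend_eqI: "(\<And>v. app a v = app b v) \<Longrightarrow> a = b"
  by (metis app_inject ext)

lemma app_zero [simp]: "app a 0 = 0"
  using app_add[of a 0 0] by simp

instantiation aend :: (ab_group_add) "{ring, monoid_mult}"
begin
definition "0 = Aend (\<lambda>v. 0)"
definition "1 = Aend (\<lambda>v. v)"
definition "a + b = Aend (\<lambda>v. app a v + app b v)"
definition "a - b = Aend (\<lambda>v. app a v - app b v)"
definition "- a = Aend (\<lambda>v. - app a v)"
definition "a * b = Aend (\<lambda>v. app a (app b v))"

lemma app_simps [simp]:
  "app 0 v = 0" "app 1 v = v" "app (a + b) v = app a v + app b v"
  "app (a - b) v = app a v - app b v" "app (- a) v = - app a v" "app (a * b) v = app a (app b v)"
  unfolding zero_aend_def one_aend_def plus_aend_def minus_aend_def uminus_aend_def times_aend_def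
  by (subst app_Aend; simp add: app_add)+

instance
  by standard (rule aend_eqI; simp add: app_add algebra_simps)+
end

lemma app_sum: "app (\<Sum>i\<in>I. a i) v = (\<Sum>i\<in>I. app (a i) v)"
  by (induct I rule: infinite_finite_induct) simp_all

type_synonym 'm svec = "complex^('m + 'm)"
type_synonym 'm smat = "complex^('m + 'm)^('m + 'm)"

section \<open>Laurent polynomials\<close>

lemma cvec_simps [simp]:
  "cvec (r + s) = cvec r + cvec s" "cvec (r - s) = cvec r - cvec s" "cvec (- r) = - cvec r" "cvec 0 = 0"
  by (simp_all add: cvec_def vec_eq_iff)

lemma cvec_eq_iff: "cvec r = cvec s \<longleftrightarrow> r = s"
  by (simp add: cvec_def vec_eq_iff)

lemma scalar_product_simps [simp]:
  fixes u v w :: "complex^'n"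
  shows "scalar_product (u + v) w = scalar_product u w + scalar_product v w"
    "scalar_product u (v + w) = scalar_product u v + scalar_product u w"
    "scalar_product (u - v) w = scalar_product u w - scalar_product v w"
    "scalar_product u (v - w) = scalar_product u v - scalar_product u w"
    "scalar_product (- u) w = - scalar_product u w"
    "scalar_product u (- w) = - scalar_product u w"
    "scalar_product 0 w = 0" "scalar_product u 0 = 0"
  by (simp_all add: scalar_product_def algebra_simps sum.distrib sum_subtractf sum_negf)

lemma lscale_eq_mult: "lscale c f = Poly_Mapping.single 0 c * f"
  by (simp add: lscale_def pm_scale_def mult_map_scale_conv_mult)

lemma lookup_lscale [simp]: "Poly_Mapping.lookup (lscale c f) k = c * Poly_Mapping.lookup f k"
  by (simp add: lscale_def pm_scale_def map.rep_eq when_def)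

interpretation lscale: vector_space lscale
  by standard (rule poly_mapping_eqI, simp add: lookup_add algebra_simps)+

lemma lscale_mult_left [simp]: "lscale c (f :: 'k::comm_monoid_add \<Rightarrow>\<^sub>0 complex) * g = lscale c (f * g)"
  and lscale_mult_right [simp]: "(f :: 'k::comm_monoid_add \<Rightarrow>\<^sub>0 complex) * lscale c g = lscale c (f * g)"
  by (simp_all add: lscale_eq_mult ac_simps)

lemma tpow_add: "tpow (r + s) = tpow r * tpow s"
  by (simp add: tpow_def mult_single)

lemma tpow_0 [simp]: "tpow 0 = 1"
  by (simp add: tpow_def)

lemma tpow_mult_minus [simp]: "tpow r * tpow (- r) = 1" "tpow (- r) * tpow r = 1"
  by (simp_all flip: tpow_add)

lemma laurent_expand: "(\<Sum>k\<in>Poly_Mapping.keys f. lscale (Poly_Mapping.lookup f k) (tpow k)) = f"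
proof (rule poly_mapping_eqI)
  fix k
  show "Poly_Mapping.lookup (\<Sum>k\<in>Poly_Mapping.keys f. lscale (Poly_Mapping.lookup f k) (tpow k)) k
      = Poly_Mapping.lookup f k"
    by (simp add: lookup_sum tpow_def lookup_single when_def if_distrib cong: if_cong)
      (simp add: in_keys_iff)
qed

lemma laurent_induct [case_names monom add]:
  assumes "\<And>c k. P (lscale c (tpow k))" and "\<And>f g. P f \<Longrightarrow> P g \<Longrightarrow> P (f + g)"
  shows "P f"
proof -
  have "P (\<Sum>k\<in>I. lscale (Poly_Mapping.lookup f k) (tpow k))" if "finite I" for I
    using that
  proof induct
    case empty
    show ?case using assms(1)[of 0 0] by simp
  qed (simp add: assms)
  then show ?thesis
    using laurent_expand[of f] by (metis finite_keys)
qed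

section \<open>Derivations of the Laurent polynomials\<close>

definition der :: "complex^'n \<Rightarrow> 'n::finite laurent \<Rightarrow> 'n laurent" where
  "der y f = Poly_Mapping.mapp (\<lambda>k c. scalar_product y (cvec k) * c) f"

lemma lookup_der [simp]:
  "Poly_Mapping.lookup (der y f) k = scalar_product y (cvec k) * Poly_Mapping.lookup f k"
  by (simp add: der_def lookup_mapp when_def in_keys_iff)

lemma der_simps [simp]:
  "der y (f + g) = der y f + der y g" "der y (f - g) = der y f - der y g"
  "der y (lscale c f) = lscale c (der y f)" "der (y + z) f = der y f + der z f"
  "der (y - z) f = der y f - der z f" "der y 0 = 0"
  by (rule poly_mapping_eqI; simp add: lookup_add lookup_minus algebra_simps)+

lemma der_tpow [simp]: "der y (tpow k) = lscale (scalar_product y (cvec k)) (tpow k)"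
  by (rule poly_mapping_eqI) (simp add: tpow_def lookup_single when_def)

lemma der_one [simp]: "der y 1 = 0"
  using der_tpow[of y 0] by simp

lemma der_mult: "der y (f * g) = der y f * g + f * der y g"
proof (induct f rule: laurent_induct)
  case (monom c k)
  show ?case
  proof (induct g rule: laurent_induct)
    case (monom d l)
    have "der y (tpow k * tpow l) = lscale (scalar_product y (cvec k) + scalar_product y (cvec l)) (tpow k * tpow l)"
      by (simp flip: tpow_add)
    then show ?case
      by (simp add: lscale.scale_left_distrib lscale.scale_right_distrib mult.commute mult.left_commute mult.assoc[where 'a=complex])
  qed (simp add: algebra_simps)
qed (simp add: algebra_simps)

lemma der_power_Suc: "der y (f ^ Suc n) = lscale (of_nat (Suc n)) (f ^ n * der y f)"
proof (induct n)
  case (Suc n)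
  have "der y (f ^ Suc (Suc n)) = f ^ Suc n * der y f + f * lscale (of_nat (Suc n)) (f ^ n * der y f)"
    by (subst power_Suc, subst der_mult, subst Suc) (simp add: mult.commute)
  also have "\<dots> = lscale 1 (f ^ Suc n * der y f) + lscale (of_nat (Suc n)) (f ^ Suc n * der y f)"
    by (simp add: mult.assoc)
  also have "\<dots> = lscale (of_nat (Suc (Suc n))) (f ^ Suc n * der y f)"
    by (subst lscale.scale_left_distrib[symmetric]) simp
  finally show ?case .
qed simp

section \<open>Evaluation at the point (1, ..., 1)\<close>

definition eps :: "'n::finite laurent \<Rightarrow> complex" where
  "eps f = (\<Sum>k\<in>Poly_Mapping.keys f. Poly_Mapping.lookup f k)"

lemma eps_add [simp]: "eps (f + g) = eps f + eps g"
  unfolding eps_def by (rule setsum_keys_plus_distrib) simp_all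

lemma eps_lscale [simp]: "eps (lscale c f) = c * eps f"
proof (cases "c = 0")
  case False
  then have "Poly_Mapping.keys (lscale c f) = Poly_Mapping.keys f"
    by (auto simp: in_keys_iff)
  then show ?thesis by (simp add: eps_def sum_distrib_left)
qed (simp add: eps_def)

lemma eps_tpow [simp]: "eps (tpow k) = 1"
  by (simp add: eps_def tpow_def)

lemma eps_0 [simp]: "eps 0 = 0" and eps_1 [simp]: "eps 1 = 1"
  using eps_tpow[of 0] by (simp_all add: eps_def)

lemma eps_diff [simp]: "eps (f - g) = eps f - eps g"
  using eps_add[of "f - g" g] by simp

lemma eps_mult [simp]: "eps (f * g) = eps f * eps g"
proof (induct f rule: laurent_induct)
  case (monom c k)
  show ?case
  proof (induct g rule: laurent_induct)
    case (monom d l)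
    show ?case by (simp flip: tpow_add)
  qed (simp only: distrib_left eps_add)
qed (simp only: distrib_right eps_add)

lemma eps_power [simp]: "eps (f ^ n) = eps f ^ n"
  by (induct n) simp_all

text \<open>The locale is not interpreted because its simplification rules would reassociate products.\<close>

lemma module_mult: "module ((*) :: 'a::comm_ring_1 \<Rightarrow> 'a \<Rightarrow> 'a)"
  by standard (simp_all add: algebra_simps)

lemmas mult_subspace = module.subspace_span[OF module_mult] module.subspace_UNIV[OF module_mult]
  module.subspace_add[OF module_mult] module.subspace_diff[OF module_mult]
  module.subspace_scale[OF module_mult] module.subspace_0[OF module_mult]

text \<open>Powers of the kernel of \<open>eps\<close>: the functions vanishing to order
  \<open>d\<close> at (1, ..., 1). Adding one factor at a time suits induction on
  \<open>d\<close>.\<close>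

primrec aug_pow :: "nat \<Rightarrow> 'n::finite laurent set" where
  "aug_pow 0 = UNIV"
| "aug_pow (Suc d) = module.span (*) {(tpow a - 1) * f | a f. f \<in> aug_pow d}"

lemma subspace_aug_pow: "module.subspace (*) (aug_pow d)"
  by (cases d) (simp_all add: mult_subspace)

lemma aug_pow_add: "f \<in> aug_pow d \<Longrightarrow> g \<in> aug_pow d \<Longrightarrow> f + g \<in> aug_pow d"
  and aug_pow_mult: "f \<in> aug_pow d \<Longrightarrow> g * f \<in> aug_pow d"
  and aug_pow_0: "0 \<in> aug_pow d"
  by (simp_all add: mult_subspace subspace_aug_pow)

lemma aug_pow_mult': "f \<in> aug_pow d \<Longrightarrow> f * g \<in> aug_pow d"
  using aug_pow_mult[of f d g] by (simp add: mult.commute)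

lemma aug_pow_lscale: "f \<in> aug_pow d \<Longrightarrow> lscale c f \<in> aug_pow d"
  by (simp add: lscale_eq_mult aug_pow_mult)

lemma aug_pow_SucI: "f \<in> aug_pow d \<Longrightarrow> (tpow a - 1) * f \<in> aug_pow (Suc d)"
  by (auto intro: module.span_base[OF module_mult])

text \<open>Each power is an ideal, so a coefficient can be absorbed into \<open>f\<close>; hence
  there is no case for multiples.\<close>

lemma aug_pow_Suc_induct [consumes 1, case_names zero add gen]:
  assumes "f \<in> aug_pow (Suc d)" and "P 0" and "\<And>f g. P f \<Longrightarrow> P g \<Longrightarrow> P (f + g)"
    and "\<And>a f. f \<in> aug_pow d \<Longrightarrow> P ((tpow a - 1) * f)"
  shows "P f"
proof -
  have "f \<in> module.span (*) {(tpow a - 1) * f | a f. f \<in> aug_pow d}" using assms(1) by simp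
  then show ?thesis
  proof (induct rule: module.span_induct_alt[OF module_mult, consumes 1, case_names base step])
    case (step c x y)
    then obtain a f where x: "x = (tpow a - 1) * f" "f \<in> aug_pow d" by auto
    then have "c * x = (tpow a - 1) * (c * f)" by (simp add: mult.left_commute)
    then have "P (c * x)" using x(2) by (simp add: assms(4) aug_pow_mult)
    with step show ?case by (simp add: assms(3))
  qed (rule assms(2))
qed

lemma aug_pow_mono: "aug_pow (Suc d) \<subseteq> aug_pow d"
proof
  fix f :: "'a laurent" assume "f \<in> aug_pow (Suc d)"
  then show "f \<in> aug_pow d"
    by (induct rule: aug_pow_Suc_induct) (simp_all add: aug_pow_0 aug_pow_add aug_pow_mult)
qed

lemma aug_pow_antimono: "d \<le> e \<Longrightarrow> aug_pow e \<subseteq> aug_pow d"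
  by (induct rule: dec_induct) (use aug_pow_mono in \<open>blast+\<close>)

lemma aug_pow_mult_aug_pow: "f \<in> aug_pow d \<Longrightarrow> g \<in> aug_pow e \<Longrightarrow> f * g \<in> aug_pow (d + e)"
proof (induct d arbitrary: f)
  case 0
  then show ?case by (simp add: aug_pow_mult)
next
  case (Suc d)
  from Suc.prems(1) show ?case
  proof (induct rule: aug_pow_Suc_induct)
    case (gen a h)
    then have "(tpow a - 1) * (h * g) \<in> aug_pow (Suc (d + e))"
      using Suc by (intro aug_pow_SucI) simp
    then show ?case by (simp add: mult.assoc)
  qed (simp_all add: aug_pow_0 aug_pow_add distrib_right del: aug_pow.simps)
qed

lemma tpow_diff_one_mem: "tpow a - 1 \<in> aug_pow 1"
  using aug_pow_SucI[of 1 0 a] by simp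

lemma aug_pow_power: "f \<in> aug_pow d \<Longrightarrow> f ^ n \<in> aug_pow (n * d)"
  by (induct n) (simp_all add: aug_pow_mult_aug_pow)

lemma tpow_diff_one_power_mem: "(tpow a - 1) ^ n \<in> aug_pow n"
  using aug_pow_power[OF tpow_diff_one_mem, of a n] by simp

lemma diff_eps_mem: "f - lscale (eps f) 1 \<in> aug_pow 1"
proof (induct f rule: laurent_induct)
  case (monom c k)
  have "lscale c (tpow k - 1) \<in> aug_pow 1" by (intro aug_pow_lscale tpow_diff_one_mem)
  then show ?case by (simp add: lscale.scale_right_diff_distrib)
next
  case (add f g)
  from aug_pow_add[OF this] show ?case by (simp add: lscale.scale_left_distrib algebra_simps)
qed

lemma eps_aug_pow: "f \<in> aug_pow (Suc d) \<Longrightarrow> eps f = 0"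
  by (induct rule: aug_pow_Suc_induct) simp_all

lemma der_aug_pow: "f \<in> aug_pow (Suc d) \<Longrightarrow> der y f \<in> aug_pow d"
proof (induct d arbitrary: f)
  case (Suc d)
  from Suc.prems show ?case
  proof (induct rule: aug_pow_Suc_induct)
    case (gen a f)
    then have "(tpow a - 1) * der y f \<in> aug_pow (Suc d)"
      by (intro aug_pow_SucI Suc)
    moreover have "der y (tpow a - 1) * f \<in> aug_pow (Suc d)"
      using gen by (rule aug_pow_mult)
    ultimately show ?case by (simp add: der_mult aug_pow_add del: aug_pow.simps)
  qed (simp_all add: aug_pow_0 aug_pow_add del: aug_pow.simps)
qed simp

section \<open>Polynomials in one monomial\<close>

definition subst_tpow :: "int^'n \<Rightarrow> complex poly \<Rightarrow> 'n::finite laurent" where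
  "subst_tpow s p = poly (map_poly (Poly_Mapping.single 0) p) (tpow s)"

lemma subst_tpow_pCons: "subst_tpow s (pCons c p) = lscale c 1 + tpow s * subst_tpow s p"
  by (cases "c = 0 \<and> p = 0") (auto simp: subst_tpow_def map_poly_pCons lscale_eq_mult)

lemma subst_tpow_0 [simp]: "subst_tpow s 0 = 0"
  by (simp add: subst_tpow_def)

lemma subst_tpow_1 [simp]: "subst_tpow s 1 = 1"
  using subst_tpow_pCons[of s 1 0] by (simp flip: one_pCons)

lemma subst_tpow_add [simp]: "subst_tpow s (p + q) = subst_tpow s p + subst_tpow s q"
proof (induct p arbitrary: q)
  case (pCons a p)
  show ?case
    by (cases q) (simp add: subst_tpow_pCons pCons(2) lscale.scale_left_distrib distrib_left)
qed simp

lemma subst_tpow_smult [simp]: "subst_tpow s (smult c p) = lscale c (subst_tpow s p)"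
  by (induct p) (simp_all add: subst_tpow_pCons lscale.scale_right_distrib)

lemma subst_tpow_mult [simp]: "subst_tpow s (p * q) = subst_tpow s p * subst_tpow s q"
  by (induct p) (simp_all add: subst_tpow_pCons algebra_simps)

lemma subst_tpow_power [simp]: "subst_tpow s (p ^ n) = subst_tpow s p ^ n"
  by (induct n) simp_all

lemma subst_tpow_linear: "subst_tpow s [:-1, 1:] = tpow s - 1" "subst_tpow s [:0, 1:] = tpow s"
  by (simp_all add: subst_tpow_pCons)

lemma der_subst_tpow:
  "der y (subst_tpow s p) = lscale (scalar_product y (cvec s)) (subst_tpow s ([:0, 1:] * pderiv p))"
proof (induct p)
  case (pCons a p)
  then show ?case
    by (simp add: subst_tpow_pCons pderiv_pCons der_mult lscale.scale_right_distrib algebra_simps)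
qed simp

section \<open>Operators on a finite dimensional module\<close>

text \<open>The polynomials have infinite dimension. Two monomials with equal image give their
  difference; otherwise the images of the monomials form an infinite set in a finite dimensional
  space, and a dependence in it lifts to distinct monomials.\<close>

lemma (in vector_space) exists_poly_in_kernel:
  fixes f :: "'a poly \<Rightarrow> 'b"
  assumes add: "\<And>p q. f (p + q) = f p + f q" and smult: "\<And>c p. f (smult c p) = scale c (f p)"
    and "finite F" and rng: "\<And>p. f p \<in> span F"
  shows "\<exists>p. p \<noteq> 0 \<and> f p = 0"
proof (cases "inj (\<lambda>i. f (monom 1 i))")
  case False
  then obtain i j where ij: "i \<noteq> j" "f (monom 1 i) = f (monom 1 j)" by (auto simp: inj_on_def)
  have "f (monom 1 i + smult (- 1) (monom 1 j)) = 0"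
    using ij by (simp only: add smult) simp
  moreover have "monom 1 i + smult (- 1) (monom 1 j) \<noteq> (0 :: 'a poly)"
  proof
    assume "monom 1 i + smult (- 1) (monom 1 j) = (0 :: 'a poly)"
    then have "coeff (monom 1 i + smult (- 1) (monom 1 j) :: 'a poly) i = 0" by simp
    with ij show False by simp
  qed
  ultimately show ?thesis by blast
next
  case True
  let ?v = "\<lambda>i. f (monom 1 i)"
  have "dependent (range ?v)"
  proof (rule ccontr)
    assume "independent (range ?v)"
    then have "finite (range ?v)"
      using independent_span_bound[OF \<open>finite F\<close>, of "range ?v"] rng by auto
    with True show False using finite_imageD by blast
  qed
  then obtain t u where t: "finite t" "t \<subseteq> range ?v" "(\<Sum>x\<in>t. scale (u x) x) = 0" "\<exists>x\<in>t. u x \<noteq> 0"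
    unfolding dependent_explicit by blast
  define I where "I = ?v -` t"
  have I: "finite I" "t = ?v ` I" "inj_on ?v I"
    using t True by (auto simp: I_def finite_vimageI inj_on_def)
  have f0: "f 0 = 0" using smult[of 0 0] by simp
  have fsum: "f (\<Sum>i\<in>K. smult (c i) (monom 1 i)) = (\<Sum>i\<in>K. scale (c i) (?v i))" if "finite K" for K and c
    using that by induct (simp_all add: f0 add smult del: smult_monom)
  define p where "p = (\<Sum>i\<in>I. smult (u (?v i)) (monom 1 i))"
  have "f p = 0"
    using t(3) by (simp only: p_def fsum[OF I(1)] I(2) sum.reindex[OF I(3)] o_def)
  moreover have "p \<noteq> 0"
  proof
    assume p0: "p = 0"
    from t(4) I(2) obtain j where j: "j \<in> I" "u (?v j) \<noteq> 0" by blast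
    have "coeff p j = u (?v j)"
      using I(1) j by (simp add: p_def coeff_sum if_distrib cong: if_cong)
    with p0 j show False by simp
  qed
  ultimately show ?thesis by blast
qed

text \<open>Takes the place of a Vandermonde determinant: the sum at \<open>2 * n\<close> minus
  \<open>2 ^ Suc d\<close> times the sum at \<open>n\<close> has no top term, and its other terms
  are the old ones times nonzero constants.\<close>

lemma (in vector_space) power_sums_eq_0:
  fixes v :: "nat \<Rightarrow> 'b"
  assumes "\<And>n::nat. (\<Sum>i\<le>d. scale (of_nat n ^ i) (v i)) = 0" and "i \<le> d"
    and char0: "\<And>k. of_nat k = (0::'a) \<Longrightarrow> k = 0"
  shows "v i = 0"
  using assms(1,2)
proof (induct d arbitrary: v i)
  case 0
  from 0(1)[of 1] 0(2) show ?case by simp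
next
  case (Suc d)
  define v' where "v' = (\<lambda>i. scale (2 ^ i - 2 ^ Suc d) (v i))"
  have "(\<Sum>i\<le>d. scale (of_nat n ^ i) (v' i)) = 0" for n :: nat
  proof -
    have "(\<Sum>i\<le>Suc d. scale (of_nat n ^ i) (v' i))
        = (\<Sum>i\<le>Suc d. scale (of_nat (2 * n) ^ i) (v i)) - scale (2 ^ Suc d) (\<Sum>i\<le>Suc d. scale (of_nat n ^ i) (v i))"
      unfolding scale_sum_right v'_def sum_subtractf[symmetric]
      by (rule sum.cong) (simp_all add: power_mult_distrib scale_left_diff_distrib algebra_simps)
    then have "(\<Sum>i\<le>Suc d. scale (of_nat n ^ i) (v' i)) = 0" by (simp only: Suc(2)) simp
    then show ?thesis by (simp add: v'_def)
  qed
  from Suc(1)[OF this] have "v' i = 0" if "i \<le> d" for i using that .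
  moreover have "(2 ^ i - 2 ^ Suc d :: 'a) \<noteq> 0" if "i \<le> d" for i
  proof
    assume "(2 ^ i - 2 ^ Suc d :: 'a) = 0"
    moreover have "(2 ^ i - 2 ^ Suc d :: 'a) = - of_nat (2 ^ Suc d - 2 ^ i)"
      using that by (subst of_nat_diff) (simp_all add: power_increasing del: power_Suc)
    ultimately have "(2 ^ Suc d - 2 ^ i :: nat) = 0" using char0 by (metis neg_equal_0_iff_equal)
    moreover have "(2 ^ i :: nat) < 2 ^ Suc d" using that by (intro power_strict_increasing) auto
    ultimately show False by simp
  qed
  ultimately have v: "v i = 0" if "i \<le> d" for i using that unfolding v'_def by simp
  have "v (Suc d) = 0" using Suc(2)[of 1] v by simp
  with v Suc(3) show ?case by (cases "i = Suc d") auto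
qed

section \<open>The skew form \<open>(Br|s)\<close> on the lattice\<close>

locale symplectic_lattice =
  fixes B :: "complex^'n^'n::finite"
  assumes skew: "transpose B = - B" and inv: "invertible B"
begin

definition w :: "int^'n \<Rightarrow> int^'n \<Rightarrow> complex" where
  "w r s = scalar_product (B *v cvec r) (cvec s)"

definition ddr :: "int^'n \<Rightarrow> 'n laurent \<Rightarrow> 'n laurent" where
  "ddr u = der (B *v cvec u)"

lemma w_simps [simp]:
  "w (r + r') s = w r s + w r' s" "w r (s + s') = w r s + w r s'" "w 0 s = 0" "w r 0 = 0"
  "w (r - r') s = w r s - w r' s" "w r (s - s') = w r s - w r s'" "w (- r) s = - w r s" "w r (- s) = - w r s"
  by (simp_all add: w_def matrix_vector_right_distrib matrix_vector_mult_diff_distrib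
      scalar_product_simps(5)[symmetric] del: scalar_product_simps(5))
    (simp add: matrix_vector_mult_def scalar_product_def sum_negf)+

lemma scalar_product_skew: "scalar_product (B *v x) y = - scalar_product (B *v y) x"
proof -
  have B: "B $ i $ j = - B $ j $ i" for i j
  proof -
    have "transpose B $ j $ i = (- B) $ j $ i" by (simp only: skew)
    then show ?thesis by (simp add: transpose_def)
  qed
  have "scalar_product (B *v x) y = (\<Sum>i\<in>UNIV. \<Sum>j\<in>UNIV. B $ i $ j * x $ j * y $ i)"
    by (simp add: scalar_product_def matrix_vector_mult_def sum_distrib_right)
  also have "\<dots> = (\<Sum>j\<in>UNIV. \<Sum>i\<in>UNIV. B $ i $ j * x $ j * y $ i)"
    by (rule sum.swap)
  also have "\<dots> = - (\<Sum>j\<in>UNIV. \<Sum>i\<in>UNIV. B $ j $ i * y $ i * x $ j)"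
    unfolding sum_negf[symmetric]
  proof (intro sum.cong refl)
    fix i j
    show "B $ i $ j * x $ j * y $ i = - (B $ j $ i * y $ i * x $ j)"
      unfolding B[of i j] by (simp add: mult.commute mult.left_commute)
  qed
  also have "\<dots> = - scalar_product (B *v y) x"
    by (simp add: scalar_product_def matrix_vector_mult_def sum_distrib_right)
  finally show ?thesis .
qed

lemma w_skew: "w s r = - w r s"
  unfolding w_def by (rule scalar_product_skew)

lemma w_self [simp]: "w r r = 0"
  using w_skew[of r r] unfolding eq_neg_iff_add_eq_0 by simp

lemma mult_B_inj:
  assumes "B *v x = 0"
  shows "x = 0"
proof -
  obtain A where "A ** B = mat 1" using inv by (auto simp: invertible_def)
  then have "x = A *v (B *v x)" by (simp add: matrix_vector_mul_assoc)
  with assms show ?thesis by simp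
qed

lemma w_nondegenerate: "s \<noteq> 0 \<Longrightarrow> \<exists>u. w u s \<noteq> 0"
proof (rule ccontr)
  assume s: "s \<noteq> 0" and "\<not> ?thesis"
  then have *: "w s u = 0" for u using w_skew[of s u] by simp
  have "(B *v cvec s) $ i = 0" for i
  proof -
    have "w s (axis i 1) = (\<Sum>j\<in>UNIV. if j = i then (B *v cvec s) $ j else 0)"
      unfolding w_def scalar_product_def by (intro sum.cong refl) (simp add: cvec_def axis_def)
    then show ?thesis using * by simp
  qed
  then have "B *v cvec s = 0" by (simp add: vec_eq_iff)
  then have "cvec s = 0" by (rule mult_B_inj)
  with s show False using cvec_eq_iff[of s 0] by simp
qed

lemma ddr_simps [simp]:
  "ddr u (f + g) = ddr u f + ddr u g" "ddr u (f - g) = ddr u f - ddr u g"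
  "ddr u (lscale c f) = lscale c (ddr u f)" "ddr (u + v) f = ddr u f + ddr v f"
  "ddr (u - v) f = ddr u f - ddr v f" "ddr u 0 = 0" "ddr u 1 = 0"
  "ddr u (tpow k) = lscale (w u k) (tpow k)"
  by (simp_all add: ddr_def w_def matrix_vector_right_distrib matrix_vector_mult_diff_distrib)

lemma ddr_mult: "ddr u (f * g) = ddr u f * g + f * ddr u g"
  by (simp add: ddr_def der_mult)

lemma ddr_power_Suc: "ddr u ((tpow s - 1) ^ Suc n)
    = lscale (of_nat (Suc n) * w u s) (tpow s * (tpow s - 1) ^ n)"
  unfolding ddr_def der_power_Suc by (simp add: w_def mult.commute)

lemma ddr_subst_tpow: "ddr u (subst_tpow s p) = lscale (w u s) (subst_tpow s ([:0, 1:] * pderiv p))"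
  unfolding ddr_def w_def by (rule der_subst_tpow)

lemma ddr_aug_pow: "f \<in> aug_pow (Suc d) \<Longrightarrow> ddr u f \<in> aug_pow d"
  unfolding ddr_def by (rule der_aug_pow)

end

text \<open>What is kept of the jet module: the operators on one weight space \<open>V0\<close>.
  Both \<open>P\<close>, which will be a projection onto \<open>V0\<close>, and
  \<open>\<tau> r\<close> act on the whole type. By \<open>T_P\<close> the operator
  \<open>\<tau> r\<close> sees a vector only through \<open>P\<close>, so identities on
  \<open>V0\<close> become identities of endomorphisms.\<close>

locale jet_core = symplectic_lattice B + vector_space sc
  for B :: "complex^'n^'n::finite" and sc :: "complex \<Rightarrow> 'v::ab_group_add \<Rightarrow> 'v" +
  fixes V0 :: "'v set" and P :: "'v aend" and \<tau> :: "int^'n \<Rightarrow> 'v aend"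
  assumes V0_sub: "subspace V0" and V0_fd: "fin_dim sc V0"
    and P_mem: "app P v \<in> V0"
    and T_scale: "app (\<tau> r) (sc c v) = sc c (app (\<tau> r) v)" and T_mem: "app (\<tau> r) v \<in> V0"
    and T_P: "\<tau> r * P = \<tau> r" and T_0: "\<tau> 0 = 0"
    and T_br: "app (\<tau> r * \<tau> s - \<tau> s * \<tau> r) v = sc (w r s) (app (\<tau> (r + s) - \<tau> r - \<tau> s) v)"
    and V0_nonzero: "V0 \<noteq> {0}"
    and irr: "\<lbrakk>subspace U; U \<subseteq> V0; \<And>r u. u \<in> U \<Longrightarrow> app (\<tau> r) u \<in> U\<rbrakk> \<Longrightarrow> U = {0} \<or> U = V0"
begin

definition esc :: "complex \<Rightarrow> 'v aend \<Rightarrow> 'v aend" where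
  "esc c a = Aend (\<lambda>v. sc c (app a v))"

lemma app_esc [simp]: "app (esc c a) v = sc c (app a v)"
  unfolding esc_def by (subst app_Aend) (simp_all add: app_add scale_right_distrib)

sublocale E: vector_space esc
  by standard (rule aend_eqI, simp add: scale_right_distrib scale_left_distrib)+

lemma esc_mult_left [simp]: "esc c a * b = esc c (a * b)"
  by (rule aend_eqI) simp

definition homog :: "'v aend \<Rightarrow> bool" where
  "homog a \<longleftrightarrow> (\<forall>c v. app a (sc c v) = sc c (app a v))"

lemma esc_mult_right [simp]: "homog a \<Longrightarrow> a * esc c b = esc c (a * b)"
  by (rule aend_eqI) (simp add: homog_def)

definition End0 :: "'v aend set" where
  "End0 = {a. homog a \<and> (\<forall>v. app a v \<in> V0) \<and> a * P = a}"

lemma End0_homog [simp]: "a \<in> End0 \<Longrightarrow> homog a"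
  and End0_mem: "a \<in> End0 \<Longrightarrow> app a v \<in> V0"
  and End0_mult_P: "a \<in> End0 \<Longrightarrow> a * P = a"
  unfolding End0_def by blast+

lemma End0_P: "a \<in> End0 \<Longrightarrow> app a (app P v) = app a v"
  using app_simps(6)[of a P v] End0_mult_P[of a] by simp

lemma End0I: "homog a \<Longrightarrow> (\<And>v. app a v \<in> V0) \<Longrightarrow> a * P = a \<Longrightarrow> a \<in> End0"
  unfolding End0_def by blast

lemma homog_closed: "homog 0" "homog 1" "homog a \<Longrightarrow> homog b \<Longrightarrow> homog (a + b)"
  "homog a \<Longrightarrow> homog b \<Longrightarrow> homog (a - b)" "homog a \<Longrightarrow> homog (esc c a)"
  "homog a \<Longrightarrow> homog b \<Longrightarrow> homog (a * b)"
  by (simp_all add: homog_def scale_right_distrib scale_right_diff_distrib mult.commute)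

lemma End0_closed: "0 \<in> End0" "a \<in> End0 \<Longrightarrow> b \<in> End0 \<Longrightarrow> a + b \<in> End0"
  "a \<in> End0 \<Longrightarrow> b \<in> End0 \<Longrightarrow> a - b \<in> End0" "a \<in> End0 \<Longrightarrow> esc c a \<in> End0"
  "homog a \<Longrightarrow> (\<And>v. v \<in> V0 \<Longrightarrow> app a v \<in> V0) \<Longrightarrow> b \<in> End0 \<Longrightarrow> a * b \<in> End0"
  using V0_sub
  by (auto intro!: End0I simp: homog_closed distrib_right left_diff_distrib mult.assoc End0_mult_P End0_mem
      subspace_add subspace_diff subspace_scale subspace_0)

lemma End0_mult: "a \<in> End0 \<Longrightarrow> b \<in> End0 \<Longrightarrow> a * b \<in> End0"
  by (rule End0_closed(5)) (simp_all add: End0_mem)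

lemma End0_eqI: "a \<in> End0 \<Longrightarrow> b \<in> End0 \<Longrightarrow> (\<And>v. v \<in> V0 \<Longrightarrow> app a v = app b v) \<Longrightarrow> a = b"
  by (rule aend_eqI) (metis End0_P P_mem)

lemma T_End0: "\<tau> r \<in> End0"
  by (rule End0I) (simp_all add: homog_def T_scale T_mem T_P)

lemma T_bracket: "\<tau> r * \<tau> s - \<tau> s * \<tau> r = esc (w r s) (\<tau> (r + s) - \<tau> r - \<tau> s)"
  by (rule aend_eqI) (use T_br in simp)

lemma End0_fd: "\<exists>F. finite F \<and> End0 \<subseteq> E.span F"
proof -
  obtain S where S: "finite S" "V0 \<subseteq> span S" using V0_fd by (auto simp: fin_dim_def)
  obtain Bs where Bs: "Bs \<subseteq> V0" "independent Bs" "V0 \<subseteq> span Bs"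
    using maximal_independent_subset by blast
  have fin: "finite Bs"
    using independent_span_bound[OF S(1) Bs(2)] Bs(1) S(2) by auto
  define R where "R v = representation Bs (app P v)" for v
  have Pspan: "app P v \<in> span Bs" for v using P_mem Bs(3) by blast
  \<comment> \<open>Matrix units for the basis \<open>Bs\<close>, precomposed with \<open>P\<close>
    so that they are defined on the whole type.\<close>
  define U where "U b b' = Aend (\<lambda>v. sc (R v b) b')" for b b'
  have U: "app (U b b') v = sc (R v b) b'" for b b' v
    unfolding U_def
    by (subst app_Aend) (simp_all add: R_def app_add representation_add[OF Bs(2) Pspan Pspan] scale_left_distrib)
  define F where "F = (\<lambda>(b, b'). U b b') ` (Bs \<times> Bs)"
  have "a \<in> E.span F" if a: "a \<in> End0" for a
  proof -
    have a_sum: "app a (\<Sum>b\<in>K. sc (g b) b) = (\<Sum>b\<in>K. sc (g b) (app a b))" for g K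
      using a by (induct K rule: infinite_finite_induct) (simp_all add: app_add End0_def homog_def)
    have aB: "app a b = (\<Sum>b'\<in>Bs. sc (representation Bs (app a b) b') b')" for b
      using sum_representation_eq[OF Bs(2) subsetD[OF Bs(3) End0_mem[OF a]] fin subset_refl, of b] by (rule sym)
    have "a = (\<Sum>b\<in>Bs. \<Sum>b'\<in>Bs. esc (representation Bs (app a b) b') (U b b'))"
    proof (rule aend_eqI)
      fix v
      have "app a v = app a (\<Sum>b\<in>Bs. sc (R v b) b)"
        using sum_representation_eq[OF Bs(2) Pspan fin subset_refl, of v] End0_P[OF a] by (simp add: R_def)
      also have "\<dots> = (\<Sum>b\<in>Bs. sc (R v b) (\<Sum>b'\<in>Bs. sc (representation Bs (app a b) b') b'))"
        unfolding a_sum by (intro sum.cong refl) (subst aB, rule refl)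
      also have "\<dots> = app (\<Sum>b\<in>Bs. \<Sum>b'\<in>Bs. esc (representation Bs (app a b) b') (U b b')) v"
        by (simp add: app_sum U scale_sum_right mult.commute)
      finally show "app a v = app (\<Sum>b\<in>Bs. \<Sum>b'\<in>Bs. esc (representation Bs (app a b) b') (U b b')) v" .
    qed
    moreover have "(\<Sum>b\<in>Bs. \<Sum>b'\<in>Bs. esc (representation Bs (app a b) b') (U b b')) \<in> E.span F"
      by (intro E.span_sum E.span_scale E.span_base) (auto simp: F_def)
    ultimately show ?thesis by simp
  qed
  then show ?thesis using fin by (intro exI[of _ F]) (auto simp: F_def)
qed

text \<open>Horner's scheme. The constant term multiplies the identity of the whole type, which need
  not lie in the finite dimensional \<open>End0\<close>; annihilating polynomials are therefore
  sought among those without constant term.\<close>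

definition peval :: "'v aend \<Rightarrow> complex poly \<Rightarrow> 'v aend" where
  "peval a p = fold_coeffs (\<lambda>c q. esc c 1 + a * q) p 0"

lemma peval_pCons: "peval a (pCons c p) = esc c 1 + a * peval a p"
  by (cases "c = 0 \<and> p = 0") (auto simp: peval_def)

lemma peval_0 [simp]: "peval a 0 = 0"
  by (simp add: peval_def)

lemma peval_homog: "homog a \<Longrightarrow> homog (peval a p)"
  by (induct p) (simp_all add: peval_pCons homog_closed)

lemma peval_add: "peval a (p + q) = peval a p + peval a q"
proof (induct p arbitrary: q)
  case (pCons c p)
  show ?case
    by (cases q) (simp add: peval_pCons pCons(2) E.scale_left_distrib distrib_left)
qed simp

lemma peval_smult: "homog a \<Longrightarrow> peval a (smult c p) = esc c (peval a p)"
  by (induct p) (simp_all add: peval_pCons E.scale_right_distrib)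

lemma peval_diff: "homog a \<Longrightarrow> peval a (p - q) = peval a p - peval a q"
  using peval_add[of a "p - q" q] by (simp add: algebra_simps)

lemma peval_comm: "homog a \<Longrightarrow> peval a p * a = a * peval a p"
  by (induct p) (simp_all add: peval_pCons distrib_left distrib_right mult.assoc)

lemma peval_monom: "homog a \<Longrightarrow> peval a (monom c n) = esc c (a ^ n)"
  by (induct n) (simp_all add: peval_pCons monom_0 monom_Suc)

lemma peval_End0: "a \<in> End0 \<Longrightarrow> peval a (pCons 0 p) \<in> End0"
proof -
  assume a: "a \<in> End0"
  have "app (peval a p) v \<in> V0" if "v \<in> V0" for v
    using that by (induct p) (simp_all add: peval_pCons subspace_0[OF V0_sub] subspace_add[OF V0_sub]
        subspace_scale[OF V0_sub] End0_mem[OF a])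
  with a have "peval a p * a \<in> End0" by (intro End0_closed(5) peval_homog) auto
  with a show ?thesis by (simp add: peval_pCons peval_comm)
qed

text \<open>The commutator with \<open>h\<close> is a derivation whose value \<open>y\<close> at
  \<open>a\<close> commutes with \<open>a\<close>, so on polynomials in \<open>a\<close> it acts as
  \<open>y\<close> times the derivative.\<close>

lemma commutator_peval:
  assumes h: "homog h" and a: "homog a" and y: "h * a - a * h = y" and ya: "y * a = a * y"
  shows "h * peval a p - peval a p * h = y * peval a (pderiv p)"
proof (induct p)
  case (pCons c p)
  have ha: "h * a = a * h + y" using y by (simp add: algebra_simps)
  have IH: "h * peval a p = peval a p * h + y * peval a (pderiv p)"
    using pCons(2) by (simp add: algebra_simps)
  have "h * peval a (pCons c p) = esc c h + (a * h + y) * peval a p"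
    by (simp add: peval_pCons distrib_left h flip: mult.assoc ha)
  also have "\<dots> = esc c h + a * (h * peval a p) + y * peval a p"
    by (simp add: distrib_right mult.assoc)
  also have "\<dots> = esc c h + a * peval a p * h + a * y * peval a (pderiv p) + y * peval a p"
    by (simp add: IH distrib_left mult.assoc)
  finally show ?case
    by (simp add: peval_pCons pderiv_pCons peval_add distrib_left distrib_right mult.assoc flip: ya)
qed simp

text \<open>The minimal polynomial of \<open>a\<close> is compared with its derivative, which the commutator with \<open>h\<close>
  turns into another polynomial relation.\<close>

lemma nilpotent_of_commutator:
  assumes a: "a \<in> End0" and h: "homog h" and y: "h * a - a * h = y" and ya: "y * a = a * y"
    and H: "\<And>p. y * peval a p = 0 \<Longrightarrow> peval a p * a = 0"
  shows "\<exists>n>0. a ^ n = 0"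
proof -
  have ah: "homog a" using a by simp
  obtain F where F: "finite F" "End0 \<subseteq> E.span F" using End0_fd by blast
  have "\<exists>p. p \<noteq> 0 \<and> peval a (pCons 0 p) = 0"
  proof (rule E.exists_poly_in_kernel[OF _ _ F(1)])
    fix p q :: "complex poly" and c :: complex
    have "pCons 0 (p + q) = pCons 0 p + pCons 0 q" by simp
    then show "peval a (pCons 0 (p + q)) = peval a (pCons 0 p) + peval a (pCons 0 q)"
      by (simp only: peval_add)
    have "pCons 0 (smult c p) = smult c (pCons 0 p)" by simp
    then show "peval a (pCons 0 (smult c p)) = esc c (peval a (pCons 0 p))"
      using peval_smult[OF ah] by (simp only:)
    show "peval a (pCons 0 p) \<in> E.span F" using peval_End0[OF a] F(2) by blast
  qed
  then have ex: "\<exists>p. p \<noteq> 0 \<and> coeff p 0 = 0 \<and> peval a p = 0"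
    by (metis coeff_pCons_0 pCons_eq_0_iff)
  then obtain p where p: "p \<noteq> 0" "coeff p 0 = 0" "peval a p = 0"
    and min: "\<And>q. q \<noteq> 0 \<Longrightarrow> coeff q 0 = 0 \<Longrightarrow> peval a q = 0 \<Longrightarrow> degree p \<le> degree q"
    using ex_has_least_nat[of "\<lambda>p. p \<noteq> 0 \<and> coeff p 0 = 0 \<and> peval a p = 0" _ degree] by metis
  have n: "degree p > 0"
  proof (rule ccontr)
    assume "\<not> degree p > 0"
    then obtain c where "p = [:c:]" by (metis degree_eq_zeroE neq0_conv)
    with p show False by simp
  qed
  have "y * peval a (pderiv p) = 0"
    using commutator_peval[OF h ah y ya, of p] p(3) by simp
  then have "peval a (pCons 0 (pderiv p)) = 0"
    using H by (simp add: peval_pCons peval_comm[OF ah])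
  \<comment> \<open>This combination cancels the leading term of \<open>p\<close> and again
    annihilates \<open>a\<close>. Minimality makes it zero, which leaves \<open>p\<close> with its
    leading term only.\<close>
  define q where "q = smult (of_nat (degree p)) p - pCons 0 (pderiv p)"
  have q: "coeff q i = (of_nat (degree p) - of_nat i) * coeff p i" for i
    by (cases i) (simp_all add: q_def coeff_pderiv algebra_simps p)
  have "peval a q = 0"
    using \<open>peval a (pCons 0 (pderiv p)) = 0\<close> p(3)
    by (simp add: q_def peval_diff[OF ah] peval_smult[OF ah])
  have "q = 0"
  proof (rule ccontr)
    assume "q \<noteq> 0"
    then have "degree p \<le> degree q" using min \<open>peval a q = 0\<close> by (simp add: q p(2))
    moreover have "coeff q (degree q) \<noteq> 0" using \<open>q \<noteq> 0\<close> by simp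
    ultimately show False using q[of "degree q"] coeff_eq_0[of p "degree q"] by (cases "degree p = degree q") auto
  qed
  have "p = monom (lead_coeff p) (degree p)"
  proof (rule poly_eqI)
    fix i
    show "coeff p i = coeff (monom (lead_coeff p) (degree p)) i"
      using q[of i] \<open>q = 0\<close> by (cases "i = degree p") auto
  qed
  then have "esc (lead_coeff p) (a ^ degree p) = 0"
    using p(3) peval_monom[OF ah] by metis
  then have "a ^ degree p = 0" using p(1) by simp
  with n show ?thesis by blast
qed

lemma nilpotent_of_eigenvector:
  assumes "a \<in> End0" "h \<in> End0" "h * a - a * h = esc c a" "c \<noteq> 0"
  shows "\<exists>n>0. a ^ n = 0"
proof (rule nilpotent_of_commutator[OF assms(1) _ assms(3)])
  fix p assume "esc c a * peval a p = 0"
  then show "peval a p * a = 0" using assms by (simp add: peval_comm)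
qed (use assms in simp_all)

text \<open>The kernel of \<open>c\<close> is invariant, so a nonzero \<open>c\<close> is injective
  on \<open>V0\<close>. Then \<open>a\<close> is nilpotent, and bracketing the first vanishing power
  \<open>a ^ n\<close> with \<open>h\<close> gives \<open>n c a ^ (n - 1) = 0\<close>, against the
  choice of \<open>n\<close>.\<close>

lemma central_commutator_eq_0:
  assumes a: "a \<in> End0" and h: "h \<in> End0" and c: "h * a - a * h = c"
    and central: "\<And>r. c * \<tau> r = \<tau> r * c" and ca: "c * a = a * c"
  shows "c = 0"
proof (rule ccontr)
  assume c0: "c \<noteq> 0"
  have cE: "c \<in> End0" unfolding c[symmetric] by (intro End0_closed(3) End0_mult a h)
  let ?U = "{v \<in> V0. app c v = 0}"
  have "subspace ?U"
    using V0_sub cE by (auto simp: subspace_def app_add End0_def homog_def)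
  moreover have "app (\<tau> r) u \<in> ?U" if "u \<in> ?U" for r u
    using that app_simps(6)[of c "\<tau> r" u] central[of r] T_mem[of r u] by simp
  ultimately have "?U = {0} \<or> ?U = V0" by (intro irr) auto
  moreover have "?U \<noteq> V0"
    using End0_eqI[OF cE End0_closed(1)] c0 by auto
  ultimately have inj: "v = 0" if "v \<in> V0" "app c v = 0" for v using that by blast
  have inj': "z = 0" if "z \<in> End0" "c * z = 0" for z
  proof (rule aend_eqI)
    fix v
    show "app z v = app 0 v"
      using inj[OF End0_mem[OF that(1), of v]] app_simps(6)[of c z v] that(2) by simp
  qed
  have ex: "\<exists>n>0. a ^ n = 0"
  proof (rule nilpotent_of_commutator[OF a _ c ca])
    fix p assume "c * peval a p = 0"
    then have "c * (peval a p * a) = 0" by (simp flip: mult.assoc)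
    moreover have "peval a p * a \<in> End0"
      using peval_End0[OF a, of p] a by (simp add: peval_pCons peval_comm)
    ultimately show "peval a p * a = 0" by (rule inj'[rotated])
  qed (use h in simp)
  define n where "n = (LEAST n. n > 0 \<and> a ^ n = 0)"
  have n: "n > 0" "a ^ n = 0" using LeastI_ex[OF ex] by (simp_all add: n_def)
  have least: "n \<le> k" if "k > 0" "a ^ k = 0" for k unfolding n_def using that by (intro Least_le) simp
  have ah: "homog a" using a by simp
  have hh: "homog h" using h by simp
  have "h * peval a (monom 1 n) - peval a (monom 1 n) * h = c * peval a (pderiv (monom 1 n))"
    by (rule commutator_peval[OF hh ah c ca])
  then have "c * esc (of_nat n) (a ^ (n - 1)) = 0"
    using n by (simp add: peval_monom[OF ah] pderiv_monom)
  then have "c * a ^ (n - 1) = 0" using n cE by simp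
  \<comment> \<open>The case \<open>n = 1\<close> is separate: \<open>a ^ 0\<close> is the identity,
    which is not known to lie in \<open>End0\<close>, so \<open>inj'\<close> does not apply to
    it.\<close>
  show False
  proof (cases "n = 1")
    case True
    with n have "a = 0" by simp
    with c c0 show False by simp
  next
    case False
    with n obtain m where m: "n - 1 = Suc m" by (cases "n - 1") auto
    have "a ^ Suc k \<in> End0" for k by (induct k) (simp_all add: a End0_mult)
    with m \<open>c * a ^ (n - 1) = 0\<close> have "a ^ (n - 1) = 0" using inj' by auto
    with least[of "n - 1"] n False show False by simp
  qed
qed

end

section \<open>Annihilating polynomials in one direction\<close>

lemma cvec_axis_multiple:
  fixes r :: "int^'n"
  assumes "\<And>j. j \<noteq> i \<Longrightarrow> r $ j = 0"
  shows "cvec r = of_int (r $ i) *s cvec (axis i 1)"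
  using assms by (auto simp: cvec_def axis_def vec_eq_iff)

context jet_core
begin

definition TT :: "'n laurent \<Rightarrow> 'v aend" where
  "TT f = (\<Sum>k\<in>Poly_Mapping.keys f. esc (Poly_Mapping.lookup f k) (\<tau> k))"

lemma TT_add [simp]: "TT (f + g) = TT f + TT g"
  unfolding TT_def by (rule setsum_keys_plus_distrib) (simp_all add: E.scale_left_distrib)

lemma TT_lscale [simp]: "TT (lscale c f) = esc c (TT f)"
proof (cases "c = 0")
  case False
  then have "Poly_Mapping.keys (lscale c f) = Poly_Mapping.keys f"
    by (auto simp: in_keys_iff)
  then show ?thesis by (simp add: TT_def E.scale_sum_right)
qed (simp add: TT_def)

lemma TT_tpow [simp]: "TT (tpow k) = \<tau> k"
  by (simp add: TT_def tpow_def)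

lemma TT_0 [simp]: "TT 0 = 0" and TT_1 [simp]: "TT 1 = 0"
  using TT_tpow[of 0] by (simp_all add: TT_def T_0)

lemma TT_diff [simp]: "TT (f - g) = TT f - TT g"
  using TT_add[of "f - g" g] by simp

lemma TT_minus [simp]: "TT (- f) = - TT f"
  using TT_diff[of 0 f] by simp

lemma TT_sum: "TT (\<Sum>i\<in>I. f i) = (\<Sum>i\<in>I. TT (f i))"
  by (induct I rule: infinite_finite_induct) simp_all

lemma TT_End0: "TT f \<in> End0"
  by (induct f rule: laurent_induct) (simp_all add: End0_closed T_End0)

lemma TT_homog [simp]: "homog (TT f)" and tau_homog [simp]: "homog (\<tau> r)"
  using TT_End0 T_End0 by simp_all

text \<open>The part \<open>T(r + s) - T(s)\<close> of the bracket is multiplication by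
  \<open>tpow r - 1\<close>. The part \<open>- T(r)\<close> does not involve the exponent
  \<open>s\<close> occurring in \<open>g\<close>, and its coefficients add up to
  \<open>eps (ddr r g)\<close>.\<close>

lemma T_TT_bracket:
  "\<tau> r * TT g - TT g * \<tau> r = TT ((tpow r - 1) * ddr r g) - esc (eps (ddr r g)) (\<tau> r)"
proof (induct g rule: laurent_induct)
  case (monom c k)
  have "\<tau> r * TT (lscale c (tpow k)) - TT (lscale c (tpow k)) * \<tau> r = esc c (\<tau> r * \<tau> k - \<tau> k * \<tau> r)"
    by (simp add: E.scale_right_diff_distrib)
  also have "\<dots> = esc (c * w r k) (\<tau> (r + k) - \<tau> r - \<tau> k)"
    by (simp add: T_bracket)
  also have "\<dots> = TT ((tpow r - 1) * ddr r (lscale c (tpow k))) - esc (eps (ddr r (lscale c (tpow k)))) (\<tau> r)"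
    by (simp add: left_diff_distrib tpow_add[symmetric] E.scale_right_diff_distrib)
  finally show ?case .
next
  case (add f g)
  have "\<tau> r * TT (f + g) - TT (f + g) * \<tau> r
      = (\<tau> r * TT f - TT f * \<tau> r) + (\<tau> r * TT g - TT g * \<tau> r)"
    by (simp add: algebra_simps)
  then show ?case
    by (simp only: add TT_add ddr_simps distrib_left eps_add E.scale_left_distrib) simp
qed

lemma T_TT_bracket_aug:
  "eps (ddr r g) = 0 \<Longrightarrow> \<tau> r * TT g - TT g * \<tau> r = TT ((tpow r - 1) * ddr r g)"
  using T_TT_bracket[of r g] by simp

text \<open>A vanishing operator has vanishing brackets, so every element killed by
  \<open>TT\<close> yields a further relation. This is how relations spread from one line to
  another.\<close>

lemma ddr_kernel:
  assumes "TT g = 0" "eps (ddr r g) = 0"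
  shows "TT (tpow r * ddr r g) = TT (ddr r g)"
  using T_TT_bracket_aug[OF assms(2)] assms(1) by (simp add: left_diff_distrib)

lemma eps_ddr: "g \<in> aug_pow 2 \<Longrightarrow> eps (ddr r g) = 0"
  using ddr_aug_pow[of g 1 r] eps_aug_pow[of "ddr r g" 0] by (simp add: numeral_2_eq_2)

text \<open>An ideal of polynomials, because \<open>w (r + s) s = w r s\<close>. The condition
  \<open>w r s \<noteq> 0\<close> allows division by the factor that differentiation along the line
  produces.\<close>

definition ann :: "int^'n \<Rightarrow> complex poly set" where
  "ann s = {q. \<forall>r. w r s \<noteq> 0 \<longrightarrow> TT (tpow r * subst_tpow s q) = 0}"

lemma ann_0: "0 \<in> ann s"
  and ann_add: "p \<in> ann s \<Longrightarrow> q \<in> ann s \<Longrightarrow> p + q \<in> ann s"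
  and ann_smult: "p \<in> ann s \<Longrightarrow> smult c p \<in> ann s"
  by (simp_all add: ann_def distrib_left)

lemma ann_tpow_mult:
  "q \<in> ann s \<Longrightarrow> w r s \<noteq> 0 \<Longrightarrow> TT (tpow r * (tpow s * subst_tpow s q)) = 0"
  using w_simps(1)[of r s s] by (auto simp: ann_def tpow_add[symmetric] mult.assoc[symmetric])

lemma ann_mult: "q \<in> ann s \<Longrightarrow> p * q \<in> ann s"
proof (induct p)
  case (pCons c p)
  have "pCons 0 (p * q) \<in> ann s"
    unfolding ann_def using pCons
    by (auto simp: subst_tpow_pCons[of _ 0] ann_tpow_mult simp del: subst_tpow_mult mult_pCons_left)
  then show ?case using pCons by (simp add: ann_add ann_smult)
qed (simp add: ann_0)

lemma annD: "q \<in> ann s \<Longrightarrow> w r s \<noteq> 0 \<Longrightarrow> TT (tpow r * subst_tpow s q) = 0"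
  by (simp add: ann_def)

text \<open>Finite dimension gives a relation on the line through 0 only. Its bracket with
  \<open>T(r)\<close> shows that \<open>TT (tpow r * f)\<close> is the same for all \<open>r\<close>
  with \<open>w r s \<noteq> 0\<close>; hence its difference along \<open>s\<close> vanishes on all
  these lines at once.\<close>

lemma ann_nonzero: "\<exists>q. q \<noteq> 0 \<and> q \<in> ann s"
proof -
  obtain F where F: "finite F" "End0 \<subseteq> E.span F" using End0_fd by blast
  \<comment> \<open>The factor \<open>(x - 1)^2\<close> places the element in I^2, where the
    \<open>eps\<close> term of the bracket vanishes, and keeps \<open>g\<close> from being
    constant.\<close>
  have "\<exists>p. p \<noteq> 0 \<and> TT (subst_tpow s ([:-1, 1:] ^ 2 * p)) = 0"
  proof (rule E.exists_poly_in_kernel[OF _ _ F(1)])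
    show "TT (subst_tpow s ([:-1, 1:] ^ 2 * p)) \<in> E.span F" for p using F(2) TT_End0 by blast
  qed (simp_all add: distrib_left del: subst_tpow_power)
  then obtain p where p: "p \<noteq> 0" "TT (subst_tpow s ([:-1, 1:] ^ 2 * p)) = 0" by blast
  define g where "g = [:-1, 1:] ^ 2 * p"
  define f where "f = subst_tpow s ([:0, 1:] * pderiv g)"
  have g: "g \<noteq> 0" "poly g 1 = 0" "TT (subst_tpow s g) = 0" using p by (simp_all add: g_def)
  have "pderiv g \<noteq> 0"
  proof
    assume "pderiv g = 0"
    then obtain c where "g = [:c:]" using pderiv_eq_0_iff degree_eq_zeroE by blast
    with g show False by simp
  qed
  have "subst_tpow s g \<in> aug_pow 2"
    by (simp add: g_def subst_tpow_linear aug_pow_mult' tpow_diff_one_power_mem)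
  from eps_ddr[OF this]
  have *: "TT (tpow r * ddr r (subst_tpow s g)) = TT (ddr r (subst_tpow s g))" for r
    using g(3) by (intro ddr_kernel)
  have f: "TT (tpow r * f) = TT f" if "w r s \<noteq> 0" for r
    using *[of r] that by (simp add: ddr_subst_tpow f_def)
  have "[:-1, 1:] * ([:0, 1:] * pderiv g) \<in> ann s"
    unfolding ann_def
  proof (intro CollectI allI impI)
    fix r assume r: "w r s \<noteq> 0"
    then have "TT (tpow (r + s) * f) = TT (tpow r * f)" using f[of r] f[of "r + s"] by simp
    moreover have "tpow r * ((tpow s - 1) * f) = tpow (r + s) * f - tpow r * f"
      by (simp add: tpow_add algebra_simps)
    ultimately show "TT (tpow r * subst_tpow s ([:-1, 1:] * ([:0, 1:] * pderiv g))) = 0"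
      by (simp only: subst_tpow_mult[of s "[:-1, 1:]"] subst_tpow_linear f_def[symmetric] TT_diff diff_self)
  qed
  moreover have "[:-1, 1:] * ([:0, 1:] * pderiv g) \<noteq> 0"
    using \<open>pderiv g \<noteq> 0\<close> by (simp del: mult_pCons_left)
  ultimately show ?thesis by blast
qed

lemma ann_pderiv:
  assumes q: "q \<in> ann s"
  shows "[:-1, 1:] * ([:0, 1:] * pderiv ([:-1, 1:] ^ 2 * q)) \<in> ann s"
proof -
  define q' where "q' = [:-1, 1:] ^ 2 * q"
  define f where "f = subst_tpow s ([:0, 1:] * pderiv q')"
  have q': "q' \<in> ann s" unfolding q'_def using q by (rule ann_mult)
  have aug: "subst_tpow s q' \<in> aug_pow 2"
    by (simp add: q'_def subst_tpow_linear aug_pow_mult' tpow_diff_one_power_mem)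
  \<comment> \<open>Bracketing with \<open>T(b)\<close> carries the relation from the line through
    \<open>a\<close> to the line through \<open>a + b\<close>. The undifferentiated term is killed
    on both lines, so only the term with the derivative of \<open>q'\<close> is left.\<close>
  have step: "TT (tpow (a + b) * f) = TT (tpow a * f)"
    if "w a s \<noteq> 0" "w (a + b) s \<noteq> 0" "w b s \<noteq> 0" for a b
  proof -
    have d: "ddr b (tpow a * subst_tpow s q')
        = lscale (w b a) (tpow a * subst_tpow s q') + lscale (w b s) (tpow a * f)"
      by (simp add: ddr_mult ddr_subst_tpow f_def)
    have "TT (tpow b * ddr b (tpow a * subst_tpow s q')) = TT (ddr b (tpow a * subst_tpow s q'))"
      by (rule ddr_kernel) (simp_all add: annD[OF q'] that aug_pow_mult aug eps_ddr)
    then show ?thesis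
      using that annD[OF q', of a] annD[OF q', of "a + b"]
      by (simp add: d distrib_left mult.assoc[symmetric] tpow_add[symmetric] add.commute)
  qed
  have "TT (tpow r * ((tpow s - 1) * f)) = 0" if r: "w r s \<noteq> 0" for r
  proof -
    \<comment> \<open>There is no direct step from \<open>r\<close> to \<open>r + s\<close>, because
      \<open>w s s = 0\<close>. Both are reached from \<open>- r\<close>, by adding
      \<open>r + r\<close> and \<open>r + r + s\<close>.\<close>
    have e: "- r + (r + r) = r" "- r + (r + r + s) = r + s" by (simp_all add: vec_eq_iff)
    have "w (r + r) s = 2 * w r s" "w (r + r + s) s = 2 * w r s" by (simp_all only: w_simps w_self) simp_all
    then have "TT (tpow r * f) = TT (tpow (- r) * f)"
      and "TT (tpow (r + s) * f) = TT (tpow (- r) * f)"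
      using step[of "- r" "r + r"] step[of "- r" "r + r + s"] r by (simp_all only: e w_simps w_self) simp_all
    moreover have "tpow r * ((tpow s - 1) * f) = tpow (r + s) * f - tpow r * f"
      by (simp add: tpow_add algebra_simps)
    ultimately show ?thesis by simp
  qed
  then show ?thesis
    by (simp only: ann_def q'_def[symmetric] mem_Collect_eq subst_tpow_mult[of s "[:-1, 1:]"] subst_tpow_linear f_def[symmetric]) simp
qed

text \<open>In the derivative supplied by \<open>ann_pderiv\<close>, a root of the generator other
  than 0 and 1 would lose one order. A root 0 would allow a factor \<open>tpow s\<close> to be
  cancelled, since that is a unit, and so lower the degree.\<close>

lemma ann_power: "\<exists>k. [:-1, 1:] ^ k \<in> ann s"
proof -
  obtain q where q: "q \<noteq> 0" "q \<in> ann s"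
    and min: "\<And>p. p \<noteq> 0 \<Longrightarrow> p \<in> ann s \<Longrightarrow> degree q \<le> degree p"
    using ex_has_least_nat[of "\<lambda>q. q \<noteq> 0 \<and> q \<in> ann s" _ degree] ann_nonzero by metis
  have dvd: "q dvd p" if "p \<in> ann s" for p
  proof (rule ccontr)
    assume "\<not> q dvd p"
    then have "p mod q \<noteq> 0" by (simp add: dvd_eq_mod_eq_0)
    moreover have "p mod q \<in> ann s"
    proof -
      have "p mod q = p + smult (- 1) (p div q * q)" by (simp add: minus_div_mult_eq_mod[symmetric])
      then show ?thesis by (simp only: ann_add ann_smult ann_mult that q)
    qed
    ultimately show False
      using min degree_mod_less'[of q p] q by fastforce
  qed
  have root: "x = 1" if x: "poly q x = 0" for x
  proof (rule ccontr)
    assume "x \<noteq> 1"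
    have "x \<noteq> 0"
    proof
      assume "x = 0"
      then obtain p where p: "q = pCons 0 p" using x by (cases q) auto
      have "p \<in> ann s"
        unfolding ann_def
      proof (intro CollectI allI impI)
        fix r assume "w r s \<noteq> 0"
        then have "TT (tpow (r - s) * subst_tpow s q) = 0" using q(2) by (simp add: annD)
        moreover have "tpow (r - s) * subst_tpow s q = tpow r * subst_tpow s p"
          by (simp add: p subst_tpow_pCons mult.assoc[symmetric] tpow_add[symmetric])
        ultimately show "TT (tpow r * subst_tpow s p) = 0" by simp
      qed
      with min[of p] p q(1) show False by (auto split: if_splits)
    qed
    let ?p = "[:-1, 1:] ^ 2 * q"
    have p0: "?p \<noteq> 0" using q(1) by simp
    have ord: "order x ?p = order x q" using \<open>x \<noteq> 1\<close> p0 by (simp add: order_mult order_0I)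
    have "q dvd [:-1, 1:] * ([:0, 1:] * pderiv ?p)" by (intro dvd ann_pderiv q)
    moreover have dp: "pderiv ?p \<noteq> 0"
    proof
      assume "pderiv ?p = 0"
      then obtain c where c: "?p = [:c:]" using pderiv_eq_0_iff degree_eq_zeroE by blast
      have "poly ?p x = 0" using x by simp
      with p0 c show False by simp
    qed
    then have nz: "[:-1, 1:] * ([:0, 1:] * pderiv ?p) \<noteq> 0" by (simp del: mult_pCons_left)
    ultimately have "order x q \<le> order x ([:-1, 1:] * ([:0, 1:] * pderiv ?p))"
      using dvd_imp_order_le by blast
    also have "\<dots> = order x (pderiv ?p)"
      using nz \<open>x \<noteq> 1\<close> \<open>x \<noteq> 0\<close> by (simp add: order_mult order_0I del: mult_pCons_left)
    finally have "order x ?p \<le> order x (pderiv ?p)" using ord by simp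
    moreover have "order x ?p \<noteq> 0" using x q(1) ord by (simp add: order_root)
    then have "order x ?p = Suc (order x (pderiv ?p))" using order_pderiv[OF p0, of x] order_root[of ?p x] p0 by simp
    ultimately show False by simp
  qed
  obtain p where p: "q = [:-1, 1:] ^ order 1 q * p" and np: "\<not> [:-1, 1:] dvd p"
    using order_decomp[OF q(1), of 1] by auto
  have "poly p x \<noteq> 0" for x
  proof
    assume "poly p x = 0"
    moreover from this have "poly q x = 0" by (subst p) simp
    ultimately show False using root[of x] np by (simp add: poly_eq_0_iff_dvd)
  qed
  then have "constant (poly p)" using fundamental_theorem_of_algebra by blast
  then obtain c where c: "p = [:c:]" using constant_degree degree_eq_zeroE by metis
  with p q(1) have "c \<noteq> 0" by auto
  then have "smult (1 / c) q = [:-1, 1:] ^ order 1 q" by (subst p) (simp add: c)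
  with ann_smult[OF q(2), of "1 / c"] show ?thesis by metis
qed

lemma ann_tpow_power: "\<exists>k. \<forall>r n. w r s \<noteq> 0 \<longrightarrow> k \<le> n \<longrightarrow> TT (tpow r * (tpow s - 1) ^ n) = 0"
proof -
  obtain k where k: "[:-1, 1:] ^ k \<in> ann s" using ann_power by blast
  have "TT (tpow r * (tpow s - 1) ^ n) = 0" if "w r s \<noteq> 0" "k \<le> n" for r n
  proof -
    have "[:-1, 1:] ^ n = [:-1, 1:] ^ (n - k) * ([:-1, 1:] ^ k :: complex poly)"
      using that by (simp flip: power_add)
    with ann_mult[OF k] have "[:-1, 1:] ^ n \<in> ann s" by simp
    from annD[OF this that(1)] show ?thesis by (simp add: subst_tpow_linear)
  qed
  then show ?thesis by blast
qed

end

section \<open>Killing a power of the augmentation ideal\<close>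

lemma additive_int_vec:
  fixes f :: "int^'n::finite \<Rightarrow> 'b::ab_group_add" and scale :: "complex \<Rightarrow> 'b \<Rightarrow> 'b"
  assumes "vector_space scale" and add: "\<And>r s. f (r + s) = f r + f s"
  shows "f r = (\<Sum>i\<in>UNIV. scale (of_int (r $ i)) (f (axis i 1)))"
proof -
  interpret vector_space scale by fact
  have f0: "f 0 = 0" using add[of 0 0] by simp
  have fdiff: "f (r - s) = f r - f s" for r s using add[of "r - s" s] by simp
  have ax: "f (axis i n) = scale (of_int n) (f (axis i 1))" for i n
  proof (induct n rule: int_induct[of _ 0])
    case base
    have "axis i (0::int) = (0 :: int^'n)" by (simp add: vec_eq_iff axis_def)
    then show ?case by (simp only: f0 of_int_0 scale_zero_left)
  next
    case (step1 n)
    have "axis i (n + 1) = axis i n + axis i 1" by (simp add: vec_eq_iff axis_def)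
    then show ?case by (simp add: add step1 scale_left_distrib)
  next
    case (step2 n)
    have "axis i (n - 1) = axis i n - axis i 1" by (simp add: vec_eq_iff axis_def)
    then show ?case by (simp add: fdiff step2 scale_left_diff_distrib)
  qed
  have fsum: "f (\<Sum>i\<in>I. g i) = (\<Sum>i\<in>I. f (g i))" for g and I :: "'n set"
    by (induct I rule: infinite_finite_induct) (simp_all add: f0 add)
  have "r = (\<Sum>i\<in>UNIV. axis i (r $ i))"
    by (simp add: vec_eq_iff axis_def)
  then have "f r = f (\<Sum>i\<in>UNIV. axis i (r $ i))" by (rule arg_cong)
  also have "\<dots> = (\<Sum>i\<in>UNIV. f (axis i (r $ i)))" by (rule fsum)
  also have "\<dots> = (\<Sum>i\<in>UNIV. scale (of_int (r $ i)) (f (axis i 1)))" by (subst ax) (rule refl)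
  finally show ?thesis .
qed

lemma lscale_power: "(lscale c (f :: 'n::finite laurent)) ^ k = lscale (c ^ k) (f ^ k)"
  by (induct k) (simp_all add: mult.commute)

lemma of_nat_mult_laurent: "of_nat n * (f :: 'n::finite laurent) = lscale (of_nat n) f"
  by (induct n) (simp_all add: lscale.scale_left_distrib algebra_simps)

text \<open>When a product of \<open>c + d\<close> elements of \<open>I + J\<close> is expanded,
  every term has at least \<open>c\<close> factors from \<open>I\<close> or at least
  \<open>d\<close> from \<open>J\<close>. The lists \<open>us\<close> and \<open>vs\<close> record
  the choices already made.\<close>

lemma prod_list_mem_sum_ideal:
  fixes R :: "'a::comm_ring_1 set"
  assumes add: "\<And>x y. x \<in> R \<Longrightarrow> y \<in> R \<Longrightarrow> x + y \<in> R" and mul: "\<And>c x. x \<in> R \<Longrightarrow> c * x \<in> R"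
    and I: "\<And>xs. set xs \<subseteq> I \<Longrightarrow> c \<le> length xs \<Longrightarrow> prod_list xs \<in> R"
    and J: "\<And>xs. set xs \<subseteq> J \<Longrightarrow> d \<le> length xs \<Longrightarrow> prod_list xs \<in> R"
    and "set us \<subseteq> I" "set vs \<subseteq> J" "\<forall>x\<in>set xs. \<exists>a\<in>I. \<exists>b\<in>J. x = a + b"
    and "c + d \<le> length us + length vs + length xs"
  shows "prod_list us * prod_list vs * prod_list xs \<in> R"
  using assms(5-)
proof (induct xs arbitrary: us vs)
  case Nil
  then consider "c \<le> length us" | "d \<le> length vs" by fastforce
  then show ?case
  proof cases
    case 1
    then have "prod_list vs * prod_list us \<in> R" using I Nil by (intro mul) auto
    then show ?thesis by (simp add: mult.commute)
  next
    case 2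
    then have "prod_list us * prod_list vs \<in> R" using J Nil by (intro mul) auto
    then show ?thesis by simp
  qed
next
  case (Cons x xs)
  then obtain a b where ab: "a \<in> I" "b \<in> J" "x = a + b" by auto
  have "prod_list (a # us) * prod_list vs * prod_list xs \<in> R" using Cons ab by (intro Cons(1)) auto
  moreover have "prod_list us * prod_list (b # vs) * prod_list xs \<in> R"
    using Cons ab by (intro Cons(1)) auto
  ultimately show ?case
    using add ab(3) by (fastforce simp: algebra_simps)
qed

text \<open>The exponents \<open>a\<close> for which this holds form a subgroup of the lattice that
  contains the unit vectors.\<close>

lemma tpow_diff_one_mem_span_axis:
  "tpow a - 1 \<in> module.span (*) {tpow (axis i 1) - 1 | i :: 'n::finite. True}" (is "_ \<in> ?M")
proof -
  note span = module.span_base[OF module_mult] module.span_add[OF module_mult]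
    module.span_diff[OF module_mult] module.span_scale[OF module_mult] module.span_zero[OF module_mult]
  have add: "tpow (r + s) - 1 \<in> ?M" if "tpow r - 1 \<in> ?M" "tpow s - 1 \<in> ?M" for r s
  proof -
    have "tpow (r + s) - 1 = tpow r * (tpow s - 1) + (tpow r - 1)" by (simp add: tpow_add algebra_simps)
    then show ?thesis using that by (simp only: span)
  qed
  have diff: "tpow (r - s) - 1 \<in> ?M" if "tpow r - 1 \<in> ?M" "tpow s - 1 \<in> ?M" for r s
  proof -
    have "tpow (r - s) - 1 = tpow (- s) * (tpow r - tpow s)"
      by (simp add: right_diff_distrib flip: tpow_add)
    also have "\<dots> = tpow (- s) * ((tpow r - 1) - (tpow s - 1))" by simp
    finally show ?thesis using that by (simp only: span)
  qed
  have z: "tpow 0 - 1 \<in> ?M" by (simp add: span)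
  have ax: "tpow (axis i n) - 1 \<in> ?M" for i n
  proof (induct n rule: int_induct[of _ 0])
    case base
    have "axis i (0::int) = (0 :: int^'n)" by (simp add: vec_eq_iff axis_def)
    with z show ?case by (simp only:)
  next
    case (step1 n)
    have "axis i (n + 1) = axis i n + axis i 1" by (simp add: vec_eq_iff axis_def)
    with step1 show ?case by (simp only:) (rule add, auto intro: span)
  next
    case (step2 n)
    have "axis i (n - 1) = axis i n - axis i 1" by (simp add: vec_eq_iff axis_def)
    with step2 show ?case by (simp only:) (rule diff, auto intro: span)
  qed
  have "tpow (\<Sum>i\<in>I. axis i (a $ i)) - 1 \<in> ?M" for I :: "'n set"
  proof (induct I rule: infinite_finite_induct)
    case (insert i I)
    show ?case unfolding sum.insert[OF insert(1,2)] by (rule add[OF ax insert(3)])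
  qed (use z in \<open>simp_all only: sum.empty sum.infinite simp_thms\<close>)
  moreover have "(\<Sum>i\<in>UNIV. axis i (a $ i)) = a" by (simp add: vec_eq_iff axis_def)
  ultimately show ?thesis by (metis (no_types))
qed

context symplectic_lattice
begin

lemma der_mult_B: "der (B *v z) f = (\<Sum>j\<in>UNIV. lscale (z $ j) (ddr (axis j 1) f))"
proof (rule poly_mapping_eqI)
  fix k
  have B: "(B *v cvec (axis j 1)) $ i = B $ i $ j" for i j
  proof -
    have "(B *v cvec (axis j 1)) $ i = (\<Sum>l\<in>UNIV. if l = j then B $ i $ l else 0)"
      unfolding matrix_vector_mult_def by (simp add: cvec_def axis_def if_distrib[of of_int] if_distrib[of "(*) _"] cong: if_cong)
    then show ?thesis by simp
  qed
  have "scalar_product (B *v z) (cvec k) = (\<Sum>j\<in>UNIV. z $ j * scalar_product (B *v cvec (axis j 1)) (cvec k))"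
    unfolding scalar_product_def B
    by (simp add: matrix_vector_mult_def sum_distrib_left sum_distrib_right mult.assoc mult.left_commute)
      (rule sum.swap)
  then show "Poly_Mapping.lookup (der (B *v z) f) k
      = Poly_Mapping.lookup (\<Sum>j\<in>UNIV. lscale (z $ j) (ddr (axis j 1) f)) k"
    by (simp add: lookup_sum ddr_def sum_distrib_right mult.assoc)
qed

lemma w_axis_multiple:
  assumes "\<And>j. j \<noteq> i \<Longrightarrow> r $ j = 0"
  shows "w u r = of_int (r $ i) * w u (axis i 1)"
  using cvec_axis_multiple[OF assms]
  by (simp add: w_def scalar_product_def sum_distrib_left mult.left_commute)

end

context jet_core
begin

text \<open>Since \<open>w (r - u) s = - w u s\<close>, translation by \<open>- u\<close> leads to a
  line where \<open>TT\<close> already vanishes. The bracket with \<open>T(u)\<close> leads back,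
  and the factor \<open>tpow u\<close> passes under the derivative because
  \<open>ddr u (tpow u) = 0\<close>.\<close>

lemma TT_ddr_orth:
  assumes s: "s \<noteq> 0" and k: "\<And>r n. w r s \<noteq> 0 \<Longrightarrow> k \<le> n \<Longrightarrow> TT (tpow r * (tpow s - 1) ^ n) = 0"
    and r: "w r s = 0" and n: "Suc k \<le> n" "2 \<le> n"
  shows "TT (ddr u (tpow r * (tpow s - 1) ^ n)) = 0"
proof -
  obtain m where m: "n = Suc m" using n(2) by (cases n) auto
  have *: "TT (ddr u (tpow r * (tpow s - 1) ^ n)) = 0" if u: "w u s \<noteq> 0" for u
  proof -
    let ?g = "tpow (r - u) * (tpow s - 1) ^ n"
    have "?g \<in> aug_pow n" by (simp add: aug_pow_mult tpow_diff_one_power_mem)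
    then have "?g \<in> aug_pow 2" using aug_pow_antimono[OF n(2)] by blast
    then have "TT (tpow u * ddr u ?g) = TT (ddr u ?g)"
      using k[of "r - u" n] u r n by (intro ddr_kernel eps_ddr) simp_all
    also have d: "ddr u ?g = lscale (w u (r - u)) ?g
        + lscale (of_nat n * w u s) (tpow (r - u + s) * (tpow s - 1) ^ m)"
      unfolding ddr_mult m ddr_power_Suc by (simp add: tpow_add mult.assoc)
    also have "TT \<dots> = 0"
      using k[of "r - u" n] k[of "r - u + s" m] u r n m by simp
    finally have "TT (tpow u * ddr u ?g) = 0" unfolding d[symmetric] .
    moreover have "tpow u * ddr u ?g = ddr u (tpow u * ?g)" by (simp add: ddr_mult[of u "tpow u"])
    moreover have "tpow u * ?g = tpow r * (tpow s - 1) ^ n"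
      by (simp add: mult.assoc[symmetric] tpow_add[symmetric])
    ultimately show ?thesis by simp
  qed
  show ?thesis
  proof (cases "w u s = 0")
    case True
    \<comment> \<open>\<open>ddr\<close> is additive in its direction, and \<open>u\<close> is the
      difference of \<open>u + v\<close> and \<open>v\<close>, both covered by the first
      case.\<close>
    obtain v where "w v s \<noteq> 0" using w_nondegenerate[OF s] by blast
    with True *[of "u + v"] *[of v] show ?thesis by simp
  qed (rule *)
qed

text \<open>As \<open>B\<close> is invertible, every direction is a complex combination of the
  directions \<open>B u\<close>.\<close>

lemma TT_der_orth:
  assumes "\<And>u. TT (ddr u f) = 0"
  shows "TT (der y f) = 0"
proof -
  obtain A where "B ** A = mat 1" using inv by (auto simp: invertible_def)
  then have "y = B *v (A *v y)" by (simp add: matrix_vector_mul_assoc)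
  then have "der y f = (\<Sum>j\<in>UNIV. lscale ((A *v y) $ j) (ddr (axis j 1) f))"
    by (metis der_mult_B)
  then show ?thesis by (simp add: TT_sum assms)
qed

text \<open>On the axis itself the annihilator argument is blind to the constant term, because brackets in
  \<open>T\<^sub>B\<close> never produce it; there the vanishing follows from centrality.\<close>

lemma axis_tpow_power: "\<exists>n. \<forall>r. TT (tpow r * (tpow (axis i 1) - 1) ^ n) = 0"
proof -
  define s :: "int^'n" where "s = axis i 1"
  have s0: "s \<noteq> 0" by (simp add: s_def)
  obtain k where k: "\<And>r n. w r s \<noteq> 0 \<Longrightarrow> k \<le> n \<Longrightarrow> TT (tpow r * (tpow s - 1) ^ n) = 0"
    using ann_tpow_power[of s] by blast
  define m where "m = Suc k"
  \<comment> \<open>So \<open>n = k + 2\<close>: differentiation lowers the exponent to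
    \<open>m\<close>, still at least \<open>k\<close>, and \<open>2 \<le> n\<close> puts
    \<open>W\<close> into I^2.\<close>
  define n where "n = Suc m"
  have n: "Suc k \<le> n" "2 \<le> n" "k \<le> m" "k \<le> n" by (simp_all add: n_def m_def)
  have "TT (tpow r * (tpow s - 1) ^ n) = 0" for r
  proof (cases "w r s = 0")
    case False
    then show ?thesis using k n by simp
  next
    case r: True
    define W where "W = tpow r * (tpow s - 1) ^ n"
    have "W \<in> aug_pow n" by (simp add: W_def aug_pow_mult tpow_diff_one_power_mem)
    then have W2: "W \<in> aug_pow 2" using aug_pow_antimono[OF n(2)] by blast
    have dW: "TT (ddr u W) = 0" for u
      unfolding W_def by (rule TT_ddr_orth[OF s0 k r n(1,2)])
    have axis_der: "der (axis j 1) W = lscale (of_int (r $ j)) W" if "j \<noteq> i" for j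
    proof -
      have sp: "scalar_product (axis j 1) (cvec x) = of_int (x $ j)" for x :: "int^'n"
      proof -
        have "scalar_product (axis j 1) (cvec x) = (\<Sum>l\<in>UNIV. if l = j then of_int (x $ l) else 0)"
          unfolding scalar_product_def by (intro sum.cong refl) (simp add: cvec_def axis_def)
        then show ?thesis by simp
      qed
      have "der (axis j 1) ((tpow s - 1) ^ n) = 0"
        using that unfolding n_def der_power_Suc by (simp add: sp s_def) (simp add: axis_def)
      then show ?thesis unfolding W_def der_mult by (simp add: sp)
    qed
    show ?thesis
    proof (cases "\<exists>j. j \<noteq> i \<and> r $ j \<noteq> 0")
      case True
      then obtain j where j: "j \<noteq> i" "r $ j \<noteq> 0" by blast
      \<comment> \<open>A nonzero coordinate of \<open>r\<close> off the axis makes \<open>W\<close>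
        a nonzero multiple of one of its derivatives, and those are killed.\<close>
      have "TT (der (axis j 1) W) = 0" by (rule TT_der_orth[OF dW])
      then have "TT W = 0" using j by (simp add: axis_der)
      then show ?thesis by (simp add: W_def)
    next
      case False
      then have rj: "r $ j = 0" if "j \<noteq> i" for j using that by blast
      have wr: "w u r = of_int (r $ i) * w u s" for u
        unfolding s_def using rj by (intro w_axis_multiple)
      have ddrW: "ddr u W = lscale (w u r) W + lscale (of_nat n * w u s) (tpow (r + s) * (tpow s - 1) ^ m)" for u
        unfolding W_def ddr_mult n_def ddr_power_Suc by (simp add: tpow_add mult.assoc)
      have TuW: "TT (tpow u * W) = 0" if "w u s \<noteq> 0" for u
        using k[of "u + r" n] that r n by (simp add: W_def tpow_add mult.assoc)
      have central: "\<tau> u * TT W - TT W * \<tau> u = 0" for u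
      proof -
        have "TT ((tpow u - 1) * ddr u W) = 0"
        proof (cases "w u s = 0")
          case True
          then show ?thesis by (simp add: ddrW wr)
        next
          case False
          have "TT (tpow u * (tpow (r + s) * (tpow s - 1) ^ m)) = 0"
            using k[of "u + (r + s)" m] False r n by (simp add: tpow_add mult.assoc)
          then have "TT (tpow u * ddr u W) = 0"
            using TuW[OF False] by (simp add: ddrW distrib_left)
          then show ?thesis using dW by (simp add: left_diff_distrib)
        qed
        then show ?thesis by (simp only: T_TT_bracket_aug[OF eps_ddr[OF W2]])
      qed
      obtain u where u: "w u s \<noteq> 0" using w_nondegenerate[OF s0] by blast
      \<comment> \<open>The antiderivative of \<open>W\<close> along the axis. The constant term
        \<open>c\<close> of \<open>W\<close> has none; there the division by 0 returns 0, and
        \<open>c\<close> reappears as the correction in \<open>ddrG\<close>.\<close>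
      define G where "G = Poly_Mapping.mapp (\<lambda>l c. c / of_int (l $ i)) W"
      define c where "c = Poly_Mapping.lookup W 0"
      have G: "Poly_Mapping.lookup G l = Poly_Mapping.lookup W l / of_int (l $ i)" for l
        by (simp add: G_def lookup_mapp when_def in_keys_iff)
      have ddrG: "ddr u G = lscale (w u s) (W - lscale c 1)"
      proof (rule poly_mapping_eqI)
        fix l
        show "Poly_Mapping.lookup (ddr u G) l = Poly_Mapping.lookup (lscale (w u s) (W - lscale c 1)) l"
        proof (cases "\<exists>j. j \<noteq> i \<and> l $ j \<noteq> 0")
          case True
          then obtain j where j: "j \<noteq> i" "l $ j \<noteq> 0" by blast
          have "Poly_Mapping.lookup (der (axis j 1) W) l = 0" using j(1) by (simp add: axis_der rj)
          moreover have "scalar_product (axis j 1) (cvec l) = (\<Sum>x\<in>UNIV. if x = j then of_int (l $ x) else 0)"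
            unfolding scalar_product_def by (intro sum.cong refl) (simp add: cvec_def axis_def)
          ultimately have "Poly_Mapping.lookup W l = 0" using j by simp
          moreover have "l \<noteq> 0" using j by auto
          ultimately show ?thesis
            by (simp add: ddr_def G lookup_minus lookup_one when_def)
        next
          case False
          then have lj: "l $ j = 0" if "j \<noteq> i" for j using that by blast
          have wl: "w u l = of_int (l $ i) * w u s"
            unfolding s_def using lj by (intro w_axis_multiple)
          have l0: "l = 0 \<longleftrightarrow> l $ i = 0" using lj by (metis vec_eq_iff zero_index)
          show ?thesis
            using wl l0
            by (cases "l = 0") (simp_all add: ddr_def w_def[symmetric] G lookup_minus lookup_one when_def c_def)
        qed
      qed
      \<comment> \<open>Because \<open>eps W = 0\<close>, the \<open>eps\<close> term of the bracket
        is \<open>c * w u s\<close> times \<open>\<tau> u\<close>. It cancels the contribution of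
        \<open>c\<close> to the product with \<open>tpow u - 1\<close>, so only \<open>TT W\<close>
        remains.\<close>
      have X: "\<tau> u * TT G - TT G * \<tau> u = esc (- w u s) (TT W)"
        unfolding T_TT_bracket ddrG
        using TuW[OF u] eps_aug_pow[of W 1] W2
        by (simp add: left_diff_distrib right_diff_distrib numeral_2_eq_2 E.scale_right_diff_distrib
            del: aug_pow.simps)
      have "esc (- 1 / w u s) (TT G) * \<tau> u - \<tau> u * esc (- 1 / w u s) (TT G)
          = esc (1 / w u s) (\<tau> u * TT G - TT G * \<tau> u)"
        by (simp add: E.scale_right_diff_distrib)
      also have "\<dots> = - TT W" unfolding X using u by simp
      finally have comm: "esc (- 1 / w u s) (TT G) * \<tau> u - \<tau> u * esc (- 1 / w u s) (TT G) = - TT W" .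
      have "- TT W = 0"
      proof (rule central_commutator_eq_0[OF T_End0 _ comm])
        show "esc (- 1 / w u s) (TT G) \<in> End0" by (intro End0_closed TT_End0)
        show "- TT W * \<tau> r = \<tau> r * - TT W" for r using central[of r] by simp
        then show "- TT W * \<tau> u = \<tau> u * - TT W" .
      qed
      then show ?thesis by (simp add: W_def)
    qed
  qed
  then show ?thesis unfolding s_def by blast
qed

text \<open>\<open>R\<close> is the largest ideal inside the kernel of \<open>TT\<close>. Each of
  the finitely many generators of I has a power in \<open>R\<close>, and a sum of two ideals that
  are nilpotent modulo \<open>R\<close> is nilpotent modulo \<open>R\<close>.\<close>

lemma exists_aug_pow_killed: "\<exists>d. \<forall>f\<in>aug_pow d. TT f = 0"
proof -
  define R where "R = {f. \<forall>g. TT (f * g) = 0}"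
  have R_add: "x \<in> R \<Longrightarrow> y \<in> R \<Longrightarrow> x + y \<in> R" for x y by (simp add: R_def distrib_right)
  have R_mul: "x \<in> R \<Longrightarrow> c * x \<in> R" for c x
  proof -
    assume "x \<in> R"
    then have "TT (x * (c * g)) = 0" for g by (simp add: R_def)
    then show ?thesis by (simp add: R_def ac_simps)
  qed
  define Y where "Y i = tpow (axis i (1::int)) - (1 :: 'n laurent)" for i
  have Y: "\<exists>n. Y i ^ n \<in> R" for i
  proof -
    obtain n where n: "\<And>r. TT (tpow r * Y i ^ n) = 0" using axis_tpow_power[of i] unfolding Y_def by blast
    have "TT (Y i ^ n * g) = 0" for g
      by (induct g rule: laurent_induct) (simp_all add: n distrib_left mult.commute[of _ "tpow _"])
    then show ?thesis by (auto simp: R_def)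
  qed
  have "\<exists>d. \<forall>xs. set xs \<subseteq> module.span (*) (Y ` S) \<longrightarrow> d \<le> length xs \<longrightarrow> prod_list xs \<in> R" for S
  proof (induct S rule: infinite_finite_induct)
    case empty
    have "prod_list xs \<in> R" if "set xs \<subseteq> module.span (*) (Y ` {})" "1 \<le> length xs" for xs
      using that by (cases xs) (auto simp: module.span_empty[OF module_mult] R_def)
    then show ?case by blast
  next
    case (insert i S)
    then obtain d where d: "\<And>xs. set xs \<subseteq> module.span (*) (Y ` S) \<Longrightarrow> d \<le> length xs \<Longrightarrow> prod_list xs \<in> R"
      by blast
    obtain n where n: "Y i ^ n \<in> R" using Y by blast
    define I where "I = range (\<lambda>c. c * Y i)"
    have pI: "\<exists>c. prod_list xs = c * Y i ^ length xs" if "set xs \<subseteq> I" for xs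
      using that
    proof (induct xs)
      case (Cons x xs)
      then obtain c b where "prod_list xs = c * Y i ^ length xs" "x = b * Y i" by (auto simp: I_def)
      then have "prod_list (x # xs) = (b * c) * Y i ^ length (x # xs)" by (simp add: ac_simps)
      then show ?case by blast
    qed (auto intro: exI[of _ 1])
    have I: "prod_list xs \<in> R" if xs: "set xs \<subseteq> I" "n \<le> length xs" for xs
    proof -
      obtain c where "prod_list xs = c * Y i ^ length xs" using pI[OF xs(1)] by blast
      also have "Y i ^ length xs = Y i ^ (length xs - n) * Y i ^ n" using xs(2) by (simp flip: power_add)
      finally show ?thesis using R_mul n by (simp add: mult.assoc[symmetric])
    qed
    have "prod_list xs \<in> R"
      if xs: "set xs \<subseteq> module.span (*) (Y ` insert i S)" "n + d \<le> length xs" for xs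
    proof -
      have "\<forall>x\<in>set xs. \<exists>a\<in>I. \<exists>b\<in>module.span (*) (Y ` S). x = a + b"
      proof
        fix x assume "x \<in> set xs"
        then obtain c where "x - c * Y i \<in> module.span (*) (Y ` S)"
          using xs(1) by (auto simp: module.span_insert[OF module_mult])
        then show "\<exists>a\<in>I. \<exists>b\<in>module.span (*) (Y ` S). x = a + b"
          by (intro bexI[of _ "c * Y i"] bexI[of _ "x - c * Y i"]) (auto simp: I_def)
      qed
      then have "prod_list [] * prod_list [] * prod_list xs \<in> R"
        using xs(2) by (intro prod_list_mem_sum_ideal[OF R_add R_mul I d]) auto
      then show ?thesis by simp
    qed
    then show ?case by blast
  qed simp
  from this[of UNIV] obtain d where d: "\<And>xs. set xs \<subseteq> module.span (*) (range Y) \<Longrightarrow> d \<le> length xs \<Longrightarrow> prod_list xs \<in> R"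
    by blast
  have rY: "range Y = {tpow (axis i 1) - 1 | i. True}" by (auto simp: Y_def)
  \<comment> \<open>Factors \<open>tpow a - 1\<close> move one by one from the ideal power into the
    list, until the list has length at least \<open>d\<close>.\<close>
  have "prod_list us * f \<in> R"
    if "f \<in> aug_pow e" "set us \<subseteq> module.span (*) (range Y)" "d \<le> length us + e" for e f us
    using that
  proof (induct e arbitrary: f us)
    case 0
    then have "f * prod_list us \<in> R" by (intro R_mul d) auto
    then show ?case by (simp add: mult.commute)
  next
    case (Suc e)
    from Suc(2) show ?case
    proof (induct rule: aug_pow_Suc_induct)
      case zero
      show ?case by (simp add: R_def)
    next
      case (add f g)
      then show ?case by (simp add: distrib_left R_add)
    next
      case (gen a f)
      have "prod_list ((tpow a - 1) # us) * f \<in> R"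
        using Suc gen tpow_diff_one_mem_span_axis[of a] by (intro Suc(1)) (auto simp: rY)
      then show ?case by (simp add: ac_simps)
    qed
  qed
  from this[of _ d "[]"] have "f \<in> R" if "f \<in> aug_pow d" for f using that by simp
  then have "TT (f * 1) = 0" if "f \<in> aug_pow d" for f using that unfolding R_def by blast
  then show ?thesis by auto
qed

end

section \<open>Descent to the cube of the augmentation ideal\<close>

lemma diff_power_mem_aug_pow:
  assumes u: "u \<in> aug_pow 1" and v: "v \<in> aug_pow 1" and uv: "u - v \<in> aug_pow 2"
  shows "u ^ p - v ^ p \<in> aug_pow (Suc p)"
proof (induct p)
  case 0
  show ?case by (simp add: aug_pow_0 del: aug_pow.simps)
next
  case (Suc p)
  have "u * (u ^ p - v ^ p) \<in> aug_pow (1 + Suc p)"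
    by (rule aug_pow_mult_aug_pow[OF u Suc])
  moreover have "(u - v) * v ^ p \<in> aug_pow (2 + p * 1)"
    by (rule aug_pow_mult_aug_pow[OF uv aug_pow_power[OF v]])
  moreover have "u ^ Suc p - v ^ Suc p = u * (u ^ p - v ^ p) + (u - v) * v ^ p"
    by (simp add: algebra_simps)
  ultimately show ?case by (simp add: aug_pow_add del: aug_pow.simps)
qed

text \<open>The witness is \<open>s + n a\<close>: to first order, multiplying monomials adds the
  elements \<open>tpow a - 1\<close>.\<close>

lemma tpow_multiple_mem_aug_pow:
  "\<exists>b. tpow b - 1 - (tpow s - 1 + lscale (of_nat n) (tpow a - 1)) \<in> aug_pow 2"
proof (induct n)
  case 0
  show ?case by (rule exI[of _ s]) (simp add: aug_pow_0 del: aug_pow.simps)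
next
  case (Suc n)
  then obtain b where b: "tpow b - 1 - (tpow s - 1 + lscale (of_nat n) (tpow a - 1)) \<in> aug_pow 2" ..
  have "(tpow b - 1) * (tpow a - 1) \<in> aug_pow (1 + 1)"
    by (intro aug_pow_mult_aug_pow tpow_diff_one_mem)
  then have "(tpow b - 1) * (tpow a - 1) \<in> aug_pow 2" by (simp only: one_add_one)
  from aug_pow_add[OF b this]
  have "tpow (b + a) - 1 - (tpow s - 1 + lscale (of_nat (Suc n)) (tpow a - 1)) \<in> aug_pow 2"
    by (simp add: tpow_add lscale.scale_left_distrib algebra_simps)
  then show ?case by blast
qed

context jet_core
begin

text \<open>Skew symmetry trades the derivative of the power along \<open>k\<close> for the
  derivative of \<open>tpow k\<close> along \<open>s\<close>, which makes the right-hand side linear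
  in \<open>f\<close>. With \<open>e > 0\<close> the differentiated power has \<open>eps\<close>
  equal to 0.\<close>

lemma TT_power_bracket:
  "TT f * TT ((tpow s - 1) ^ Suc e) - TT ((tpow s - 1) ^ Suc e) * TT f
    = esc (of_nat (Suc e)) (TT ((lscale (eps (ddr s f)) 1 - ddr s f) * (tpow s * (tpow s - 1) ^ e)))"
  if "e > 0"
proof (induct f rule: laurent_induct)
  case (monom c k)
  let ?Y = "tpow s * (tpow s - 1) ^ e"
  let ?z = "TT ((tpow s - 1) ^ Suc e)"
  have "eps ?Y = 0" using that by simp
  then have "\<tau> k * ?z - ?z * \<tau> k = esc (of_nat (Suc e) * w k s) (TT ((tpow k - 1) * ?Y))"
    by (subst T_TT_bracket_aug) (simp_all add: ddr_power_Suc del: power_Suc)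
  also have "\<dots> = esc (of_nat (Suc e)) (TT ((lscale (w s k) 1 - lscale (w s k) (tpow k)) * ?Y))"
    unfolding w_skew[of s k] by (simp add: left_diff_distrib E.scale_right_diff_distrib)
  finally have "esc c (\<tau> k * ?z - ?z * \<tau> k)
      = esc c (esc (of_nat (Suc e)) (TT ((lscale (w s k) 1 - lscale (w s k) (tpow k)) * ?Y)))"
    by simp
  moreover have "(lscale (eps (ddr s (lscale c (tpow k)))) 1 - ddr s (lscale c (tpow k))) * ?Y
      = lscale c ((lscale (w s k) 1 - lscale (w s k) (tpow k)) * ?Y)"
    by (simp add: left_diff_distrib lscale.scale_right_diff_distrib)
  moreover have "TT (lscale c (tpow k)) * ?z - ?z * TT (lscale c (tpow k)) = esc c (\<tau> k * ?z - ?z * \<tau> k)"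
    by (simp add: E.scale_right_diff_distrib del: power_Suc)
  ultimately show ?case
    by (simp only: TT_lscale E.scale_left_commute)
next
  case (add f g)
  let ?z = "TT ((tpow s - 1) ^ Suc e)"
  have "TT (f + g) * ?z - ?z * TT (f + g) = (TT f * ?z - ?z * TT f) + (TT g * ?z - ?z * TT g)"
    by (simp add: algebra_simps del: power_Suc)
  also have "\<dots> = esc (of_nat (Suc e)) (TT ((lscale (eps (ddr s (f + g))) 1 - ddr s (f + g)) * (tpow s * (tpow s - 1) ^ e)))"
    unfolding add E.scale_right_distrib[symmetric] TT_add[symmetric] distrib_right[symmetric]
    by (simp add: lscale.scale_left_distrib algebra_simps)
  finally show ?case .
qed

lemma kills_descend:
  assumes d: "3 \<le> d" and kill: "\<And>f. f \<in> aug_pow (Suc d) \<Longrightarrow> TT f = 0"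
    and f: "f \<in> aug_pow d"
  shows "TT f = 0"
proof -
  obtain e where e: "d = Suc e" "2 \<le> e" using d by (cases d) auto
  define z where "z s = TT ((tpow s - 1) ^ d)" for s
  have zE: "z s \<in> End0" for s by (simp add: z_def TT_End0)
  have nil: "\<exists>n>0. z s ^ n = 0" for s
  proof (cases "s = 0")
    case True
    then have "z s = 0" using d by (simp add: z_def power_0_left)
    then show ?thesis by (intro exI[of _ 1]) simp
  next
    case False
    then obtain r where r: "w r s \<noteq> 0" using w_nondegenerate by blast
    \<comment> \<open>Since \<open>TT 1 = 0\<close>, this is
      \<open>TT ((tpow r - 1) * (tpow s - 1))\<close>. To leading order it is the quadratic function
      \<open>r s\<close>, whose bracket with the power \<open>s^d\<close> is
      \<open>d * w r s\<close> times that power.\<close>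
    let ?h = "TT (tpow (r + s) - tpow r - tpow s)"
    have "tpow (r + s) * (tpow s - 1) ^ d - (tpow s - 1) ^ d \<in> aug_pow (1 + d)"
      using aug_pow_mult_aug_pow[OF tpow_diff_one_mem tpow_diff_one_power_mem, of "r + s" s d]
      by (simp add: left_diff_distrib)
    then have "TT (tpow (r + s) * (tpow s - 1) ^ d - (tpow s - 1) ^ d) = 0" by (intro kill) simp
    then have zz: "TT (tpow (r + s) * (tpow s - 1) ^ d) = z s" by (simp add: z_def)
    have ddr: "ddr s (tpow (r + s) - tpow r - tpow s) = lscale (w s r) (tpow (r + s) - tpow r)"
      by (simp add: lscale.scale_right_diff_distrib)
    have "(lscale 0 1 - lscale (w s r) (tpow (r + s) - tpow r)) * (tpow s * (tpow s - 1) ^ e)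
        = lscale (w r s) ((tpow (r + s) - tpow r) * (tpow s * (tpow s - 1) ^ e))"
      unfolding w_skew[of s r] by simp
    also have "(tpow (r + s) - tpow r) * (tpow s * (tpow s - 1) ^ e) = tpow (r + s) * (tpow s - 1) ^ d"
      by (simp add: tpow_add e(1) algebra_simps)
    finally have key: "(lscale 0 1 - lscale (w s r) (tpow (r + s) - tpow r)) * (tpow s * (tpow s - 1) ^ e)
        = lscale (w r s) (tpow (r + s) * (tpow s - 1) ^ d)" .
    have eps: "eps (lscale (w s r) (tpow (r + s) - tpow r)) = 0" by simp
    have "0 < e" using e(2) by simp
    from TT_power_bracket[OF this, of "tpow (r + s) - tpow r - tpow s" s, unfolded ddr eps key, folded e(1)]
    have "?h * z s - z s * ?h = esc (of_nat d * w r s) (TT (tpow (r + s) * (tpow s - 1) ^ d))"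
      unfolding z_def by simp
    then have bracket: "?h * z s - z s * ?h = esc (of_nat d * w r s) (z s)" unfolding zz .
    have "of_nat d * w r s \<noteq> 0" using r d by simp
    with bracket show ?thesis by (rule nilpotent_of_eigenvector[OF zE TT_End0])
  qed
  have comm: "z b * z s = z s * z b" for b s
  proof -
    have "ddr s ((tpow b - 1) ^ d) \<in> aug_pow e"
      using ddr_aug_pow[of "(tpow b - 1) ^ d" e s] tpow_diff_one_power_mem[of b d] e(1) by simp
    moreover have "tpow s * (tpow s - 1) ^ e \<in> aug_pow e"
      by (intro aug_pow_mult tpow_diff_one_power_mem)
    ultimately have "ddr s ((tpow b - 1) ^ d) * (tpow s * (tpow s - 1) ^ e) \<in> aug_pow (e + e)"
      by (rule aug_pow_mult_aug_pow)
    \<comment> \<open>The inequality \<open>Suc d \<le> e + e\<close> is where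
      \<open>3 \<le> d\<close> enters.\<close>
    then have "ddr s ((tpow b - 1) ^ d) * (tpow s * (tpow s - 1) ^ e) \<in> aug_pow (Suc d)"
      using aug_pow_antimono[of "Suc d" "e + e"] e by auto
    then have "TT (ddr s ((tpow b - 1) ^ d) * (tpow s * (tpow s - 1) ^ e)) = 0" by (rule kill)
    moreover have "eps (ddr s ((tpow b - 1) ^ d)) = 0"
      using d tpow_diff_one_power_mem[of b d] aug_pow_antimono[of 2 d] by (intro eps_ddr) auto
    ultimately have "z b * z s - z s * z b = 0"
      unfolding z_def e(1) by (subst TT_power_bracket) (use e in simp_all)
    then show ?thesis by simp
  qed
  have finker: "\<exists>v\<in>V0. v \<noteq> 0 \<and> (\<forall>s\<in>I. app (z s) v = 0)" if "finite I" for I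
    using that
  proof induct
    case empty
    show ?case using V0_nonzero subspace_0[OF V0_sub] by auto
  next
    case (insert s I)
    then obtain v where v: "v \<in> V0" "v \<noteq> 0" "\<forall>t\<in>I. app (z t) v = 0" by blast
    \<comment> \<open>The last nonzero vector among the \<open>z s ^ k\<close> applied to
      \<open>v\<close> lies in the kernel of \<open>z s\<close>, and it stays in the other kernels
      because the operators commute.\<close>
    have ex: "\<exists>n. app (z s ^ n) v = 0" using nil[of s] by (metis app_simps(1))
    define n where "n = (LEAST n. app (z s ^ n) v = 0)"
    have n: "app (z s ^ n) v = 0" unfolding n_def by (rule LeastI_ex[OF ex])
    with v(2) obtain m where m: "n = Suc m" by (cases n) auto
    have nz: "app (z s ^ m) v \<noteq> 0"
      using not_less_Least[of m "\<lambda>n. app (z s ^ n) v = 0"] m by (simp add: n_def)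
    have mem: "app (z s ^ k) v \<in> V0" for k by (induct k) (simp_all add: v End0_mem[OF zE])
    have "app (z t) (app (z s ^ k) v) = app (z s ^ k) (app (z t) v)" for t k
    proof (induct k)
      case (Suc k)
      have "app (z t) (app (z s) x) = app (z s) (app (z t) x)" for x
        using comm[of t s] by (metis app_simps(6))
      with Suc show ?case by simp
    qed simp
    then have "app (z t) (app (z s ^ m) v) = 0" if "t \<in> I" for t using v(3) that by simp
    moreover have "app (z s) (app (z s ^ m) v) = 0" using n m by simp
    ultimately show ?case using nz mem by blast
  qed
  obtain F where F: "finite F" "End0 \<subseteq> E.span F" using End0_fd by blast
  \<comment> \<open>A basis of the span of the operators \<open>z s\<close> reduces the infinite
    family to a finite one.\<close>
  obtain Z where Z: "Z \<subseteq> range z" "E.independent Z" "range z \<subseteq> E.span Z"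
    using E.maximal_independent_subset by blast
  have "finite Z" using E.independent_span_bound[OF F(1) Z(2)] Z(1) F(2) zE by auto
  then obtain I where I: "finite I" "Z = z ` I" using finite_subset_image Z(1) by metis
  then obtain v0 where v0: "v0 \<in> V0" "v0 \<noteq> 0" "\<forall>s\<in>I. app (z s) v0 = 0" using finker by blast
  have z0: "app (z s) v0 = 0" for s
  proof -
    have "app x v0 = 0" if "x \<in> E.span (z ` I)" for x
      using that by (induct rule: E.span_induct_alt) (use v0 in auto)
    then show ?thesis using Z(3) I(2) by blast
  qed
  \<comment> \<open>Polarization: pure powers are turned into products one factor at a time, by
    replacing \<open>s\<close> with \<open>s + n a\<close> and extracting the coefficient of
    \<open>n\<close>. At \<open>j = d\<close> all of I^d is reached.\<close>
  have pol: "app (TT ((tpow s - 1) ^ (d - j) * g)) v0 = 0" if "j \<le> d" "g \<in> aug_pow j" for j g s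
    using that
  proof (induct j arbitrary: g s)
    case 0
    \<comment> \<open>Modulo I^(d+1) the factor \<open>g\<close> may be replaced by the constant
      \<open>eps g\<close>.\<close>
    have "(tpow s - 1) ^ d * (g - lscale (eps g) 1) \<in> aug_pow (d + 1)"
      by (intro aug_pow_mult_aug_pow tpow_diff_one_power_mem diff_eps_mem)
    then have "TT ((tpow s - 1) ^ d * (g - lscale (eps g) 1)) = 0" by (intro kill) simp
    then have "TT ((tpow s - 1) ^ d * g) = esc (eps g) (z s)" by (simp add: right_diff_distrib z_def)
    then show ?case by (simp add: z0)
  next
    case (Suc j)
    from Suc(3) show ?case
    proof (induct rule: aug_pow_Suc_induct)
      case (gen a g)
      define p where "p = d - j"
      have p: "p = Suc (d - Suc j)" "p + j = d" using Suc(2) by (simp_all add: p_def)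
      define v where "v k = sc (of_nat (p choose k)) (app (TT ((tpow a - 1) ^ k * (tpow s - 1) ^ (p - k) * g)) v0)" for k
      have "(\<Sum>k\<le>p. sc (of_nat n ^ k) (v k)) = 0" for n :: nat
      proof -
        obtain b where b: "tpow b - 1 - (tpow s - 1 + lscale (of_nat n) (tpow a - 1)) \<in> aug_pow 2"
          using tpow_multiple_mem_aug_pow by blast
        let ?u = "lscale (of_nat n) (tpow a - 1) + (tpow s - 1)"
        have "?u \<in> aug_pow 1" by (intro aug_pow_add aug_pow_lscale tpow_diff_one_mem)
        with b have "(tpow b - 1) ^ p - ?u ^ p \<in> aug_pow (Suc p)"
          by (intro diff_power_mem_aug_pow tpow_diff_one_mem) (simp_all add: add.commute)
        from aug_pow_mult_aug_pow[OF this gen] have "TT (((tpow b - 1) ^ p - ?u ^ p) * g) = 0"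
          using p(2) by (intro kill) (simp del: aug_pow.simps)
        then have "app (TT (?u ^ p * g)) v0 = app (TT ((tpow b - 1) ^ p * g)) v0"
          by (simp add: left_diff_distrib)
        also have "\<dots> = 0" unfolding p_def using Suc(2) gen by (intro Suc(1)) auto
        also have "?u ^ p * g
            = (\<Sum>k\<le>p. lscale (of_nat (p choose k) * of_nat n ^ k) ((tpow a - 1) ^ k * (tpow s - 1) ^ (p - k) * g))"
          unfolding binomial_ring lscale_power of_nat_mult_laurent
          by (simp add: sum_distrib_right mult.assoc)
        finally show ?thesis
          by (simp add: TT_sum app_sum v_def mult.commute)
      qed
      \<comment> \<open>The coefficient of the first power of \<open>n\<close> carries the binomial
        \<open>p choose 1\<close>, which is nonzero because \<open>p\<close> is a successor.\<close>
      then have "v 1 = 0" by (rule power_sums_eq_0) (use p in auto)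
      then have "app (TT ((tpow a - 1) * (tpow s - 1) ^ (d - Suc j) * g)) v0 = 0"
        using p(1) of_nat_neq_0[of "d - Suc j", where 'a = complex] by (simp add: v_def)
      then show ?case by (simp add: ac_simps)
    qed (simp_all add: distrib_left)
  qed
  define N where "N = {v \<in> V0. \<forall>g\<in>aug_pow d. app (TT g) v = 0}"
  have "v0 \<in> N" using v0(1) pol[of d] by (simp add: N_def)
  have homog: "app (TT g) (sc c v) = sc c (app (TT g) v)" for g c v
    using TT_homog[of g] by (simp add: homog_def)
  have "subspace N"
    using V0_sub by (auto simp: subspace_def N_def app_add homog)
  moreover have "app (\<tau> r) v \<in> N" if v: "v \<in> N" for r v
  proof -
    have "app (TT g) (app (\<tau> r) v) = 0" if g: "g \<in> aug_pow d" for g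
    proof -
      have "g \<in> aug_pow 2" using g aug_pow_antimono[of 2 d] d by auto
      from T_TT_bracket_aug[OF eps_ddr[OF this], of r]
      have "app (TT g * \<tau> r) v = app (\<tau> r * TT g - TT ((tpow r - 1) * ddr r g)) v"
        by (simp add: algebra_simps)
      \<comment> \<open>The derivative loses one degree and the factor \<open>tpow r - 1\<close>
        restores it; this makes \<open>N\<close> invariant.\<close>
      moreover have "(tpow r - 1) * ddr r g \<in> aug_pow (1 + e)"
        using g e(1) by (intro aug_pow_mult_aug_pow tpow_diff_one_mem ddr_aug_pow) simp
      then have "app (TT ((tpow r - 1) * ddr r g)) v = 0" using v e(1) by (simp add: N_def)
      ultimately show ?thesis using v g by (simp add: N_def)
    qed
    then show ?thesis using T_mem by (simp add: N_def)
  qed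
  ultimately have "N = {0} \<or> N = V0" by (intro irr) (auto simp: N_def)
  with \<open>v0 \<in> N\<close> v0(2) have "N = V0" by auto
  then show ?thesis
    using f by (intro End0_eqI TT_End0 End0_closed(1)) (auto simp: N_def)
qed

lemma TT_aug_pow_3: "f \<in> aug_pow 3 \<Longrightarrow> TT f = 0"
proof -
  assume f: "f \<in> aug_pow 3"
  obtain d where d: "\<And>f. f \<in> aug_pow d \<Longrightarrow> TT f = 0" using exists_aug_pow_killed by blast
  have "\<forall>f\<in>aug_pow (3 + k). TT f = 0 \<Longrightarrow> \<forall>f\<in>aug_pow 3. TT f = 0" for k
  proof (induct k)
    case (Suc k)
    have "\<forall>f\<in>aug_pow (3 + k). TT f = 0"
    proof
      fix f :: "'n laurent" assume "f \<in> aug_pow (3 + k)"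
      then show "TT f = 0"
      proof (rule kills_descend[rotated 2])
        fix g :: "'n laurent" assume "g \<in> aug_pow (Suc (3 + k))"
        then show "TT g = 0" using Suc(2) unfolding add_Suc_right by blast
      qed simp
    qed
    then show ?case by (rule Suc(1))
  qed simp
  moreover have "\<forall>f\<in>aug_pow (3 + d). TT f = 0" using d aug_pow_antimono[of d "3 + d"] by auto
  ultimately show ?thesis using f by blast
qed

section \<open>The quadratic and the linear part of \<open>T\<close>\<close>

definition quad :: "int^'n \<Rightarrow> int^'n \<Rightarrow> 'v aend" where
  "quad r s = TT ((tpow r - 1) * (tpow s - 1))"

text \<open>\<open>TT\<close> of the logarithm of \<open>tpow r\<close>, truncated after the square:
  \<open>(tpow r - 1) - (tpow r - 1)^2 / 2\<close>. Modulo I^3 it is additive in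
  \<open>r\<close>.\<close>

definition lin :: "int^'n \<Rightarrow> 'v aend" where
  "lin r = \<tau> r - esc (1 / 2) (quad r r)"

lemma quad_commute: "quad r s = quad s r"
  by (simp add: quad_def mult.commute)

lemma quad_add: "quad (r + r') s = quad r s + quad r' s"
proof -
  have "(tpow r - 1) * ((tpow r' - 1) * (tpow s - 1)) \<in> aug_pow (1 + (1 + 1))"
    by (intro aug_pow_mult_aug_pow tpow_diff_one_mem)
  then have "TT ((tpow r - 1) * ((tpow r' - 1) * (tpow s - 1))) = 0"
    by (intro TT_aug_pow_3) (simp add: numeral_3_eq_3 del: aug_pow.simps)
  moreover have "(tpow (r + r') - 1) * (tpow s - 1)
      = (tpow r - 1) * ((tpow r' - 1) * (tpow s - 1)) + (tpow r - 1) * (tpow s - 1) + (tpow r' - 1) * (tpow s - 1)"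
    by (simp add: tpow_add algebra_simps)
  ultimately show ?thesis unfolding quad_def by simp
qed

lemma quad_add_right: "quad s (r + r') = quad s r + quad s r'"
  by (simp add: quad_commute[of s] quad_add)

lemma tau_add: "\<tau> (r + s) = \<tau> r + \<tau> s + quad r s"
proof -
  have "(tpow r - 1) * (tpow s - 1) = tpow (r + s) - tpow r - tpow s + 1"
    by (simp add: tpow_add algebra_simps)
  then show ?thesis unfolding quad_def by simp
qed

lemma lin_add: "lin (r + s) = lin r + lin s"
proof -
  have "quad (r + s) (r + s) = quad r r + quad s s + (quad r s + quad r s)"
    by (simp add: quad_add quad_add_right quad_commute[of s r])
  moreover have "esc (1 / 2) (x + x) = x" for x
    by (simp add: E.scale_right_distrib E.scale_left_distrib[symmetric])
  ultimately show ?thesis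
    by (simp add: lin_def tau_add E.scale_right_distrib)
qed

text \<open>A complex linear map on all pairs of a matrix and a vector that takes the value
  \<open>\<tau> r\<close> at the pair of \<open>r r^T\<close> and \<open>r\<close>.\<close>

definition rep0 :: "(complex^'n^'n) \<times> (complex^'n) \<Rightarrow> 'v aend" where
  "rep0 x = (\<Sum>i\<in>UNIV. \<Sum>j\<in>UNIV. esc (fst x $ i $ j / 2) (quad (axis i 1) (axis j 1)))
     + (\<Sum>i\<in>UNIV. esc (snd x $ i) (lin (axis i 1)))"

lemma rep0_tau: "rep0 (\<chi> i j. of_int (r $ i) * of_int (r $ j), cvec r) = \<tau> r"
proof -
  have "(\<Sum>i\<in>UNIV. esc (cvec r $ i) (lin (axis i 1))) = lin r"
    using additive_int_vec[OF E.vector_space_axioms lin_add, of r] by (simp add: cvec_def)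
  moreover have "quad r r = (\<Sum>i\<in>UNIV. \<Sum>j\<in>UNIV. esc (of_int (r $ i) * of_int (r $ j)) (quad (axis i 1) (axis j 1)))"
  proof -
    have "quad r r = (\<Sum>i\<in>UNIV. esc (of_int (r $ i)) (quad (axis i 1) r))"
      by (rule additive_int_vec[OF E.vector_space_axioms]) (rule quad_add)
    moreover have "quad (axis i 1) r = (\<Sum>j\<in>UNIV. esc (of_int (r $ j)) (quad (axis i 1) (axis j 1)))" for i
      by (rule additive_int_vec[OF E.vector_space_axioms]) (rule quad_add_right)
    ultimately show ?thesis by (simp add: E.scale_sum_right)
  qed
  ultimately show ?thesis
    by (simp add: rep0_def lin_def E.scale_sum_right)
qed

lemma rep0_add: "rep0 (x + y) = rep0 x + rep0 y"
  by (simp add: rep0_def add_divide_distrib E.scale_left_distrib sum.distrib)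

lemma rep0_scale: "rep0 (mat_scale c X, c *s u) = esc c (rep0 (X, u))"
  by (simp add: rep0_def mat_scale_def map_matrix_def E.scale_sum_right E.scale_right_distrib)

lemma rep0_End0: "rep0 x \<in> End0"
proof -
  have sum: "sum g I \<in> End0" if "\<And>i. g i \<in> End0" for g and I :: "'n set"
    using that by (induct I rule: infinite_finite_induct) (simp_all add: End0_closed)
  then show ?thesis
    unfolding rep0_def lin_def quad_def by (intro End0_closed(2,3,4) T_End0 TT_End0 sum)
qed

end

section \<open>Symplectic linear algebra\<close>

lemma sum_UNIV_sum_type: "(\<Sum>k\<in>(UNIV :: ('a::finite + 'b::finite) set). f k) = (\<Sum>a\<in>UNIV. f (Inl a)) + (\<Sum>b\<in>UNIV. f (Inr b))"
  unfolding UNIV_Plus_UNIV[symmetric] by (subst sum.Plus) simp_all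

lemma matrix_eqI: "(\<And>x. A *v x = A' *v x) \<Longrightarrow> A = (A' :: complex^'n^'m)"
  using matrix_eq[of A A'] by blast

lemma scalar_product_scale [simp]:
  fixes u v :: "complex^'n"
  shows "scalar_product (c *s u) v = c * scalar_product u v" "scalar_product u (c *s v) = c * scalar_product u v"
  by (simp_all add: scalar_product_def sum_distrib_left ac_simps)

lemma scalar_product_commute: "scalar_product u v = scalar_product v (u :: complex^'n)"
  by (simp add: scalar_product_def mult.commute)

lemma scalar_product_axis [simp]: "scalar_product (axis i 1) v = (v :: complex^'n) $ i"
proof -
  have "scalar_product (axis i 1) v = (\<Sum>l\<in>UNIV. if l = i then v $ l else 0)"
    unfolding scalar_product_def by (intro sum.cong refl) (simp add: axis_def)
  then show ?thesis by simp
qed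

lemma scalar_product_eqI: "(\<And>v. scalar_product v x = scalar_product v y) \<Longrightarrow> x = (y :: complex^'n)"
  using scalar_product_axis by (metis vec_eq_iff)

lemma matrix_axis_nth: "(A *v axis j 1) $ i = (A :: complex^'n^'m) $ i $ j"
  by (simp add: matrix_vector_mult_def axis_def if_distrib[of "(*) _"] cong: if_cong)

lemma uminus_matrix_apply: "(- A) *v x = - (A *v (x :: complex^'n))"
  by (simp add: matrix_vector_mult_def vec_eq_iff sum_negf)

lemma scalar_product_transpose: "scalar_product (transpose A *v x) y = scalar_product x (A *v (y :: complex^'n))"
  unfolding scalar_product_def matrix_vector_mult_def transpose_def
  by (simp add: sum_distrib_left sum_distrib_right ac_simps) (rule sum.swap)

lemma sympl_form_apply [simp]:
  "(sympl_form *v x) $ Inl a = x $ Inr a" "(sympl_form *v x) $ Inr a = - x $ Inl a"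
  by (simp_all add: matrix_vector_mult_def sympl_form_def sum_UNIV_sum_type if_distrib[of "\<lambda>c. c * _"] cong: if_cong)

lemma sympl_form_square: "sympl_form *v (sympl_form *v x) = - x"
proof -
  have "(sympl_form *v (sympl_form *v x)) $ i = (- x) $ i" for i by (cases i) simp_all
  then show ?thesis by (simp add: vec_eq_iff)
qed

lemma transpose_sympl_form: "transpose sympl_form = - (sympl_form :: ('m::finite) smat)"
proof -
  have "transpose sympl_form $ i $ j = (- sympl_form :: 'm smat) $ i $ j" for i j
    by (cases i; cases j) (simp_all add: transpose_def sympl_form_def)
  then show ?thesis by (simp add: vec_eq_iff)
qed

section \<open>The standard symplectic form and its Lie algebra\<close>

definition omega :: "('m::finite) svec \<Rightarrow> 'm svec \<Rightarrow> complex" where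
  "omega u v = scalar_product u (sympl_form *v v)"

lemma omega_simps [simp]:
  "omega (u + u') v = omega u v + omega u' v" "omega u (v + v') = omega u v + omega u v'"
  "omega (c *s u) v = c * omega u v" "omega u (c *s v) = c * omega u v"
  "omega (- u) v = - omega u v" "omega u (- v) = - omega u v" "omega 0 v = 0" "omega u 0 = 0"
  by (simp_all add: omega_def matrix_vector_right_distrib vec.scale vec.neg)

lemma omega_skew: "omega v u = - omega u v"
proof -
  have "omega v u = scalar_product (transpose sympl_form *v v) u"
    by (simp only: omega_def scalar_product_transpose)
  then show ?thesis
    by (simp only: transpose_sympl_form omega_def uminus_matrix_apply scalar_product_simps
        scalar_product_commute[of u])
qed

lemma omega_self [simp]: "omega u u = 0"
  using omega_skew[of u u] unfolding eq_neg_iff_add_eq_0 by simp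

lemma omega_eq_0D: "(\<And>v. omega u v = 0) \<Longrightarrow> u = 0"
proof -
  assume *: "\<And>v. omega u v = 0"
  have "scalar_product v u = scalar_product v 0" for v
    using *[of "- (sympl_form *v v)"] by (simp add: omega_def vec.neg sympl_form_square scalar_product_commute)
  then show "u = 0" by (rule scalar_product_eqI)
qed

lemma sp_iff: "X \<in> sp \<longleftrightarrow> (\<forall>a b. omega (X *v a) b + omega a (X *v b) = 0)"
proof -
  have *: "omega (X *v a) b + omega a (X *v b) = scalar_product a ((transpose X ** sympl_form + sympl_form ** X) *v b)" for a b
    using scalar_product_transpose[of "transpose X" a "sympl_form *v b"]
    by (simp add: omega_def matrix_vector_mult_add_rdistrib matrix_vector_mul_assoc)
  show ?thesis
  proof
    assume "X \<in> sp"
    then show "\<forall>a b. omega (X *v a) b + omega a (X *v b) = 0" unfolding * by (simp add: sp_def)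
  next
    assume h: "\<forall>a b. omega (X *v a) b + omega a (X *v b) = 0"
    have "transpose X ** sympl_form + sympl_form ** X = 0"
    proof (rule matrix_eqI)
      fix b
      show "(transpose X ** sympl_form + sympl_form ** X) *v b = 0 *v b"
        by (rule scalar_product_eqI) (use h in \<open>simp add: *\<close>)
    qed
    then show "X \<in> sp" by (simp add: sp_def)
  qed
qed

lemma mat_scale_nth [simp]: "mat_scale c X $ i $ j = c * X $ i $ j"
  by (simp add: mat_scale_def map_matrix_def)

lemma mat_scale_apply [simp]: "mat_scale c X *v x = c *s (X *v x)"
  by (simp add: vec_eq_iff matrix_vector_mult_def sum_distrib_left mult.assoc)

interpretation mat_scale: vector_space mat_scale
  by standard (simp_all add: vec_eq_iff algebra_simps)

lemma mat_br_apply: "mat_br X Y *v x = X *v (Y *v x) - Y *v (X *v x)"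
  by (simp add: mat_br_def matrix_vector_mult_diff_rdistrib matrix_vector_mul_assoc)

lemma matrix_apply_simps:
  fixes X Y :: "complex^'n^'n"
  shows "(X + Y) *v x = X *v x + Y *v x" "(X - Y) *v x = X *v x - Y *v x" "0 *v x = 0" "(- X) *v x = - (X *v x)"
    "X *v (x + y) = X *v x + X *v y" "X *v (x - y) = X *v x - X *v y" "X *v (c *s x) = c *s (X *v x)"
    "X *v 0 = 0" "X *v (- x) = - (X *v x)"
  by (simp_all add: matrix_vector_mult_add_rdistrib matrix_vector_mult_diff_rdistrib uminus_matrix_apply
      matrix_vector_right_distrib vec.diff vec.scale vec.neg)

lemma mat_br_simps:
  "mat_br (X + X') Y = mat_br X Y + mat_br X' Y" "mat_br X (Y + Y') = mat_br X Y + mat_br X Y'"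
  "mat_br (mat_scale c X) Y = mat_scale c (mat_br X Y)" "mat_br X (mat_scale c Y) = mat_scale c (mat_br X Y)"
  "mat_br X X = 0" "mat_br X 0 = 0" "mat_br 0 Y = 0" "mat_br X (- Y) = - mat_br X Y"
  by (rule matrix_eqI; simp add: mat_br_apply matrix_apply_simps vec.scale_right_diff_distrib)+

lemma mat_br_jacobi: "mat_br X (mat_br Y Z) + mat_br Y (mat_br Z X) + mat_br Z (mat_br X Y) = 0"
  by (rule matrix_eqI) (simp add: mat_br_apply matrix_apply_simps)

lemma subspace_sp: "mat_scale.subspace sp"
proof (rule mat_scale.subspaceI)
  fix X Y :: "('m::finite) smat" and c
  assume X: "X \<in> sp"
  then have X': "omega (X *v a) b = - omega a (X *v b)" for a b
    unfolding sp_iff by (simp add: eq_neg_iff_add_eq_0)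
  show "mat_scale c X \<in> sp" by (simp add: sp_iff X')
  assume "Y \<in> sp"
  then have "omega (Y *v a) b = - omega a (Y *v b)" for a b
    unfolding sp_iff by (simp add: eq_neg_iff_add_eq_0)
  with X' show "X + Y \<in> sp" by (simp add: sp_iff matrix_apply_simps)
qed (simp add: sp_iff)

lemma omega_diff [simp]: "omega (u - u') v = omega u v - omega u' v" "omega u (v - v') = omega u v - omega u v'"
  using omega_simps(1)[of u "- u'" v] omega_simps(2)[of u v "- v'"] by simp_all

lemma mat_br_sp: "X \<in> sp \<Longrightarrow> Y \<in> sp \<Longrightarrow> mat_br X Y \<in> sp"
proof -
  assume "X \<in> sp" "Y \<in> sp"
  then have "omega (X *v a) b = - omega a (X *v b)" "omega (Y *v a) b = - omega a (Y *v b)" for a b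
    unfolding sp_iff by (simp_all add: eq_neg_iff_add_eq_0)
  then show ?thesis by (simp add: sp_iff mat_br_apply)
qed

text \<open>The matrix by which the quadratic Hamiltonian \<open>u v\<close> acts on linear functions.\<close>

definition tv :: "('m::finite) svec \<Rightarrow> 'm svec \<Rightarrow> 'm smat" where
  "tv u v = (\<chi> i j. u $ i * (- (sympl_form *v v) $ j) + v $ i * (- (sympl_form *v u) $ j))"

lemma tv_apply: "tv u v *v a = omega v a *s u + omega u a *s v"
proof -
  have s: "(\<Sum>j\<in>UNIV. - ((sympl_form *v z) $ j) * a $ j) = omega z a" for z
    using omega_skew[of z a] by (simp add: omega_def scalar_product_def sum_negf mult.commute)
  have "(\<Sum>j\<in>UNIV. (u $ i * (- (sympl_form *v v) $ j) + v $ i * (- (sympl_form *v u) $ j)) * a $ j)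
      = u $ i * (\<Sum>j\<in>UNIV. - ((sympl_form *v v) $ j) * a $ j) + v $ i * (\<Sum>j\<in>UNIV. - ((sympl_form *v u) $ j) * a $ j)" for i
    by (simp only: sum_distrib_left sum.distrib[symmetric] distrib_right mult.assoc)
  then show ?thesis unfolding s
    by (simp add: tv_def matrix_vector_mult_def vec_eq_iff mult.commute)
qed

lemma tv_simps:
  "tv u v = tv v u" "tv (u + u') v = tv u v + tv u' v" "tv u (v + v') = tv u v + tv u v'"
  "tv (c *s u) v = mat_scale c (tv u v)" "tv u (c *s v) = mat_scale c (tv u v)" "tv 0 v = 0" "tv u 0 = 0"
  "tv (- u) v = - tv u v" "tv u (- v) = - tv u v"
  by (rule matrix_eqI; simp add: tv_apply matrix_apply_simps vec.scale_right_distrib vec.scale_left_distrib ac_simps)+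

lemma tv_sp: "tv u v \<in> sp"
  using omega_skew[of _ u] omega_skew[of _ v] by (simp add: sp_iff tv_apply algebra_simps)

lemma mat_br_tv: "X \<in> sp \<Longrightarrow> mat_br X (tv u v) = tv (X *v u) v + tv u (X *v v)"
proof (rule matrix_eqI)
  fix a
  assume "X \<in> sp"
  then have X: "omega b (X *v a) = - omega (X *v b) a" for b
    unfolding sp_iff by (simp add: eq_neg_iff_add_eq_0 add.commute)
  show "mat_br X (tv u v) *v a = (tv (X *v u) v + tv u (X *v v)) *v a"
    by (simp add: mat_br_apply tv_apply matrix_apply_simps X vec.scale_left_distrib)
qed

lemma mat_br_tv_self: "mat_br (tv s s) (tv s t) = mat_scale (2 * omega s t) (tv s s)"
  by (simp add: mat_br_tv[OF tv_sp] tv_apply tv_simps(3,5,6,7) vec.scale_left_distrib[symmetric])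

lemma mat_br_tv_tv: "mat_br (tv u u) (tv v v) = mat_scale (4 * omega u v) (tv u v)"
proof -
  have "tv u u *v v = (2 * omega u v) *s u" by (simp add: tv_apply vec_eq_iff)
  then show ?thesis
    by (simp add: mat_br_tv[OF tv_sp] tv_simps(4,5) tv_simps(1)[of v u] mat_scale.scale_left_distrib[symmetric])
qed

text \<open>For \<open>X\<close> in \<open>sp\<close> the form \<open>omega (X *v a) b\<close> is
  symmetric, hence determined by its diagonal.\<close>

lemma sp_eq_0I:
  assumes X: "X \<in> sp" and diag: "\<And>v. omega (X *v v) v = 0"
  shows "X = 0"
proof (rule matrix_eqI)
  fix a
  have "omega (X *v a) b = 0" for b
  proof -
    have "omega (X *v a) b = - omega a (X *v b)" using X unfolding sp_iff by (simp add: eq_neg_iff_add_eq_0)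
    then have "omega (X *v b) a = omega (X *v a) b" using omega_skew[of a "X *v b"] by simp
    then show ?thesis using diag[of "a + b"] diag[of a] diag[of b] by (simp add: matrix_apply_simps)
  qed
  then show "X *v a = 0 *v a" by (simp add: omega_eq_0D matrix_apply_simps)
qed

text \<open>Two proper subspaces do not cover the space.\<close>

lemma exists_omega_nonzero:
  assumes "s \<noteq> 0" "t \<noteq> 0"
  shows "\<exists>x. omega s x \<noteq> 0 \<and> omega x t \<noteq> 0"
proof -
  obtain x where x: "omega s x \<noteq> 0" using omega_eq_0D assms(1) by blast
  obtain y where "omega t y \<noteq> 0" using omega_eq_0D assms(2) by blast
  then have y: "omega y t \<noteq> 0" using omega_skew[of y t] by simp
  show ?thesis
  proof (cases "omega x t = 0 \<and> omega s y = 0")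
    case True
    with x y show ?thesis by (intro exI[of _ "x + y"]) simp
  next
    case False
    with x y show ?thesis by blast
  qed
qed

text \<open>With \<open>J\<close> the matrix of the form, the vectors \<open>axis i 1\<close> and
  \<open>J *v axis i 1\<close> are dual bases for \<open>omega\<close> up to sign. Expanding in them
  exhibits \<open>X\<close> as half the sum of the
  \<open>tv (X *v axis i 1) (J *v axis i 1)\<close>.\<close>

lemma sp_span_tv: "X \<in> sp \<Longrightarrow> X \<in> mat_scale.span (range (\<lambda>(u, v). tv u v))"
proof -
  assume X: "X \<in> sp"
  let ?J = "sympl_form :: complex^('a + 'a)^('a + 'a)"
  have exp1: "(\<Sum>i\<in>UNIV. omega (?J *v axis i 1) x *s axis i 1) = x" for x
  proof -
    have "omega (?J *v axis i 1) x = x $ i" for i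
      using omega_skew[of "?J *v axis i 1" x]
      by (simp add: omega_def sympl_form_square scalar_product_commute[of x])
    then show ?thesis by (simp add: basis_expansion)
  qed
  have exp2: "(\<Sum>i\<in>UNIV. omega (axis i 1) x *s (?J *v axis i 1)) = - x" for x
  proof -
    have "(\<Sum>i\<in>UNIV. omega (axis i 1) x *s (?J *v axis i 1)) = ?J *v (\<Sum>i\<in>UNIV. (?J *v x) $ i *s axis i 1)"
      by (simp add: omega_def vec.sum vec.scale)
    then show ?thesis by (simp add: basis_expansion sympl_form_square)
  qed
  have X': "omega (X *v b) a = - omega b (X *v a)" for a b
    using X unfolding sp_iff by (simp add: eq_neg_iff_add_eq_0)
  have sum_apply: "(\<Sum>i\<in>I. A i) *v a = (\<Sum>i\<in>I. A i *v a)" for A :: "'a + 'a \<Rightarrow> complex^('a + 'a)^('a + 'a)" and I a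
    by (induct I rule: infinite_finite_induct) (simp_all add: matrix_apply_simps)
  have "mat_scale (1/2) (\<Sum>i\<in>UNIV. tv (X *v axis i 1) (?J *v axis i 1)) = X"
  proof (rule matrix_eqI)
    fix a
    have "(\<Sum>i\<in>UNIV. omega (?J *v axis i 1) a *s (X *v axis i 1)) = X *v (\<Sum>i\<in>UNIV. omega (?J *v axis i 1) a *s axis i 1)"
      by (simp add: vec.sum vec.scale)
    then have "(\<Sum>i\<in>UNIV. omega (?J *v axis i 1) a *s (X *v axis i 1)) = X *v a" by (simp only: exp1)
    moreover have "(\<Sum>i\<in>UNIV. omega (X *v axis i 1) a *s (?J *v axis i 1)) = X *v a"
      using exp2[of "X *v a"] by (simp add: X' sum_negf)
    ultimately show "mat_scale (1/2) (\<Sum>i\<in>UNIV. tv (X *v axis i 1) (?J *v axis i 1)) *v a = X *v a"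
      by (simp add: sum_apply tv_apply sum.distrib) (simp add: vec_eq_iff)
  qed
  moreover have "mat_scale (1/2) (\<Sum>i\<in>UNIV. tv (X *v axis i 1) (?J *v axis i 1)) \<in> mat_scale.span (range (\<lambda>(u, v). tv u v))"
    by (intro mat_scale.span_scale mat_scale.span_sum mat_scale.span_base) auto
  ultimately show ?thesis by simp
qed

text \<open>Symplectic Gram-Schmidt: hyperbolic pairs \<open>p a\<close>, \<open>q a\<close> are
  added one at a time, each orthogonal to the earlier ones. They become the columns of
  \<open>M\<close>.\<close>

lemma symplectic_basis:
  fixes K :: "('m::finite) smat"
  assumes K: "transpose K = - K" "invertible K"
  shows "\<exists>M :: 'm smat. transpose M ** K ** M = sympl_form"
proof -
  interpret symplectic_lattice K by standard (fact K)+
  define f where "f u v = scalar_product u (K *v v)" for u v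
  have f_simps [simp]: "f (u + u') v = f u v + f u' v" "f u (v + v') = f u v + f u v'"
    "f (u - u') v = f u v - f u' v" "f u (v - v') = f u v - f u v'"
    "f (c *s u) v = c * f u v" "f u (c *s v) = c * f u v" "f 0 v = 0" "f u 0 = 0" for u u' v v' c
    by (simp_all add: f_def matrix_apply_simps)
  have f_skew: "f v u = - f u v" for u v
    using scalar_product_skew[of u v] by (simp add: f_def scalar_product_commute)
  have f_self [simp]: "f u u = 0" for u
    using f_skew[of u u] unfolding eq_neg_iff_add_eq_0 by simp
  have f_sum: "f u (\<Sum>i\<in>I. g i) = (\<Sum>i\<in>I. f u (g i))" for u g and I :: "'m set"
    by (induct I rule: infinite_finite_induct) simp_all
  have f_nondeg: "\<exists>v. f u v \<noteq> 0" if "u \<noteq> 0" for u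
  proof (rule ccontr)
    assume "\<nexists>v. f u v \<noteq> 0"
    then have "f v u = 0" for v using f_skew[of v u] by simp
    then have "K *v u = 0" by (intro scalar_product_eqI) (simp add: f_def)
    with mult_B_inj that show False by blast
  qed
  have "\<exists>p q. (\<forall>a\<in>A. \<forall>b\<in>A. f (p a) (p b) = 0 \<and> f (q a) (q b) = 0 \<and> f (p a) (q b) = (if a = b then 1 else 0))"
    for A :: "'m set"
  proof (induct A rule: infinite_finite_induct)
    case (insert c A)
    then obtain p q where pq: "\<And>a b. a \<in> A \<Longrightarrow> b \<in> A \<Longrightarrow> f (p a) (p b) = 0"
      "\<And>a b. a \<in> A \<Longrightarrow> b \<in> A \<Longrightarrow> f (q a) (q b) = 0"
      "\<And>a b. a \<in> A \<Longrightarrow> b \<in> A \<Longrightarrow> f (p a) (q b) = (if a = b then 1 else 0)" by blast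
    have qp: "f (q a) (p b) = (if a = b then -1 else 0)" if "a \<in> A" "b \<in> A" for a b
      using f_skew[of "q a" "p b"] pq(3)[OF that(2,1)] by auto
    \<comment> \<open>The projection onto the orthogonal complement of the pairs found so
      far.\<close>
    define proj where "proj x = x - (\<Sum>a\<in>A. f (p a) x *s q a - f (q a) x *s p a)" for x
    have proj0: "f (p b) (proj x) = 0" "f (q b) (proj x) = 0" if b: "b \<in> A" for b x
    proof -
      have "(\<Sum>a\<in>A. f (p b) (f (p a) x *s q a - f (q a) x *s p a)) = (\<Sum>a\<in>A. if a = b then f (p b) x else 0)"
        using b by (intro sum.cong refl) (auto simp: pq)
      then show "f (p b) (proj x) = 0" using b insert(1) by (simp add: proj_def f_sum)
      have "(\<Sum>a\<in>A. f (q b) (f (p a) x *s q a - f (q a) x *s p a)) = (\<Sum>a\<in>A. if a = b then f (q b) x else 0)"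
        using b by (intro sum.cong refl) (auto simp: pq qp)
      then show "f (q b) (proj x) = 0" using b insert(1) by (simp add: proj_def f_sum)
    qed
    let ?S = "p ` A \<union> q ` A"
    \<comment> \<open>Fewer vectors than the dimension cannot span, so some \<open>x\<close> has a
      nonzero projection.\<close>
    have "card ?S \<le> card A + card A"
      by (meson add_mono card_Un_le card_image_le insert(1) le_trans)
    moreover have "card A < CARD('m)"
      using insert(2) by (intro psubset_card_mono) auto
    ultimately have "card ?S < CARD('m + 'm)" by simp
    then have "vec.span ?S \<noteq> UNIV"
      using vec.dim_le_card[of UNIV ?S] insert(1) vec_dim_card[where 'a = complex and 'n = "'m + 'm"] by auto
    then obtain x where x: "x \<notin> vec.span ?S" by blast
    define u where "u = proj x"
    have "u \<noteq> 0"
    proof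
      assume "u = 0"
      then have "x = (\<Sum>a\<in>A. f (p a) x *s q a - f (q a) x *s p a)" by (simp add: u_def proj_def)
      moreover have "\<dots> \<in> vec.span ?S"
        by (intro vec.span_sum vec.span_diff vec.span_scale vec.span_base) auto
      ultimately show False using x by simp
    qed
    then obtain y where y: "f u y \<noteq> 0" using f_nondeg by blast
    define v where "v = (1 / f u y) *s proj y"
    have u: "f (p a) u = 0" "f (q a) u = 0" "f u (p a) = 0" "f u (q a) = 0" if "a \<in> A" for a
      using proj0[OF that, of x] f_skew[of u "p a"] f_skew[of u "q a"] by (simp_all add: u_def)
    have v: "f (p a) v = 0" "f (q a) v = 0" "f v (p a) = 0" "f v (q a) = 0" if "a \<in> A" for a
      using proj0[OF that, of y] f_skew[of v "p a"] f_skew[of v "q a"] by (simp_all add: v_def)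
    \<comment> \<open>\<open>proj y\<close> differs from \<open>y\<close> by vectors orthogonal to
      \<open>u\<close>, so the nonzero pairing with \<open>u\<close> survives.\<close>
    have "f u (proj y) = f u y"
      unfolding proj_def by (simp add: f_sum u)
    then have uv: "f u v = 1" using y by (simp add: v_def)
    show ?case
      using pq u v uv insert(2)
      by (intro exI[of _ "p(c := u)"] exI[of _ "q(c := v)"]) auto
  qed simp_all
  from this[of UNIV] obtain p q :: "'m \<Rightarrow> 'm svec"
    where "\<forall>a\<in>UNIV. \<forall>b\<in>UNIV. f (p a) (p b) = 0 \<and> f (q a) (q b) = 0 \<and> f (p a) (q b) = (if a = b then 1 else 0)"
    by blast
  then have pq: "f (p a) (p b) = 0" "f (q a) (q b) = 0" "f (p a) (q b) = (if a = b then 1 else 0)" for a b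
    by blast+
  have qp: "f (q a) (p b) = (if a = b then -1 else 0)" for a b
    using f_skew[of "q a" "p b"] pq(3)[of b a] by auto
  define c where "c j = (case j of Inl a \<Rightarrow> p a | Inr a \<Rightarrow> q a)" for j
  define M where "M = (\<chi> i j. c j $ i)"
  have Mc: "M *v axis j 1 = c j" for j by (simp add: M_def matrix_axis_nth vec_eq_iff)
  have "(transpose M ** K ** M) $ i $ j = sympl_form $ i $ j" for i j
  proof -
    have e: "A $ i $ j = scalar_product (axis i 1) (A *v axis j 1)" for A :: "'m smat"
      by (simp add: matrix_axis_nth)
    have "(transpose M ** K ** M) $ i $ j = scalar_product (axis i 1) (transpose M *v (K *v c j))"
      by (subst e) (simp add: matrix_vector_mul_assoc[symmetric] Mc)
    also have "\<dots> = f (c i) (c j)"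
      using scalar_product_transpose[of M "K *v c j" "axis i 1"]
      by (simp add: Mc f_def scalar_product_commute)
    also have "\<dots> = sympl_form $ i $ j"
      by (cases i; cases j) (simp_all add: c_def pq qp sympl_form_def)
    finally show ?thesis .
  qed
  then have "transpose M ** K ** M = sympl_form" by (simp add: vec_eq_iff)
  then show ?thesis ..
qed

section \<open>The reductive quotient\<close>

type_synonym coords = "nat \<Rightarrow>\<^sub>0 complex"
type_synonym ('n, 'v) graded = "(int^'n) \<Rightarrow>\<^sub>0 'v"

text \<open>Any numbering of the matrix and vector entries will do; it is there because the quotient
  has to be carried by finitely supported functions on the naturals.\<close>

definition coord_index :: "('n::finite \<times> 'n) + 'n \<Rightarrow> nat" where
  "coord_index = (SOME h. inj h)"

lemma coord_index_eq_iff [simp]: "coord_index x = coord_index y \<longleftrightarrow> x = (y :: ('n::finite \<times> 'n) + 'n)"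
proof -
  have "\<exists>h :: ('n \<times> 'n) + 'n \<Rightarrow> nat. inj h"
    using finite_imp_inj_to_nat_seg[of "UNIV :: (('n \<times> 'n) + 'n) set"] by auto
  then have "inj (coord_index :: ('n \<times> 'n) + 'n \<Rightarrow> nat)" unfolding coord_index_def by (rule someI_ex)
  then show ?thesis by (simp add: inj_eq)
qed

definition embed :: "(complex^'n^'n) \<times> (complex^'n::finite) \<Rightarrow> coords" where
  "embed x = (\<Sum>i\<in>UNIV. \<Sum>j\<in>UNIV. Poly_Mapping.single (coord_index (Inl (i, j))) (fst x $ i $ j))
     + (\<Sum>i\<in>UNIV. Poly_Mapping.single (coord_index (Inr i)) (snd x $ i))"

definition unembed :: "coords \<Rightarrow> (complex^'n^'n) \<times> (complex^'n::finite)" where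
  "unembed y = (\<chi> i j. Poly_Mapping.lookup y (coord_index (Inl (i, j))), \<chi> i. Poly_Mapping.lookup y (coord_index (Inr i)))"

definition pscale :: "complex \<Rightarrow> (complex^'n^'n) \<times> (complex^'n) \<Rightarrow> (complex^'n^'n) \<times> (complex^'n)" where
  "pscale c x = (mat_scale c (fst x), c *s snd x)"

lemma pscale_simps [simp]: "fst (pscale c x) = mat_scale c (fst x)" "snd (pscale c x) = c *s snd x"
  "pscale c (X, u) = (mat_scale c X, c *s u)"
  by (simp_all add: pscale_def)

lemma unembed_embed [simp]: "unembed (embed x) = x"
proof -
  have Inl: "Poly_Mapping.lookup (embed x) (coord_index (Inl (i, j))) = fst x $ i $ j" for i j
  proof -
    have "(\<Sum>k\<in>UNIV. \<Sum>l\<in>UNIV. fst x $ k $ l when k = i \<and> l = j)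
        = (\<Sum>k\<in>UNIV. if k = i then (\<Sum>l\<in>UNIV. if l = j then fst x $ k $ l else 0) else 0)"
      by (intro sum.cong refl) (auto simp: when_def)
    then show ?thesis by (simp add: embed_def lookup_add lookup_sum lookup_single)
  qed
  moreover have "Poly_Mapping.lookup (embed x) (coord_index (Inr i)) = snd x $ i" for i
    by (simp add: embed_def lookup_add lookup_sum lookup_single when_def)
  ultimately show ?thesis by (simp add: unembed_def prod_eq_iff vec_eq_iff)
qed

lemma unembed_simps [simp]: "unembed (x + y) = unembed x + unembed y" "unembed 0 = 0"
  "unembed (lscale c x) = pscale c (unembed x)"
  by (simp_all add: unembed_def prod_eq_iff vec_eq_iff lookup_add)

lemma embed_add: "embed (x + y) = embed x + embed y"
  by (simp add: embed_def single_add sum.distrib)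

lemma embed_0 [simp]: "embed 0 = 0"
  by (simp add: embed_def)

lemma embed_scale: "embed (pscale c x) = lscale c (embed x)"
proof -
  have "Poly_Mapping.single k (c * a) = lscale c (Poly_Mapping.single k a)" for k :: nat and a
    by (rule poly_mapping_eqI) (simp add: lookup_single when_def)
  then show ?thesis
    by (simp add: embed_def lscale.scale_right_distrib lscale.scale_sum_right)
qed

lemma embed_diff: "embed (x - y) = embed x - embed y"
  using embed_add[of "x - y" y] by (simp add: algebra_simps)

lemma embed_eq_iff [simp]: "embed x = embed y \<longleftrightarrow> x = y"
  by (metis unembed_embed)

lemma embed_eq_0_iff: "embed x = 0 \<longleftrightarrow> x = 0"
  by (metis embed_0 embed_eq_iff)

section \<open>The sum of \<open>sp\<close> and a central vector space, in coordinates\<close>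

definition Lsp :: "'m::finite itself \<Rightarrow> coords set" where
  "Lsp _ = embed ` ((sp :: 'm smat set) \<times> UNIV)"

definition Lbr :: "'m::finite itself \<Rightarrow> coords \<Rightarrow> coords \<Rightarrow> coords" where
  "Lbr _ x y = embed (mat_br (fst (unembed x)) (fst (unembed y)) :: 'm smat, 0)"

lemma embed_mem_Lsp [simp]: "embed (X, u) \<in> Lsp TYPE('m::finite) \<longleftrightarrow> X \<in> (sp :: 'm smat set)"
  by (auto simp: Lsp_def)

lemma Lbr_embed [simp]:
  "Lbr TYPE('m::finite) (embed (X, u)) (embed (Y, v)) = embed (mat_br X (Y :: 'm smat), 0)"
  by (simp add: Lbr_def)

lemma Lsp_cases:
  assumes "x \<in> Lsp TYPE('m::finite)"
  obtains X u where "x = embed (X, u)" "X \<in> (sp :: 'm smat set)"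
  using assms by (auto simp: Lsp_def)

lemmas sp_0 = mat_scale.subspace_0[OF subspace_sp]
  and sp_add = mat_scale.subspace_add[OF subspace_sp]
  and sp_scale = mat_scale.subspace_scale[OF subspace_sp]

lemma lie_algebra_Lsp: "lie_algebra lscale (Lsp TYPE('m::finite)) (Lbr TYPE('m))"
proof
  show "lscale.subspace (Lsp TYPE('m))"
  proof (rule lscale.subspaceI)
    have "embed 0 = (0 :: coords)" by (rule embed_0)
    then show "0 \<in> Lsp TYPE('m)"
      using embed_mem_Lsp[where 'm = 'm, of 0 0] by (simp add: sp_0 zero_prod_def[symmetric])
    fix x y :: "coords" and c
    assume "x \<in> Lsp TYPE('m)" then obtain X u where x: "x = embed (X, u)" "X \<in> (sp :: 'm smat set)"
      by (rule Lsp_cases)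
    show "lscale c x \<in> Lsp TYPE('m)" using x by (simp add: embed_scale[symmetric] sp_scale)
    assume "y \<in> Lsp TYPE('m)" then obtain Y v where y: "y = embed (Y, v)" "Y \<in> (sp :: 'm smat set)"
      by (rule Lsp_cases)
    show "x + y \<in> Lsp TYPE('m)" using x y by (simp add: embed_add[symmetric] sp_add)
  qed
  fix x assume "x \<in> Lsp TYPE('m)"
  then obtain X u where x: "x = embed (X, u)" "X \<in> (sp :: 'm smat set)" by (rule Lsp_cases)
  show "linear_on lscale (Lsp TYPE('m)) lscale (Lsp TYPE('m)) (\<lambda>y. Lbr TYPE('m) x y)"
    using x by (auto simp: linear_on_def elim!: Lsp_cases simp: mat_br_sp embed_add[symmetric] embed_scale[symmetric] mat_br_simps)
  show "linear_on lscale (Lsp TYPE('m)) lscale (Lsp TYPE('m)) (\<lambda>y. Lbr TYPE('m) y x)"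
    using x by (auto simp: linear_on_def elim!: Lsp_cases simp: mat_br_sp embed_add[symmetric] embed_scale[symmetric] mat_br_simps)
  show "Lbr TYPE('m) x x = 0"
    using x by (simp add: mat_br_simps zero_prod_def[symmetric])
  fix y z assume "y \<in> Lsp TYPE('m)" "z \<in> Lsp TYPE('m)"
  then show "Lbr TYPE('m) x (Lbr TYPE('m) y z) + Lbr TYPE('m) y (Lbr TYPE('m) z x) + Lbr TYPE('m) z (Lbr TYPE('m) x y) = 0"
    using x by (auto elim!: Lsp_cases simp: embed_add[symmetric] mat_br_jacobi zero_prod_def[symmetric])
qed

abbreviation Lsp0 :: "'m::finite itself \<Rightarrow> coords set" where
  "Lsp0 m \<equiv> (\<lambda>X :: 'm smat. embed (X, 0)) ` sp"

context
  fixes m :: "'m::finite itself"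
begin

interpretation L: lie_algebra lscale "Lsp TYPE('m)" "Lbr TYPE('m)"
  by (rule lie_algebra_Lsp)

lemma subspace_embed_sp: "lscale.subspace (Lsp0 TYPE('m))"
proof (rule lscale.subspaceI)
  show "0 \<in> Lsp0 TYPE('m)" by (rule image_eqI[of _ _ 0]) (simp_all add: sp_0 zero_prod_def[symmetric])
next
  fix x y assume "x \<in> Lsp0 TYPE('m)" "y \<in> Lsp0 TYPE('m)"
  then show "x + y \<in> Lsp0 TYPE('m)" by (auto simp: embed_add[symmetric] intro!: image_eqI sp_add)
next
  fix c x assume "x \<in> Lsp0 TYPE('m)"
  then show "lscale c x \<in> Lsp0 TYPE('m)" by (auto simp: embed_scale[symmetric] intro!: image_eqI sp_scale)
qed

text \<open>By polarization the squares \<open>tv s s\<close> yield all \<open>tv s t\<close>, and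
  these span \<open>sp\<close>.\<close>

lemma embed_sp_subset:
  assumes I: "lscale.subspace I" and tv: "\<And>s. embed (tv s (s :: 'm svec), 0) \<in> I"
  shows "Lsp0 TYPE('m) \<subseteq> I"
proof -
  have tv2: "embed (tv s (t :: 'm svec), 0) \<in> I" for s t
  proof -
    have "tv (s + t) (s + t) - tv s s - tv t t = mat_scale 2 (tv s t)"
      by (rule matrix_eqI) (simp add: tv_apply matrix_apply_simps vec_eq_iff algebra_simps)
    then have "mat_scale (1/2) (tv (s + t) (s + t) - tv s s - tv t t) = tv s t"
      by (simp add: vec_eq_iff)
    then have "embed (tv s t, 0) = lscale (1/2) (embed (tv (s + t) (s + t), 0) - embed (tv s s, 0) - embed (tv t t, 0))"
      by (simp add: embed_scale[symmetric] embed_diff[symmetric])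
    then show ?thesis using I tv by (simp only: lscale.subspace_scale lscale.subspace_diff)
  qed
  have "embed (X, 0) \<in> I" if "X \<in> mat_scale.span (range (\<lambda>(u, v :: 'm svec). tv u v))" for X
    using that
  proof (induct rule: mat_scale.span_induct_alt)
    case base
    show ?case using lscale.subspace_0[OF I] by (simp add: zero_prod_def[symmetric])
  next
    case (step c X Y)
    then have "lscale c (embed (X, 0)) + embed (Y, 0) \<in> I"
      using tv2 by (auto intro!: lscale.subspace_add[OF I] lscale.subspace_scale[OF I])
    then show ?case by (simp add: embed_scale[symmetric] embed_add[symmetric])
  qed
  then show ?thesis using sp_span_tv by blast
qed

text \<open>The bracket of \<open>tv s s\<close> with \<open>tv s t\<close> is
  \<open>2 * omega s t\<close> times \<open>tv s s\<close>, so \<open>sp\<close> is perfect. The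
  form with an arbitrary \<open>I\<close> above \<open>sp\<close> can be iterated along a derived
  series.\<close>

lemma derived_supset: "Lsp0 TYPE('m) \<subseteq> I \<Longrightarrow> Lsp0 TYPE('m) \<subseteq> L.derived I"
proof (rule embed_sp_subset)
  assume I: "Lsp0 TYPE('m) \<subseteq> I"
  show "lscale.subspace (L.derived I)" unfolding L.derived_def by (rule lscale.subspace_span)
  fix s :: "'m svec"
  show "embed (tv s s, 0) \<in> L.derived I"
  proof (cases "s = 0")
    case True
    then show ?thesis by (simp add: tv_simps zero_prod_def[symmetric] L.derived_def lscale.span_zero)
  next
    case False
    then obtain t where t: "omega s t \<noteq> 0" using omega_eq_0D by blast
    let ?Y = "mat_scale (1 / (2 * omega s t)) (tv s t)"
    have "mat_br (tv s s) ?Y = tv s s"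
      using t by (simp add: mat_br_simps mat_br_tv_self)
    then have "embed (tv s s, 0) = Lbr TYPE('m) (embed (tv s s, 0)) (embed (?Y, 0))" by simp
    moreover have "embed (tv s s, 0) \<in> I" "embed (?Y, 0) \<in> I"
      using I by (auto simp: tv_sp sp_scale)
    ultimately show ?thesis unfolding L.derived_def by (intro lscale.span_base) blast
  qed
qed

lemma derived_Lsp: "L.derived (Lsp TYPE('m)) = Lsp0 TYPE('m)"
proof
  show "L.derived (Lsp TYPE('m)) \<subseteq> Lsp0 TYPE('m)"
    unfolding L.derived_def
    by (rule lscale.span_minimal[OF _ subspace_embed_sp]) (auto elim!: Lsp_cases intro!: image_eqI mat_br_sp)
  show "Lsp0 TYPE('m) \<subseteq> L.derived (Lsp TYPE('m))" by (rule derived_supset) auto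
qed

lemma center_Lsp: "L.center = {embed (0 :: 'm smat, u) | u. True}"
proof
  show "{embed (0 :: 'm smat, u) | u. True} \<subseteq> L.center"
    by (auto simp: L.center_def sp_0 mat_br_simps zero_prod_def[symmetric] elim!: Lsp_cases)
  show "L.center \<subseteq> {embed (0 :: 'm smat, u) | u. True}"
  proof
    fix x assume x: "x \<in> L.center"
    then have "x \<in> Lsp TYPE('m)" by (simp add: L.center_def)
    then obtain X u where X: "x = embed (X, u)" "X \<in> (sp :: 'm smat set)" by (rule Lsp_cases)
    have br: "mat_br X (tv v v) = 0" for v
    proof -
      have "Lbr TYPE('m) x (embed (tv v v, 0)) = 0" using x by (simp add: L.center_def tv_sp)
      then show ?thesis by (simp add: X(1) embed_eq_0_iff prod_eq_iff)
    qed
    \<comment> \<open>Applied to \<open>v\<close> itself, the bracket of \<open>X\<close> with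
      \<open>tv v v\<close> leaves just \<open>2 * omega (X *v v) v\<close> times
      \<open>v\<close>.\<close>
    have "omega (X *v v) v = 0" for v
    proof (cases "v = 0")
      case False
      have "(tv (X *v v) v + tv v (X *v v)) *v v = 0" using br[of v] by (simp add: mat_br_tv[OF X(2)] matrix_apply_simps)
      then have "(2 * omega (X *v v) v) *s v = 0" by (simp add: tv_apply matrix_apply_simps vec_eq_iff algebra_simps)
      with False show ?thesis by simp
    qed simp
    then have "X = 0" by (rule sp_eq_0I[OF X(2)])
    then show "x \<in> {embed (0 :: 'm smat, u) | u. True}" using X(1) by blast
  qed
qed

text \<open>Simplicity of \<open>sp\<close> by means of long root vectors. Bracketing twice with
  \<open>tv v v\<close> sends \<open>X\<close> to \<open>- 4 * omega v (X *v v)\<close> times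
  \<open>tv v v\<close>. The same device leads from \<open>tv v v\<close> to \<open>tv s s\<close>
  when \<open>omega s v \<noteq> 0\<close>, and through an intermediate vector to every
  \<open>s\<close>.\<close>

lemma ideal_not_central:
  assumes I: "L.ideal I" and x: "x \<in> I" "x \<notin> L.center"
  shows "Lsp0 TYPE('m) \<subseteq> I"
proof -
  have sub: "lscale.subspace I" and "I \<subseteq> Lsp TYPE('m)"
    and br: "\<And>a b. a \<in> Lsp TYPE('m) \<Longrightarrow> b \<in> I \<Longrightarrow> Lbr TYPE('m) a b \<in> I"
    using I by (auto simp: L.ideal_def)
  with x obtain X u where X: "x = embed (X, u)" "X \<in> (sp :: 'm smat set)" by (metis Lsp_cases subsetD)
  have "X \<noteq> 0" using x X(1) by (auto simp: center_Lsp)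
  have scale: "embed (Y, 0) \<in> I" if "embed (mat_scale c Y, 0) \<in> I" "c \<noteq> 0" for c and Y :: "'m smat"
    using lscale.subspace_scale[OF sub that(1), of "1 / c"] that(2) by (simp add: embed_scale[symmetric])
  have step: "embed (tv s s, 0) \<in> I" if "embed (tv v v, 0) \<in> I" "omega s v \<noteq> 0" for s v :: "'m svec"
  proof -
    have "mat_br (tv s s) (mat_br (tv s s) (tv v v)) = mat_scale (8 * (omega s v * omega s v)) (tv s s)"
      by (simp add: mat_br_tv_tv mat_br_simps mat_br_tv_self)
    moreover have "Lbr TYPE('m) (embed (tv s s, 0)) (Lbr TYPE('m) (embed (tv s s, 0)) (embed (tv v v, 0))) \<in> I"
      by (intro br that) (simp_all add: tv_sp)
    ultimately have "embed (mat_scale (8 * (omega s v * omega s v)) (tv s s), 0) \<in> I" by simp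
    then show ?thesis by (rule scale) (use that(2) in simp)
  qed
  have "\<exists>v. omega v (X *v v) \<noteq> 0"
  proof (rule ccontr)
    assume "\<not> ?thesis"
    then have "omega (X *v v) v = 0" for v using omega_skew[of "X *v v" v] by simp
    then have "X = 0" by (rule sp_eq_0I[OF X(2)])
    with \<open>X \<noteq> 0\<close> show False by simp
  qed
  then obtain v where v: "omega v (X *v v) \<noteq> 0" by blast
  have "mat_br (tv v v) (mat_br (tv v v) X) = mat_scale (- 4 * omega v (X *v v)) (tv v v)"
  proof -
    have "mat_br (tv v v) X = - mat_br X (tv v v)" by (simp add: mat_br_def)
    also have "\<dots> = - mat_scale 2 (tv v (X *v v))"
      by (rule matrix_eqI) (simp add: mat_br_tv[OF X(2)] tv_apply matrix_apply_simps vec_eq_iff algebra_simps)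
    finally show ?thesis by (simp add: mat_br_simps mat_br_tv_self)
  qed
  moreover have "Lbr TYPE('m) (embed (tv v v, 0)) (Lbr TYPE('m) (embed (tv v v, 0)) x) \<in> I"
    by (intro br x) (simp_all add: tv_sp)
  ultimately have "embed (mat_scale (- 4 * omega v (X *v v)) (tv v v), 0) \<in> I" by (simp add: X(1))
  then have tvv: "embed (tv v v, 0) \<in> I" by (rule scale) (use v in simp)
  have "v \<noteq> 0" using v by auto
  show ?thesis
  proof (rule embed_sp_subset[OF sub])
    fix s :: "'m svec"
    show "embed (tv s s, 0) \<in> I"
    proof (cases "s = 0")
      case True
      then show ?thesis using lscale.subspace_0[OF sub] by (simp add: tv_simps zero_prod_def[symmetric])
    next
      case False
      then obtain t where "omega s t \<noteq> 0" "omega t v \<noteq> 0" using exists_omega_nonzero \<open>v \<noteq> 0\<close> by blast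
      then show ?thesis using step step[OF tvv] by blast
    qed
  qed
qed

text \<open>A solvable ideal that is not central would contain \<open>sp\<close>, which is perfect
  and so survives in every term of the derived series.\<close>

lemma radical_Lsp: "L.radical = L.center"
proof
  have subC: "lscale.subspace L.center"
  proof (rule lscale.subspaceI)
    show "0 \<in> L.center" unfolding center_Lsp by (auto intro!: exI[of _ 0] simp: zero_prod_def[symmetric])
  qed (auto simp: center_Lsp embed_add[symmetric] embed_scale[symmetric])
  have "I \<subseteq> L.center" if I: "L.ideal I" "L.solvable I" for I
  proof (rule ccontr)
    assume "\<not> I \<subseteq> L.center"
    then have "Lsp0 TYPE('m) \<subseteq> I" using ideal_not_central[OF I(1)] by blast
    then have "Lsp0 TYPE('m) \<subseteq> (L.derived ^^ n) I" for n by (induct n) (simp_all add: derived_supset)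
    with I(2) have "Lsp0 TYPE('m) \<subseteq> {0}" by (auto simp: L.solvable_def)
    then have "embed (tv s s :: 'm smat, 0 :: 'm svec) = 0" for s
      using tv_sp[of s s] by blast
    then have tv0: "tv s s = (0 :: 'm smat)" for s by (simp add: embed_eq_0_iff prod_eq_iff)
    define s :: "'m svec" where "s = 1"
    have "s \<noteq> 0" by (simp add: s_def)
    then obtain t where t: "omega s t \<noteq> 0" using omega_eq_0D by blast
    have "tv s s *v t = (2 * omega s t) *s s" by (simp add: tv_apply vec_eq_iff)
    with tv0 have "(2 * omega s t) *s s = 0" by (simp add: matrix_apply_simps)
    with t \<open>s \<noteq> 0\<close> show False by simp
  qed
  then show "L.radical \<subseteq> L.center"
    unfolding L.radical_def by (intro lscale.span_minimal subC) blast
  have "L.ideal L.center"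
    unfolding L.ideal_def
  proof (intro conjI ballI)
    show "L.center \<subseteq> Lsp TYPE('m)" by (auto simp: L.center_def)
    fix x y assume "x \<in> Lsp TYPE('m)" "y \<in> L.center"
    then have "Lbr TYPE('m) x y = 0"
      by (auto simp: center_Lsp mat_br_simps zero_prod_def[symmetric] elim!: Lsp_cases)
    then show "Lbr TYPE('m) x y \<in> L.center" using lscale.subspace_0[OF subC] by simp
  qed (rule subC)
  moreover have "L.solvable L.center"
  proof -
    have "{Lbr TYPE('m) x y |x y. x \<in> L.center \<and> y \<in> L.center} \<subseteq> {0}"
      by (auto simp: center_Lsp mat_br_simps zero_prod_def[symmetric])
    then have "L.derived L.center \<subseteq> lscale.span {0}"
      unfolding L.derived_def by (rule lscale.span_mono)
    then have "L.derived L.center = {0}"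
      using lscale.span_zero unfolding L.derived_def by auto
    then have "(L.derived ^^ 1) L.center = {0}" by simp
    then show ?thesis unfolding L.solvable_def by blast
  qed
  ultimately show "L.center \<subseteq> L.radical"
    unfolding L.radical_def by (intro subset_trans[OF _ lscale.span_superset]) blast
qed

lemma reductive_Lsp: "L.reductive"
proof -
  let ?G = "(\<lambda>k. Poly_Mapping.single k (1::complex)) ` range (coord_index :: (('m + 'm) \<times> ('m + 'm)) + ('m + 'm) \<Rightarrow> nat)"
  have single: "Poly_Mapping.single (coord_index k) a \<in> lscale.span ?G" for k :: "(('m + 'm) \<times> ('m + 'm)) + ('m + 'm)" and a
  proof -
    have "Poly_Mapping.single (coord_index k) a = lscale a (Poly_Mapping.single (coord_index k) 1)"
      by (rule poly_mapping_eqI) (simp add: lookup_single when_def)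
    then show ?thesis by (simp only:) (intro lscale.span_scale lscale.span_base, blast)
  qed
  have "Lsp TYPE('m) \<subseteq> lscale.span ?G"
    unfolding Lsp_def embed_def by (auto intro!: lscale.span_add lscale.span_sum single)
  then have "fin_dim lscale (Lsp TYPE('m))"
    unfolding fin_dim_def by (intro exI[of _ ?G]) simp
  then show ?thesis unfolding L.reductive_def using radical_Lsp by simp
qed

lemma semisimple_part_Lsp:
  "lie_isomorphic lscale L.semisimple_part (Lbr TYPE('m)) mat_scale (sp :: 'm smat set) mat_br"
proof -
  let ?f = "\<lambda>x. fst (unembed x :: ('m smat) \<times> ('m svec))"
  have "lie_hom lscale (Lsp0 TYPE('m)) (Lbr TYPE('m)) mat_scale (sp :: 'm smat set) mat_br ?f"
    by (auto simp: lie_hom_def linear_on_def)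
  moreover have "bij_betw ?f (Lsp0 TYPE('m)) sp"
    by (rule bij_betw_imageI) (auto simp: inj_on_def image_image)
  ultimately show ?thesis
    unfolding lie_isomorphic_def L.semisimple_part_def derived_Lsp by blast
qed

end

section \<open>Jet modules\<close>

lemma linear_onI:
  assumes "\<And>x. x \<in> V \<Longrightarrow> f x \<in> W" "\<And>x y. x \<in> V \<Longrightarrow> y \<in> V \<Longrightarrow> f (x + y) = f x + f y"
    "\<And>c x. x \<in> V \<Longrightarrow> f (sc c x) = sc' c (f x)"
  shows "linear_on sc V sc' W f"
  using assms by (simp add: linear_on_def)

lemma linear_onD:
  assumes "linear_on sc V sc' W f"
  shows "x \<in> V \<Longrightarrow> f x \<in> W" "x \<in> V \<Longrightarrow> y \<in> V \<Longrightarrow> f (x + y) = f x + f y"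
    "x \<in> V \<Longrightarrow> f (sc c x) = sc' c (f x)"
  using assms by (simp_all add: linear_on_def)

section \<open>Vector fields on the torus\<close>

lemma lookup_torus_d: "Poly_Mapping.lookup (torus_d i f) k = of_int (k $ i) * Poly_Mapping.lookup f k"
  by (simp add: torus_d_def lookup_mapp when_def in_keys_iff)

lemma torus_d_sum: "der u f = (\<Sum>i\<in>UNIV. lscale (u $ i) (torus_d i f))"
  by (rule poly_mapping_eqI)
    (simp add: lookup_sum lookup_torus_d scalar_product_def cvec_def sum_distrib_right mult.assoc)

lemma D_eq: "D u r f = tpow r * der u f"
  by (simp add: D_def torus_d_sum sum_distrib_left)

lemma D_tpow: "D u r (tpow k) = lscale (scalar_product u (cvec k)) (tpow (r + k))"
  by (simp add: D_eq tpow_add)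

lemma der_commute: "der u (der v f) = der v (der u f)"
  by (rule poly_mapping_eqI) simp

lemma der_scale [simp]: "der (c *s u) f = lscale c (der u f)"
  by (rule poly_mapping_eqI) (simp add: mult.assoc)

lemma op_br_D: "op_br (D u r) (D v s)
    = D (scalar_product u (cvec s) *s v - scalar_product v (cvec r) *s u) (r + s)"
proof
  fix f
  show "op_br (D u r) (D v s) f = D (scalar_product u (cvec s) *s v - scalar_product v (cvec r) *s u) (r + s) f"
    unfolding op_br_def D_eq der_mult der_tpow der_simps der_scale tpow_add
    by (simp add: distrib_left right_diff_distrib der_commute[of u v] ac_simps)
qed

lemma op_scale_D: "op_scale c (D u r) = D (c *s u) r"
  by (rule ext) (simp add: op_scale_def D_eq)

interpretation op: vector_space op_scale
  by standard (simp_all add: op_scale_def fun_eq_iff lscale.scale_right_distrib lscale.scale_left_distrib)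

lemma Ham_extI: "\<eta> \<in> Ham B \<Longrightarrow> \<theta> \<in> torus_cartan \<Longrightarrow> \<eta> + \<theta> \<in> Ham_ext B"
  by (auto simp: Ham_ext_def)

lemma Ham_ext_add: "\<eta> \<in> Ham_ext B \<Longrightarrow> \<theta> \<in> Ham_ext B \<Longrightarrow> \<eta> + \<theta> \<in> Ham_ext B"
proof -
  assume "\<eta> \<in> Ham_ext B" "\<theta> \<in> Ham_ext B"
  then obtain a b c d where *: "\<eta> = a + b" "\<theta> = c + d" "a \<in> Ham B" "c \<in> Ham B" "b \<in> torus_cartan" "d \<in> torus_cartan"
    by (auto simp: Ham_ext_def)
  then have "(a + c) + (b + d) \<in> Ham_ext B"
    by (intro Ham_extI) (simp_all add: Ham_def torus_cartan_def op.span_add)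
  then show ?thesis using * by (simp add: ac_simps)
qed

lemma Ham_ext_gens: "D (B *v cvec r) r \<in> Ham_ext B" "D u 0 \<in> Ham_ext B" "0 \<in> Ham_ext B"
proof -
  have 0: "0 \<in> Ham B" "0 \<in> torus_cartan" by (simp_all add: Ham_def torus_cartan_def op.span_zero)
  have u: "D u 0 \<in> torus_cartan" for u unfolding torus_cartan_def by (intro op.span_base) blast
  show D0: "D u 0 \<in> Ham_ext B" for u using Ham_extI[OF 0(1) u] by simp
  show "0 \<in> Ham_ext B" using Ham_extI[OF 0] by simp
  show "D (B *v cvec r) r \<in> Ham_ext B"
  proof (cases "r = 0")
    case False
    then have "D (B *v cvec r) r \<in> Ham B" unfolding Ham_def by (intro op.span_base) blast
    from Ham_extI[OF this 0(2)] show ?thesis by simp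
  qed (simp add: D0)
qed

lemma Ham_ext_induct [consumes 1, case_names ham cartan add scale]:
  assumes "\<eta> \<in> Ham_ext B" and ham: "\<And>r. P (D (B *v cvec r) r)" and cartan: "\<And>u. P (D u 0)"
    and add: "\<And>\<eta> \<theta>. \<eta> \<in> Ham_ext B \<Longrightarrow> \<theta> \<in> Ham_ext B \<Longrightarrow> P \<eta> \<Longrightarrow> P \<theta> \<Longrightarrow> P (\<eta> + \<theta>)"
    and scale: "\<And>c \<eta>. \<eta> \<in> Ham_ext B \<Longrightarrow> P \<eta> \<Longrightarrow> P (op_scale c \<eta>)"
  shows "P \<eta>"
proof -
  have P0: "P 0" using scale[OF Ham_ext_gens(2) cartan[of 0], of 0] by simp
  have sc: "op_scale c (D u 0) \<in> Ham_ext B" for c u by (simp add: op_scale_D Ham_ext_gens)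
  have sc': "op_scale c (D (B *v cvec r) r) \<in> Ham_ext B" if "r \<noteq> 0" for c r
  proof -
    have "op_scale c (D (B *v cvec r) r) \<in> Ham B"
      unfolding Ham_def using that by (intro op.span_scale op.span_base) blast
    from Ham_extI[OF this, of 0] show ?thesis by (simp add: torus_cartan_def op.span_zero)
  qed
  have 1: "P a \<and> a \<in> Ham_ext B" if "a \<in> Ham B" for a
    using that unfolding Ham_def
  proof (induct rule: op.span_induct_alt)
    case (step c x y)
    then have x: "op_scale c x \<in> Ham_ext B" "P (op_scale c x)"
      using sc' by (auto intro: scale[OF Ham_ext_gens(1) ham])
    with step show ?case by (intro conjI add Ham_ext_add) simp_all
  qed (rule conjI[OF P0 Ham_ext_gens(3)])
  have 2: "P a \<and> a \<in> Ham_ext B" if "a \<in> torus_cartan" for a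
    using that unfolding torus_cartan_def
  proof (induct rule: op.span_induct_alt)
    case (step c x y)
    then have x: "op_scale c x \<in> Ham_ext B" "P (op_scale c x)"
      using sc by (auto intro: scale[OF Ham_ext_gens(2) cartan])
    with step show ?case by (intro conjI add Ham_ext_add) simp_all
  qed (rule conjI[OF P0 Ham_ext_gens(3)])
  from assms(1) obtain a b where "\<eta> = a + b" "a \<in> Ham B" "b \<in> torus_cartan" by (auto simp: Ham_ext_def)
  with 1 2 show ?thesis by (auto intro: add)
qed

text \<open>Transport of structure: the tensor product inherits the jet module axioms from
  \<open>V\<close>, and only the formulas on pure tensors remain to be computed.\<close>

lemma jet_module_transport:
  assumes jm: "jet_module B sc V \<rho> \<mu>" and vs: "vector_space sc'" and V': "module.subspace sc' V'"
    and lin: "linear_on sc' V' sc V \<Psi>" and bij: "bij_betw \<Psi> V' V"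
  defines "\<Phi> \<equiv> inv_into V' \<Psi>"
  defines "\<rho>' \<equiv> \<lambda>\<eta> x. \<Phi> (\<rho> \<eta> (\<Psi> x))" and "\<mu>' \<equiv> \<lambda>f x. \<Phi> (\<mu> f (\<Psi> x))"
  shows "jet_module B sc' V' \<rho>' \<mu>'" and "jet_iso B sc V \<rho> \<mu> sc' V' \<rho>' \<mu>' \<Phi>"
proof -
  interpret M: jet_module B sc V \<rho> \<mu> by (rule jm)
  interpret V': vector_space sc' by (rule vs)
  note \<Psi> = linear_onD[OF lin]
  have \<Phi>\<Psi>: "\<Phi> (\<Psi> x) = x" if "x \<in> V'" for x
    using that bij by (simp add: \<Phi>_def bij_betw_inv_into_left)
  have \<Psi>\<Phi>: "\<Psi> (\<Phi> v) = v" if "v \<in> V" for v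
    using that bij by (simp add: \<Phi>_def bij_betw_inv_into_right)
  have \<Phi>V: "\<Phi> v \<in> V'" if "v \<in> V" for v
    using that bij by (metis \<Phi>_def bij_betw_def inv_into_into)
  have \<Phi>add: "\<Phi> (u + v) = \<Phi> u + \<Phi> v" if "u \<in> V" "v \<in> V" for u v
    using \<Phi>\<Psi>[OF V'.subspace_add[OF V' \<Phi>V[OF that(1)] \<Phi>V[OF that(2)]]] \<Psi>(2)[OF \<Phi>V[OF that(1)] \<Phi>V[OF that(2)]]
    by (simp add: \<Psi>\<Phi> that)
  have \<Phi>sc: "\<Phi> (sc c v) = sc' c (\<Phi> v)" if "v \<in> V" for c v
    using \<Phi>\<Psi>[OF V'.subspace_scale[OF V' \<Phi>V[OF that]]] \<Psi>(3)[OF \<Phi>V[OF that]] by (simp add: \<Psi>\<Phi> that)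
  have \<Phi>diff: "\<Phi> (u - v) = \<Phi> u - \<Phi> v" if "u \<in> V" "v \<in> V" for u v
    using \<Phi>add[OF M.V.subspace_diff[OF M.subspace_V that] that(2)] by (simp add: algebra_simps)
  note \<rho> = linear_onD[OF M.act_linear] and \<rho>l = linear_onD[OF M.act_linear_left]
    and \<mu> = linear_onD[OF M.mult_linear] and \<mu>l = linear_onD[OF M.mult_linear_left]
  show "jet_module B sc' V' \<rho>' \<mu>'"
  proof
    show "V'.subspace V'" by (rule V')
    fix \<eta> assume \<eta>: "\<eta> \<in> Ham_ext B"
    show "linear_on sc' V' sc' V' (\<rho>' \<eta>)"
      by (rule linear_onI) (simp_all add: \<rho>'_def \<Psi> \<rho>[OF \<eta>] \<Phi>V \<Phi>add \<Phi>sc)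
    fix \<theta> x assume \<theta>: "\<theta> \<in> Ham_ext B" and x: "x \<in> V'"
    show "\<rho>' (op_br \<eta> \<theta>) x = \<rho>' \<eta> (\<rho>' \<theta> x) - \<rho>' \<theta> (\<rho>' \<eta> x)"
      using x \<eta> \<theta> by (simp add: \<rho>'_def M.act_br \<Psi> \<rho> \<Psi>\<Phi> \<Phi>diff)
  next
    fix x assume x: "x \<in> V'"
    show "linear_on op_scale (Ham_ext B) sc' V' (\<lambda>\<eta>. \<rho>' \<eta> x)"
      by (rule linear_onI) (simp_all add: \<rho>'_def \<rho>l[OF \<Psi>(1)[OF x]] \<Phi>V \<Phi>add \<Phi>sc)
    show "linear_on lscale UNIV sc' V' (\<lambda>f. \<mu>' f x)"
      by (rule linear_onI) (simp_all add: \<mu>'_def \<mu>l[OF \<Psi>(1)[OF x]] \<Phi>V \<Phi>add \<Phi>sc)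
    show "\<mu>' 1 x = x" using x by (simp add: \<mu>'_def M.mult_one \<Psi> \<Phi>\<Psi>)
    show "\<mu>' (f * g) x = \<mu>' f (\<mu>' g x)" for f g
      using x by (simp add: \<mu>'_def M.mult_assoc \<Psi> \<mu> \<Psi>\<Phi>)
    show "\<rho>' \<eta> (\<mu>' f x) = \<mu>' (\<eta> f) x + \<mu>' f (\<rho>' \<eta> x)" if "\<eta> \<in> Ham_ext B" for \<eta> f
      using x that by (simp add: \<mu>'_def \<rho>'_def M.leibniz \<Psi> \<mu> \<rho> \<Psi>\<Phi> \<Phi>add)
  next
    show "linear_on sc' V' sc' V' (\<mu>' f)" for f
      by (rule linear_onI) (simp_all add: \<mu>'_def \<Psi> \<mu> \<Phi>V \<Phi>add \<Phi>sc)
  qed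
  show "jet_iso B sc V \<rho> \<mu> sc' V' \<rho>' \<mu>' \<Phi>"
    unfolding jet_iso_def using bij_betw_inv_into[OF bij, folded \<Phi>_def]
    by (auto simp: \<rho>'_def \<mu>'_def \<Psi>\<Phi> \<Phi>V \<Phi>add \<Phi>sc intro!: linear_onI)
qed

lemma lookup_pm_scale:
  assumes "vector_space sc"
  shows "Poly_Mapping.lookup (pm_scale sc c x) k = sc c (Poly_Mapping.lookup x k)"
proof -
  interpret vector_space sc by fact
  show ?thesis by (simp add: pm_scale_def map.rep_eq when_def)
qed

lemma vector_space_pm_scale:
  assumes "vector_space sc"
  shows "vector_space (pm_scale sc)"
proof -
  interpret vector_space sc by fact
  show ?thesis
    by standard (rule poly_mapping_eqI,
      simp add: lookup_pm_scale[OF assms] lookup_add scale_right_distrib scale_left_distrib)+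
qed

section \<open>Weight spaces and the operators that preserve them\<close>

context jet_module
begin

lemmas V_closed = V.subspace_0[OF subspace_V] V.subspace_add[OF subspace_V]
  V.subspace_diff[OF subspace_V] V.subspace_scale[OF subspace_V]

lemmas rho = linear_onD[OF act_linear] and rho_left = linear_onD[OF act_linear_left]
  and mu = linear_onD[OF mult_linear] and mu_left = linear_onD[OF mult_linear_left]

abbreviation ham :: "int^'n \<Rightarrow> 'n laurent \<Rightarrow> 'n laurent" where
  "ham r \<equiv> D (B *v cvec r) r"

lemmas ham_mem = Ham_ext_gens(1)[of B] and cartan_mem = Ham_ext_gens(2)[of _ B]

lemma mu_0 [simp]: "\<mu> f 0 = 0"
  using mu(3)[of 0 f 0] V_closed(1) by simp

lemma mu_diff: "u \<in> V \<Longrightarrow> v \<in> V \<Longrightarrow> \<mu> f (u - v) = \<mu> f u - \<mu> f v"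
  using mu(2)[of "u - v" v f] V_closed(3) by simp

lemma mu_minus: "v \<in> V \<Longrightarrow> \<mu> (- f) v = - \<mu> f v"
  using mu_left(3)[of v f "- 1"] by simp

lemma mu_tpow_add: "v \<in> V \<Longrightarrow> \<mu> (tpow r) (\<mu> (tpow s) v) = \<mu> (tpow (r + s)) v"
  by (simp add: tpow_add mult_assoc)

lemma rho_diff: "\<eta> \<in> Ham_ext B \<Longrightarrow> u \<in> V \<Longrightarrow> v \<in> V \<Longrightarrow> \<rho> \<eta> (u - v) = \<rho> \<eta> u - \<rho> \<eta> v"
  using rho(2)[of \<eta> "u - v" v] V_closed(3) by simp

lemma weight_space_V: "v \<in> weight_space l \<Longrightarrow> v \<in> V"
  by (simp add: weight_space_def)

lemma weight_space_subspace: "V.subspace (weight_space l)"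
  using subspace_V
  by (auto simp: V.subspace_def weight_space_def rho[OF cartan_mem] V.scale_right_distrib mult.commute)
    (use rho(3)[OF cartan_mem, of 0 _ 0] in simp)

lemmas weight_space_closed = V.subspace_0[OF weight_space_subspace] V.subspace_add[OF weight_space_subspace]
  V.subspace_diff[OF weight_space_subspace] V.subspace_scale[OF weight_space_subspace]

lemma mu_tpow_weight:
  assumes "v \<in> weight_space l"
  shows "\<mu> (tpow r) v \<in> weight_space (l + cvec r)"
proof -
  have v: "v \<in> V" "\<And>u. \<rho> (D u 0) v = sc (scalar_product u l) v" using assms by (simp_all add: weight_space_def)
  have "\<rho> (D u 0) (\<mu> (tpow r) v) = sc (scalar_product u (l + cvec r)) (\<mu> (tpow r) v)" for u
    using v by (simp add: leibniz[OF cartan_mem] D_tpow mu_left mu V.scale_left_distrib add.commute)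
  with v show ?thesis by (simp add: weight_space_def mu)
qed

lemma rho_ham_weight:
  assumes "v \<in> weight_space l"
  shows "\<rho> (ham r) v \<in> weight_space (l + cvec r)"
proof -
  have v: "v \<in> V" "\<And>u. \<rho> (D u 0) v = sc (scalar_product u l) v" using assms by (simp_all add: weight_space_def)
  have "\<rho> (D u 0) (\<rho> (ham r) v) = sc (scalar_product u (l + cvec r)) (\<rho> (ham r) v)" for u
  proof -
    have "op_br (D u 0) (ham r) = op_scale (scalar_product u (cvec r)) (ham r)"
      by (simp add: op_br_D op_scale_D)
    then have "sc (scalar_product u (cvec r)) (\<rho> (ham r) v) = \<rho> (D u 0) (\<rho> (ham r) v) - \<rho> (ham r) (\<rho> (D u 0) v)"
      using act_br[OF cartan_mem ham_mem v(1), of u r] rho_left(3)[OF v(1) ham_mem] by simp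
    then show ?thesis
      using v by (simp add: rho[OF ham_mem] V.scale_left_distrib algebra_simps)
  qed
  with v show ?thesis by (simp add: weight_space_def rho[OF ham_mem])
qed

definition jet_op :: "int^'n \<Rightarrow> 'v \<Rightarrow> 'v" where
  "jet_op r v = \<mu> (tpow (- r)) (\<rho> (ham r) v)"

lemma jet_op_V: "v \<in> V \<Longrightarrow> jet_op r v \<in> V"
  by (simp add: jet_op_def mu rho[OF ham_mem])

lemma jet_op_linear: "u \<in> V \<Longrightarrow> v \<in> V \<Longrightarrow> jet_op r (u + v) = jet_op r u + jet_op r v"
  "u \<in> V \<Longrightarrow> v \<in> V \<Longrightarrow> jet_op r (u - v) = jet_op r u - jet_op r v"
  "v \<in> V \<Longrightarrow> jet_op r (sc c v) = sc c (jet_op r v)"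
  by (simp_all add: jet_op_def mu mu_diff rho_diff[OF ham_mem] rho[OF ham_mem])

lemma jet_op_weight: "v \<in> weight_space l \<Longrightarrow> jet_op r v \<in> weight_space l"
  using mu_tpow_weight[OF rho_ham_weight, of v l "- r" r] by (simp add: jet_op_def)

lemma jet_op_0: "v \<in> V \<Longrightarrow> jet_op 0 v = 0"
proof -
  assume v: "v \<in> V"
  have "ham 0 = op_scale 0 (ham 0)" by (simp add: op_scale_D)
  then have "\<rho> (ham 0) v = sc 0 (\<rho> (ham 0) v)" using rho_left(3)[OF v ham_mem, of 0 0] by simp
  then show ?thesis by (simp add: jet_op_def)
qed

lemma rho_ham_mu:
  assumes "v \<in> V"
  shows "\<rho> (ham r) (\<mu> (tpow k) v)
    = \<mu> (tpow (k + r)) (sc (scalar_product (B *v cvec r) (cvec k)) v + jet_op r v)"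
proof -
  have "\<mu> (tpow (k + r)) (jet_op r v) = \<mu> (tpow k) (\<rho> (ham r) v)"
    using assms by (simp add: jet_op_def mu_tpow_add rho[OF ham_mem])
  then show ?thesis
    using assms
    by (simp add: leibniz[OF ham_mem] D_tpow mu_left mu V_closed(4) jet_op_V add.commute)
qed

text \<open>Moving \<open>tpow (- s)\<close> past \<open>ham r\<close> costs the scalar
  \<open>- (Br|s)\<close>. The two costs supply the terms of \<open>jet_op r\<close> and
  \<open>jet_op s\<close>, and the commutator of the vector fields supplies that of
  \<open>jet_op (r + s)\<close>.\<close>

lemma jet_op_bracket:
  assumes skew: "\<And>r s. scalar_product (B *v cvec s) (cvec r) = - scalar_product (B *v cvec r) (cvec s)"
    and v: "v \<in> V"
  shows "jet_op r (jet_op s v) - jet_op s (jet_op r v)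
    = sc (scalar_product (B *v cvec r) (cvec s)) (jet_op (r + s) v - jet_op r v - jet_op s v)"
proof -
  have comp: "jet_op r (jet_op s v) = sc (- scalar_product (B *v cvec r) (cvec s)) (jet_op s v)
      + \<mu> (tpow (- (r + s))) (\<rho> (ham r) (\<rho> (ham s) v))" for r s
  proof -
    have e: "- r + (- s + r) = - s" "- r + - s = - (r + s)" by simp_all
    have y: "\<rho> (ham s) v \<in> V" using v by (simp add: rho[OF ham_mem])
    have "\<rho> (ham r) (\<mu> (tpow (- s)) (\<rho> (ham s) v))
        = sc (- scalar_product (B *v cvec r) (cvec s)) (\<mu> (tpow (- s + r)) (\<rho> (ham s) v)) + \<mu> (tpow (- s)) (\<rho> (ham r) (\<rho> (ham s) v))"
      using y by (simp add: leibniz[OF ham_mem] D_tpow mu_left mu_minus add.commute)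
    then show ?thesis
      unfolding jet_op_def
      using y by (simp only: mu V_closed(4) mu_tpow_add rho[OF ham_mem] e)
  qed
  let ?w = "scalar_product (B *v cvec r) (cvec s)"
  have "op_br (ham r) (ham s) = op_scale ?w (ham (r + s))"
    by (simp add: op_br_D op_scale_D skew[of s r] matrix_vector_right_distrib vec.scale_right_distrib add.commute)
  then have "\<rho> (ham r) (\<rho> (ham s) v) - \<rho> (ham s) (\<rho> (ham r) v) = sc ?w (\<rho> (ham (r + s)) v)"
    using act_br[OF ham_mem ham_mem v, of r s] rho_left(3)[OF v ham_mem[of "r + s"], of ?w] by simp
  then have "\<mu> (tpow (- (r + s))) (\<rho> (ham r) (\<rho> (ham s) v)) - \<mu> (tpow (- (r + s))) (\<rho> (ham s) (\<rho> (ham r) v))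
      = sc ?w (jet_op (r + s) v)"
    using v rho(1)[OF ham_mem[of "r + s"] v] by (simp add: jet_op_def mu_diff[symmetric] mu rho[OF ham_mem])
  then show ?thesis
    unfolding comp[of r s] comp[of s r] skew[of s r]
    by (simp add: V.scale_right_diff_distrib add.commute[of s r] algebra_simps)
qed

section \<open>Comparison of \<open>V\<close> with the tensor product\<close>

definition assemble :: "('n, 'v) graded \<Rightarrow> 'v" where
  "assemble x = (\<Sum>k\<in>Poly_Mapping.keys x. \<mu> (tpow k) (Poly_Mapping.lookup x k))"

lemma assemble_single: "assemble (Poly_Mapping.single k v) = \<mu> (tpow k) v"
  by (cases "v = 0") (simp_all add: assemble_def)

lemma assemble_linear: "linear_on (pm_scale sc) (tensor_laurent V) sc V assemble"
proof (rule linear_onI)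
  have mem: "Poly_Mapping.lookup x k \<in> V" if "x \<in> tensor_laurent V" for x and k :: "int^'n"
    using that by (simp add: tensor_laurent_def)
  fix x :: "('n, 'v) graded" assume x: "x \<in> tensor_laurent V"
  show "assemble x \<in> V"
    unfolding assemble_def using x by (intro V.subspace_sum[OF subspace_V] mu(1) mem)
  show "assemble (x + y) = assemble x + assemble y" if "y \<in> tensor_laurent V" for y
    unfolding assemble_def using mem[OF x] mem[OF that] by (intro setsum_keys_plus_distrib) (simp_all add: mu)
  have pm: "Poly_Mapping.lookup (pm_scale sc c x) k = sc c (Poly_Mapping.lookup x k)" for c k
    by (rule lookup_pm_scale[OF V.vector_space_axioms])
  show "assemble (pm_scale sc c x) = sc c (assemble x)" for c
  proof (cases "c = 0")
    case True
    then have "pm_scale sc c x = 0" by (intro poly_mapping_eqI) (simp add: pm)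
    with True show ?thesis by (simp add: assemble_def)
  next
    case False
    then have "Poly_Mapping.keys (pm_scale sc c x) = Poly_Mapping.keys x" by (auto simp: in_keys_iff pm)
    then show ?thesis unfolding assemble_def pm V.scale_sum_right by (simp add: mu mem[OF x])
  qed
qed

text \<open>The weights \<open>b + cvec k\<close> are distinct, so the vectors \<open>g k\<close>
  form a decomposition of 0 into weight vectors, and that decomposition is unique.\<close>

lemma weight_vectors_independent:
  assumes ds: "direct_sum_of V weight_space" and K: "finite K"
    and g: "\<And>k. k \<in> K \<Longrightarrow> g k \<in> weight_space (b + cvec k)" and sum: "(\<Sum>k\<in>K. g k) = 0" and k: "k \<in> K"
  shows "g k = 0"
proof -
  define f where "f l = (\<Sum>k\<in>K. if l = b + cvec k then g k else 0)" for l
  have f1: "f (b + cvec k) = g k" if "k \<in> K" for k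
    using K that by (simp add: f_def cvec_eq_iff)
  have f0: "f l = 0" if "l \<notin> (\<lambda>k. b + cvec k) ` K" for l
    unfolding f_def using that by (intro sum.neutral) auto
  have fin: "{l. f l \<noteq> 0} \<subseteq> (\<lambda>k. b + cvec k) ` K" using f0 by blast
  have "(\<Sum>l | f l \<noteq> 0. f l) = (\<Sum>l\<in>(\<lambda>k. b + cvec k) ` K. f l)"
    using fin K by (intro sum.mono_neutral_left) auto
  also have "\<dots> = (\<Sum>k\<in>K. g k)"
    by (subst sum.reindex) (auto simp: inj_on_def cvec_eq_iff f1 intro!: sum.cong)
  finally have s: "(\<Sum>l | f l \<noteq> 0. f l) = 0" using sum by simp
  have W: "f l \<in> weight_space l" for l
  proof (cases "l \<in> (\<lambda>k. b + cvec k) ` K")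
    case True
    then show ?thesis using f1 g by auto
  next
    case False
    then show ?thesis using f0 weight_space_closed(1) by simp
  qed
  have "0 \<in> V" using V_closed(1) .
  with ds have ex1: "\<exists>!f. (\<forall>i. f i \<in> weight_space i) \<and> finite {i. f i \<noteq> 0} \<and> 0 = (\<Sum>i | f i \<noteq> 0. f i)"
    unfolding direct_sum_of_def by blast
  have "f = (\<lambda>_. 0)"
    by (rule ex1E[OF ex1]) (use W s finite_subset[OF fin] K weight_space_closed(1) in
      \<open>metis (mono_tags, lifting) finite_imageI Collect_empty_eq finite.emptyI sum.empty\<close>)
  then show ?thesis using f1[OF k] by simp
qed

lemma assemble_inj:
  assumes ds: "direct_sum_of V weight_space"
  shows "inj_on assemble (tensor_laurent (weight_space b))"
proof (rule inj_onI)
  fix x y :: "('n, 'v) graded"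
  assume x: "x \<in> tensor_laurent (weight_space b)" and y: "y \<in> tensor_laurent (weight_space b)"
    and eq: "assemble x = assemble y"
  note wt = x[unfolded tensor_laurent_def] y[unfolded tensor_laurent_def]
  have sub: "tensor_laurent (weight_space b) \<subseteq> (tensor_laurent V :: ('n, 'v) graded set)"
    by (auto simp: tensor_laurent_def intro: weight_space_V)
  have d: "Poly_Mapping.lookup (x - y) k \<in> weight_space b" for k
    using wt by (simp add: lookup_minus weight_space_closed(3))
  have "assemble ((x - y) + y) = assemble (x - y) + assemble y"
    using d y sub by (intro linear_onD(2)[OF assemble_linear]) (auto simp: tensor_laurent_def intro: weight_space_V)
  then have "assemble (x - y) = 0" using eq by simp
  then have s: "(\<Sum>k\<in>Poly_Mapping.keys (x - y). \<mu> (tpow k) (Poly_Mapping.lookup (x - y) k)) = 0"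
    by (simp add: assemble_def)
  have "Poly_Mapping.lookup (x - y) k = 0" for k
  proof (rule ccontr)
    assume nz: "Poly_Mapping.lookup (x - y) k \<noteq> 0"
    then have "\<mu> (tpow k) (Poly_Mapping.lookup (x - y) k) = 0"
      using mu_tpow_weight[OF d] by (intro weight_vectors_independent[OF ds finite_keys _ s, where b = b]) (auto simp: in_keys_iff)
    then have "\<mu> (tpow (- k)) (\<mu> (tpow k) (Poly_Mapping.lookup (x - y) k)) = 0" by simp
    then show False using nz weight_space_V[OF d] by (simp add: mu_tpow_add mult_one)
  qed
  then have "x - y = 0" by (intro poly_mapping_eqI) simp
  then show "x = y" by simp
qed

text \<open>The span of the translates of \<open>U\<close> is stable under the monomials by
  construction, under the Cartan part because the generators are weight vectors, and under
  \<open>ham r\<close> by \<open>rho_ham_mu\<close>. Thus irreducibility of \<open>V\<close> passes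
  to a single weight space.\<close>

lemma span_translates_submodule:
  assumes irr: jet_irreducible and U: "V.subspace U" "U \<subseteq> weight_space b"
    and inv: "\<And>r u. u \<in> U \<Longrightarrow> jet_op r u \<in> U"
  shows "U = {0} \<or> V = V.span {\<mu> (tpow k) u | k u. u \<in> U}"
proof -
  let ?G = "{\<mu> (tpow k) u | k u. u \<in> U}"
  have UV: "u \<in> V" if "u \<in> U" for u using that U(2) weight_space_V by blast
  have GV: "V.span ?G \<subseteq> V"
    by (rule V.span_minimal[OF _ subspace_V]) (auto simp: mu UV)
  have stable: "g x \<in> V.span ?G"
    if lin: "linear_on sc V sc V g" and gen: "\<And>k u. u \<in> U \<Longrightarrow> g (\<mu> (tpow k) u) \<in> V.span ?G"
      and x: "x \<in> V.span ?G" for g x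
  proof -
    have "x \<in> V \<and> g x \<in> V.span ?G"
      using x
    proof (induct rule: V.span_induct_alt)
      case base
      have "g 0 = 0" using linear_onD(3)[OF lin, of 0 0] V_closed(1) by simp
      then show ?case using V_closed(1) V.span_zero by simp
    next
      case (step c y z)
      then obtain k u where y: "y = \<mu> (tpow k) u" "u \<in> U" by blast
      then have yV: "y \<in> V" by (simp add: mu UV)
      then have "g (sc c y + z) = sc c (g y) + g z"
        using step linear_onD[OF lin] V_closed(4) by simp
      then show ?case
        using step yV gen y by (simp add: V.span_add V.span_scale V_closed(2) V_closed(4))
    qed
    then show ?thesis by simp
  qed
  have base: "\<mu> (tpow k) u \<in> V.span ?G" if "u \<in> U" for k u
    using that by (intro V.span_base) blast
  have "\<mu> f x \<in> V.span ?G" if "x \<in> V.span ?G" for f x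
  proof (rule stable[OF mult_linear _ that])
    fix k u assume u: "u \<in> U"
    have uV: "\<mu> (tpow k) u \<in> V" using u by (simp add: mu UV)
    show "\<mu> f (\<mu> (tpow k) u) \<in> V.span ?G"
    proof (induct f rule: laurent_induct)
      case (monom c r)
      show ?case
        using base[OF u, of "r + k"] uV u by (simp add: mu_left mu_tpow_add UV V.span_scale)
    next
      case (add f g)
      then show ?case using uV by (simp add: mu_left V.span_add)
    qed
  qed
  moreover have "\<rho> \<eta> x \<in> V.span ?G" if "\<eta> \<in> Ham_ext B" "x \<in> V.span ?G" for \<eta> x
  proof (rule stable[OF act_linear[OF that(1)] _ that(2)])
    fix k u assume u: "u \<in> U"
    have uV: "\<mu> (tpow k) u \<in> V" using u by (simp add: mu UV)
    from that(1) show "\<rho> \<eta> (\<mu> (tpow k) u) \<in> V.span ?G"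
    proof (induct rule: Ham_ext_induct)
      case (ham r)
      show ?case
        unfolding rho_ham_mu[OF UV[OF u]]
        by (intro base V.subspace_add[OF U(1)] V.subspace_scale[OF U(1)] u inv)
    next
      case (cartan y)
      have "\<mu> (tpow k) u \<in> weight_space (b + cvec k)" using u U(2) by (intro mu_tpow_weight) blast
      then show ?case using base[OF u] by (simp add: weight_space_def V.span_scale)
    next
      case (add \<eta> \<theta>)
      show ?case unfolding rho_left(2)[OF uV add(1,2)] by (rule V.span_add[OF add(3,4)])
    next
      case (scale c \<eta>)
      then show ?case using uV by (simp add: rho_left V.span_scale)
    qed
  qed
  ultimately have "V.span ?G = {0} \<or> V.span ?G = V"
    using irr GV V.subspace_span unfolding jet_irreducible_def by blast
  moreover have "U = {0}" if "V.span ?G = {0}"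
  proof -
    have "u = 0" if "u \<in> U" for u
      using base[OF that, of 0] \<open>V.span ?G = {0}\<close> UV[OF that] by (simp add: mult_one)
    then show ?thesis using V.subspace_0[OF U(1)] by blast
  qed
  ultimately show ?thesis by blast
qed

lemma V_subset_assemble:
  assumes V: "V = V.span {\<mu> (tpow k) u | k u. u \<in> U}" and U: "V.subspace U" "U \<subseteq> V"
  shows "V \<subseteq> assemble ` tensor_laurent U"
proof -
  have sub: "tensor_laurent U \<subseteq> (tensor_laurent V :: ('n, 'v) graded set)"
    using U(2) by (auto simp: tensor_laurent_def)
  have single: "Poly_Mapping.single k u \<in> (tensor_laurent U :: ('n, 'v) graded set)" if "u \<in> U" for k u
    using that V.subspace_0[OF U(1)] by (simp add: tensor_laurent_def lookup_single when_def)
  have closed: "x + y \<in> tensor_laurent U" "pm_scale sc c x \<in> tensor_laurent U"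
    if "x \<in> tensor_laurent U" "y \<in> tensor_laurent U" for x y :: "('n, 'v) graded" and c
    using that V.subspace_add[OF U(1)] V.subspace_scale[OF U(1)]
    by (simp_all add: tensor_laurent_def lookup_add lookup_pm_scale[OF V.vector_space_axioms])
  note lin = linear_onD[OF assemble_linear]
  have "V.subspace (assemble ` tensor_laurent U)"
  proof (rule V.subspaceI)
    show "0 \<in> assemble ` tensor_laurent U"
      using single[OF V.subspace_0[OF U(1)], of 0] by (intro image_eqI) (auto simp: assemble_def)
  next
    fix x y assume "x \<in> assemble ` tensor_laurent U" "y \<in> assemble ` tensor_laurent U"
    then show "x + y \<in> assemble ` tensor_laurent U"
      using lin(2) closed(1) sub by (smt (verit, best) image_iff subsetD)
  next
    fix c x assume "x \<in> assemble ` tensor_laurent U"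
    then show "sc c x \<in> assemble ` tensor_laurent U"
      using lin(3) closed(2) sub by (smt (verit, best) image_iff subsetD)
  qed
  moreover have "{\<mu> (tpow k) u | k u. u \<in> U} \<subseteq> assemble ` tensor_laurent U"
    using single assemble_single by (smt (verit, best) Collect_mono_iff image_iff mem_Collect_eq subsetI)
  ultimately have "V.span {\<mu> (tpow k) u | k u. u \<in> U} \<subseteq> assemble ` tensor_laurent U"
    by (rule V.span_minimal[rotated])
  then show ?thesis using V by blast
qed

end

section \<open>The quotient map\<close>

text \<open>\<open>symplectic_basis\<close> is applied to \<open>- B\<close>: the matrix of
  \<open>omega\<close> acts on the second argument, that of \<open>(Bx|y)\<close> on the first, and
  \<open>B\<close> is skew. \<open>P\<close> is the inverse of the matrix \<open>M\<close> found
  there.\<close>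

lemma exists_symplectic_change:
  fixes B :: "('m::finite) smat"
  assumes B: "transpose B = - B" "invertible B"
  shows "\<exists>P M :: 'm smat. M ** P = mat 1 \<and> P ** M = mat 1 \<and>
    (\<forall>x y. omega (P *v x) (P *v y) = scalar_product (B *v x) y)"
proof -
  interpret symplectic_lattice B by standard (fact B)+
  obtain A where A: "A ** B = mat 1" "B ** A = mat 1" using B(2) by (auto simp: invertible_def)
  have neg: "(- X) ** (- Y) = X ** Y" for X Y :: "'m smat"
    by (rule matrix_eqI) (simp add: matrix_vector_mul_assoc[symmetric] matrix_apply_simps)
  have "transpose (- B) = - transpose B" by (simp add: transpose_def vec_eq_iff)
  then have "transpose (- B) = - (- B)" by (simp only: B(1))
  moreover have "invertible (- B)"
    unfolding invertible_def using neg A by (intro exI[of _ "- A"]) simp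
  ultimately obtain M :: "'m smat" where M: "transpose M ** (- B) ** M = sympl_form"
    using symplectic_basis by blast
  define P where "P = - sympl_form ** transpose M ** (- B)"
  have PM: "P ** M = mat 1"
  proof -
    have "P ** M = - sympl_form ** (transpose M ** (- B) ** M)" by (simp add: P_def matrix_mul_assoc)
    also have "\<dots> = mat 1"
      unfolding M
      by (rule matrix_eqI) (simp add: matrix_vector_mul_assoc[symmetric] matrix_apply_simps sympl_form_square)
    finally show ?thesis .
  qed
  then have MP: "M ** P = mat 1" by (simp add: matrix_left_right_inverse)
  have "omega (P *v x) (P *v y) = scalar_product (B *v x) y" for x y
  proof -
    have MPx: "M *v (P *v z) = z" for z by (simp add: matrix_vector_mul_assoc MP)
    have "omega (P *v x) (P *v y) = scalar_product (P *v x) (transpose M *v ((- B) *v (M *v (P *v y))))"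
      unfolding omega_def M[symmetric] by (simp only: matrix_vector_mul_assoc[symmetric])
    also have "\<dots> = scalar_product (transpose M *v (- B *v y)) (P *v x)"
      by (simp only: MPx scalar_product_commute)
    also have "\<dots> = scalar_product (- B *v y) (M *v (P *v x))" by (simp only: scalar_product_transpose)
    also have "\<dots> = scalar_product (B *v x) y"
      using scalar_product_skew[of x y] by (simp add: MPx matrix_apply_simps)
    finally show ?thesis .
  qed
  with MP PM show ?thesis by blast
qed

locale lie_quotient = symplectic_lattice B for B :: "('m::finite) smat" +
  fixes P M :: "'m smat"
  assumes MP: "M ** P = mat 1" and PM: "P ** M = mat 1"
    and omega_P: "omega (P *v x) (P *v y) = scalar_product (B *v x) y"
begin

text \<open>Only the matrix part is transported by \<open>P\<close>; the central part keeps the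
  original coordinates.\<close>

definition gen :: "int^('m + 'm) \<Rightarrow> coords" where
  "gen r = embed (mat_scale (1 / 2) (tv (P *v cvec r) (P *v cvec r)), cvec r)"

definition quot :: "('m + 'm) laurent \<Rightarrow> coords" where
  "quot f = (\<Sum>k\<in>Poly_Mapping.keys f. lscale (Poly_Mapping.lookup f k) (gen k))"

lemma gen_0: "gen 0 = 0"
  by (simp add: gen_def matrix_apply_simps tv_simps embed_eq_0_iff zero_prod_def)

lemma quot_add: "quot (f + g) = quot f + quot g"
  unfolding quot_def by (rule setsum_keys_plus_distrib) (simp_all add: lscale.scale_left_distrib)

lemma quot_scale: "quot (lscale c f) = lscale c (quot f)"
proof (cases "c = 0")
  case False
  then have "Poly_Mapping.keys (lscale c f) = Poly_Mapping.keys f"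
    by (auto simp: in_keys_iff)
  then show ?thesis by (simp add: quot_def lscale.scale_sum_right)
qed (simp add: quot_def)

lemma quot_tpow: "quot (tpow r) = gen r"
  by (simp add: quot_def tpow_def)

lemma quot_0: "quot 0 = 0"
  by (simp add: quot_def)

lemma quot_diff: "quot (f - g) = quot f - quot g"
  using quot_add[of "f - g" g] by simp

lemma quot_sum: "quot (\<Sum>i\<in>I. f i) = (\<Sum>i\<in>I. quot (f i))"
  by (induct I rule: infinite_finite_induct) (simp_all add: quot_0 quot_add)

lemma quot_T: "quot (T r) = gen r"
  by (cases "r = 0") (simp_all add: T_def quot_0 gen_0 quot_tpow flip: tpow_def)

lemma gen_mem: "gen r \<in> Lsp TYPE('m)"
  by (simp add: gen_def sp_scale tv_sp)

interpretation L: lie_algebra lscale "Lsp TYPE('m)" "Lbr TYPE('m)"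
  by (rule lie_algebra_Lsp)

lemma quot_mem: "quot f \<in> Lsp TYPE('m)"
  unfolding quot_def
  by (intro lscale.subspace_sum[OF L.subspace_L] lscale.subspace_scale[OF L.subspace_L] gen_mem)

lemma gen_add: "gen (r + s) - gen r - gen s = embed (tv (P *v cvec r) (P *v cvec s), 0)"
proof -
  have "mat_scale (1/2) (tv (a + b) (a + b)) - mat_scale (1/2) (tv a a) - mat_scale (1/2) (tv b b) = tv a b"
    for a b :: "'m svec"
    by (rule matrix_eqI) (simp add: tv_apply matrix_apply_simps vec_eq_iff algebra_simps)
  then show ?thesis
    by (simp add: gen_def embed_diff[symmetric] matrix_apply_simps)
qed

text \<open>Both sides are \<open>w r s\<close> times \<open>tv (P *v cvec r) (P *v cvec s)\<close>:
  the two halves in \<open>gen\<close> cancel the 4 of \<open>mat_br_tv_tv\<close>.\<close>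

lemma gen_bracket: "Lbr TYPE('m) (gen r) (gen s) = lscale (w r s) (gen (r + s) - gen r - gen s)"
  unfolding gen_add by (simp add: gen_def mat_br_simps mat_br_tv_tv omega_P w_def embed_scale[symmetric])

lemma Lbr_sum:
  "Lbr TYPE('m) (\<Sum>i\<in>I. lscale (a i) (x i)) (\<Sum>j\<in>J. lscale (b j) (y j))
    = (\<Sum>i\<in>I. \<Sum>j\<in>J. lscale (a i * b j) (Lbr TYPE('m) (x i) (y j)))"
proof -
  have pair: "embed (X + Y, 0 :: 'm svec) = embed (X, 0) + embed (Y, 0)"
    "embed (mat_scale c X, 0 :: 'm svec) = lscale c (embed (X, 0))" for X Y :: "'m smat" and c
    by (simp_all add: embed_add[symmetric] embed_scale[symmetric])
  have add: "Lbr TYPE('m) (x + x') y = Lbr TYPE('m) x y + Lbr TYPE('m) x' y"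
    "Lbr TYPE('m) x (y + y') = Lbr TYPE('m) x y + Lbr TYPE('m) x y'"
    "Lbr TYPE('m) (lscale c x) y = lscale c (Lbr TYPE('m) x y)"
    "Lbr TYPE('m) x (lscale c y) = lscale c (Lbr TYPE('m) x y)"
    "Lbr TYPE('m) 0 y = 0" "Lbr TYPE('m) x 0 = 0" for x x' y y' c
    by (simp_all add: Lbr_def mat_br_simps pair) (simp_all add: mat_br_simps zero_prod_def[symmetric])
  have r: "Lbr TYPE('m) z (\<Sum>j\<in>J. lscale (b j) (y j)) = (\<Sum>j\<in>J. lscale (b j) (Lbr TYPE('m) z (y j)))" for z
    by (induct J rule: infinite_finite_induct) (simp_all add: add)
  have l: "Lbr TYPE('m) (\<Sum>i\<in>I. lscale (a i) (x i)) z = (\<Sum>i\<in>I. lscale (a i) (Lbr TYPE('m) (x i) z))" for z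
    by (induct I rule: infinite_finite_induct) (simp_all add: add)
  show ?thesis by (simp add: r l lscale.scale_sum_right mult.commute) (rule sum.swap)
qed

lemma quot_TB_br: "quot (TB_br B f g) = Lbr TYPE('m) (quot f) (quot g)"
  unfolding quot_def[of f] quot_def[of g] Lbr_sum gen_bracket
  by (simp add: TB_br_def quot_sum quot_scale quot_diff quot_T w_def)

lemma lie_hom_quot: "lie_hom lscale TB (TB_br B) lscale (Lsp TYPE('m)) (Lbr TYPE('m)) quot"
  unfolding lie_hom_def
  by (intro conjI linear_onI ballI quot_mem quot_add quot_scale quot_TB_br)

text \<open>Second differences of \<open>gen\<close> isolate the matrices
  \<open>tv (P *v cvec r) (P *v cvec s)\<close>, which span \<open>sp\<close> because the integral
  vectors span the complex space. What is then left of \<open>gen r\<close> is the central vector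
  \<open>cvec r\<close>.\<close>

lemma quot_surj: "quot ` TB = Lsp TYPE('m)"
proof
  show "quot ` TB \<subseteq> Lsp TYPE('m)" using quot_mem by blast
  define R where "R = range quot"
  have R: "lscale.subspace R"
    unfolding R_def
  proof (rule lscale.subspaceI)
    show "0 \<in> range quot" using rangeI[of quot 0] by (simp add: quot_0)
  next
    fix x y assume "x \<in> range quot" "y \<in> range quot"
    then obtain f g where "x = quot f" "y = quot g" by auto
    then show "x + y \<in> range quot" using rangeI[of quot "f + g"] by (simp add: quot_add)
  next
    fix c x assume "x \<in> range quot"
    then obtain f where "x = quot f" by auto
    then show "lscale c x \<in> range quot" using rangeI[of quot "lscale c f"] by (simp add: quot_scale)
  qed
  have gen: "gen r \<in> R" for r unfolding R_def using rangeI[of quot "tpow r"] by (simp add: quot_tpow)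
  have tvP: "embed (tv (P *v cvec r) (P *v cvec s), 0) \<in> R" for r s
    unfolding gen_add[symmetric] by (intro lscale.subspace_diff[OF R] gen)
  have cvec_R: "embed (0 :: 'm smat, cvec r) \<in> R" for r
  proof -
    have "gen r - lscale (1/2) (embed (tv (P *v cvec r) (P *v cvec r), 0)) \<in> R"
      by (intro lscale.subspace_diff[OF R] lscale.subspace_scale[OF R] gen tvP)
    then show ?thesis by (simp add: gen_def embed_diff[symmetric] embed_scale[symmetric])
  qed
  have axis_expand: "(\<Sum>i\<in>UNIV. u $ i *s cvec (axis i 1)) = u" for u :: "'m svec"
  proof -
    have "cvec (axis i 1) = (axis i 1 :: 'm svec)" for i
      by (simp add: cvec_def axis_def vec_eq_iff)
    then show ?thesis by (simp add: basis_expansion)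
  qed
  have pair: "embed (0 :: 'm smat, a + b) = embed (0, a) + embed (0, b)"
    "embed (X + Y, 0 :: 'm svec) = embed (X, 0) + embed (Y, 0)"
    for a b :: "'m svec" and X Y :: "'m smat"
    by (simp_all add: embed_add[symmetric])
  have embed_sum2: "embed (0 :: 'm smat, \<Sum>i\<in>I. g i) = (\<Sum>i\<in>I. embed (0, g i))" for g and I :: "('m + 'm) set"
    by (induct I rule: infinite_finite_induct) (simp_all add: pair zero_prod_def[symmetric])
  have embed_sum1: "embed (\<Sum>i\<in>I. g i, 0 :: 'm svec) = (\<Sum>i\<in>I. embed (g i, 0))" for g and I :: "('m + 'm) set"
    by (induct I rule: infinite_finite_induct) (simp_all add: pair zero_prod_def[symmetric])
  have u_R: "embed (0 :: 'm smat, u) \<in> R" for u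
  proof -
    have "(\<Sum>i\<in>UNIV. lscale (u $ i) (embed (0 :: 'm smat, cvec (axis i 1)))) \<in> R"
      by (intro lscale.subspace_sum[OF R] lscale.subspace_scale[OF R] cvec_R)
    then show ?thesis
      using embed_sum2[of "\<lambda>i. u $ i *s cvec (axis i 1)" UNIV, unfolded axis_expand]
      by (simp add: embed_scale[symmetric])
  qed
  have "embed (tv s s, 0) \<in> R" for s :: "'m svec"
  proof -
    define c where "c = M *v s"
    define e where "e i = P *v cvec (axis i 1)" for i
    have s: "s = (\<Sum>i\<in>UNIV. c $ i *s e i)"
    proof -
      have "s = P *v (\<Sum>i\<in>UNIV. c $ i *s cvec (axis i 1))"
        unfolding axis_expand by (simp add: c_def matrix_vector_mul_assoc PM)
      then show ?thesis by (simp add: vec.sum vec.scale e_def)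
    qed
    have tvsum: "tv (\<Sum>i\<in>I. c $ i *s e i) v = (\<Sum>i\<in>I. mat_scale (c $ i) (tv (e i) v))" for I and v :: "'m svec"
      by (induct I rule: infinite_finite_induct) (simp_all add: tv_simps)
    have "tv s s = (\<Sum>i\<in>UNIV. mat_scale (c $ i) (\<Sum>j\<in>UNIV. mat_scale (c $ j) (tv (e j) (e i))))"
      unfolding s tvsum by (subst tv_simps(1), subst tvsum) (rule refl)
    then have "embed (tv s s, 0) = (\<Sum>i\<in>UNIV. lscale (c $ i) (\<Sum>j\<in>UNIV. lscale (c $ j) (embed (tv (e j) (e i), 0))))"
      by (simp add: embed_sum1[symmetric] embed_scale[symmetric])
    also have "\<dots> \<in> R"
      unfolding e_def by (intro lscale.subspace_sum[OF R] lscale.subspace_scale[OF R] tvP)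
    finally show ?thesis .
  qed
  from embed_sp_subset[OF R this] have sp_R: "embed (X, 0) \<in> R" if "X \<in> (sp :: 'm smat set)" for X
    using that by blast
  show "Lsp TYPE('m) \<subseteq> quot ` TB"
  proof
    fix x assume "x \<in> Lsp TYPE('m)"
    then obtain X u where X: "x = embed (X, u)" "X \<in> (sp :: 'm smat set)" by (rule Lsp_cases)
    have "embed (X, 0) + embed (0, u) \<in> R" using sp_R[OF X(2)] u_R by (intro lscale.subspace_add[OF R])
    then have "x \<in> R" by (simp add: X(1) embed_add[symmetric])
    then obtain f where f: "x = quot f" by (auto simp: R_def)
    \<comment> \<open>Removing the constant term moves \<open>f\<close> into \<open>TB\<close>, and
      the image does not change because \<open>gen 0 = 0\<close>.\<close>
    define g where "g = f - lscale (Poly_Mapping.lookup f 0) (tpow 0)"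
    have "g \<in> TB" by (simp add: TB_def g_def lookup_minus lookup_one)
    moreover have "quot g = x" by (simp add: g_def quot_diff quot_scale quot_tpow gen_0 f del: tpow_0)
    ultimately show "x \<in> quot ` TB" by blast
  qed
qed

text \<open>The matrix part of \<open>gen r\<close> is \<open>(P r) (P r)^T J\<close> with
  \<open>J\<close> the matrix of the form. Multiplying by \<open>- J\<close> on the right removes
  \<open>J\<close>, and \<open>M\<close> on both sides removes \<open>P\<close>; what results is
  \<open>r r^T\<close>.\<close>

definition unconj :: "'m smat \<Rightarrow> 'm smat" where
  "unconj X = M ** X ** (- sympl_form) ** transpose M"

lemma unconj_linear: "unconj (X + Y) = unconj X + unconj Y" "unconj (mat_scale c X) = mat_scale c (unconj X)"
  by (rule matrix_eqI; simp add: unconj_def matrix_vector_mul_assoc[symmetric] matrix_apply_simps)+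

lemma unconj_gen: "unconj (mat_scale (1 / 2) (tv (P *v cvec r) (P *v cvec r))) = (\<chi> i j. of_int (r $ i) * of_int (r $ j))"
proof (rule matrix_eqI)
  fix y
  have MPr: "M *v (P *v z) = z" for z by (simp add: matrix_vector_mul_assoc MP)
  have half: "(1 / 2) *s (x + x) = x" for x :: "'m svec" by (simp add: vec_eq_iff)
  have o: "omega (P *v cvec r) ((- sympl_form) *v z) = scalar_product (P *v cvec r) z" for z
    by (simp add: omega_def matrix_apply_simps sympl_form_square)
  have "scalar_product (P *v cvec r) (transpose M *v y) = scalar_product y (M *v (P *v cvec r))"
    by (simp only: scalar_product_transpose scalar_product_commute[of "P *v cvec r"])
  then have sp: "scalar_product (P *v cvec r) (transpose M *v y) = scalar_product (cvec r) y"
    by (simp only: MPr scalar_product_commute)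
  have "unconj (mat_scale (1 / 2) (tv (P *v cvec r) (P *v cvec r))) *v y = scalar_product (cvec r) y *s cvec r"
    unfolding unconj_def matrix_vector_mul_assoc[symmetric] mat_scale_apply tv_apply o sp half
    by (simp add: matrix_apply_simps MPr)
  also have "\<dots> = (\<chi> i j. of_int (r $ i) * of_int (r $ j)) *v y"
    by (simp add: vec_eq_iff matrix_vector_mult_def scalar_product_def cvec_def sum_distrib_left mult.commute mult.left_commute)
  finally show "unconj (mat_scale (1 / 2) (tv (P *v cvec r) (P *v cvec r))) *v y = (\<chi> i j. of_int (r $ i) * of_int (r $ j)) *v y" .
qed

end

section \<open>The action of the quotient on \<open>V0\<close>\<close>

locale lie_quotient_module = lie_quotient B P M + jet_core B sc V0 Pr \<tau>
  for B :: "('m::finite) smat" and P M and sc :: "complex \<Rightarrow> 'v::ab_group_add \<Rightarrow> 'v"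
    and V0 :: "'v set" and Pr :: "'v aend" and \<tau> :: "int^('m + 'm) \<Rightarrow> 'v aend"
begin

text \<open>The descent of \<open>TT\<close> along \<open>quot\<close>, by a formula that makes
  linearity evident and chooses no preimages.\<close>

definition sig :: "coords \<Rightarrow> 'v aend" where
  "sig x = rep0 (unconj (fst (unembed x)), snd (unembed x))"

lemma sig_add: "sig (x + y) = sig x + sig y"
  unfolding sig_def by (simp add: unconj_linear rep0_add[symmetric])

lemma sig_scale: "sig (lscale c x) = esc c (sig x)"
  unfolding sig_def by (simp add: unconj_linear rep0_scale)

lemma sig_End0: "sig x \<in> End0"
  unfolding sig_def by (rule rep0_End0)

lemma sig_gen: "sig (gen r) = \<tau> r"
  unfolding sig_def gen_def by (simp add: unconj_gen rep0_tau)

lemma sig_quot: "sig (quot f) = TT f"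
  by (induct f rule: laurent_induct) (simp_all add: quot_scale quot_add quot_tpow sig_scale sig_add sig_gen)

lemma TT_T: "TT (T r) = \<tau> r"
  by (cases "r = 0") (simp_all add: T_def T_0 flip: tpow_def)

lemma TT_TB_br: "TT (TB_br B f g) = TT f * TT g - TT g * TT f"
proof -
  have "TT (TB_br B f g) = (\<Sum>r\<in>Poly_Mapping.keys f. \<Sum>s\<in>Poly_Mapping.keys g.
      esc (Poly_Mapping.lookup f r * Poly_Mapping.lookup g s) (\<tau> r * \<tau> s - \<tau> s * \<tau> r))"
    by (simp add: TB_br_def TT_sum TT_T T_bracket w_def)
  also have "\<dots> = (\<Sum>r\<in>Poly_Mapping.keys f. \<Sum>s\<in>Poly_Mapping.keys g.
      esc (Poly_Mapping.lookup f r) (\<tau> r) * esc (Poly_Mapping.lookup g s) (\<tau> s)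
      - esc (Poly_Mapping.lookup g s) (\<tau> s) * esc (Poly_Mapping.lookup f r) (\<tau> r))"
    by (intro sum.cong refl) (simp add: E.scale_right_diff_distrib mult.commute)
  also have "\<dots> = TT f * TT g - TT g * TT f"
    unfolding sum_subtractf TT_def[of f] TT_def[of g] sum_product
    by (simp add: sum.swap[of _ "Poly_Mapping.keys g"])
  finally show ?thesis .
qed

lemma lie_module_sig: "lie_module lscale (Lsp TYPE('m)) (Lbr TYPE('m)) sc V0 (\<lambda>x. app (sig x))"
proof -
  interpret L: lie_algebra lscale "Lsp TYPE('m)" "Lbr TYPE('m)" by (rule lie_algebra_Lsp)
  show ?thesis
  proof
    show "subspace V0" by (rule V0_sub)
    show "linear_on sc V0 sc V0 (app (sig x))" for x
      using sig_End0[of x] by (intro linear_onI) (simp_all add: End0_mem app_add End0_homog[unfolded homog_def])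
    show "linear_on lscale (Lsp TYPE('m)) sc V0 (\<lambda>x. app (sig x) v)" if "v \<in> V0" for v
      by (intro linear_onI) (simp_all add: End0_mem[OF sig_End0] sig_add sig_scale)
    fix x y v
    assume "x \<in> Lsp TYPE('m)" "y \<in> Lsp TYPE('m)"
    \<comment> \<open>Surjectivity of \<open>quot\<close> turns the bracket relation into the one in
      \<open>TB\<close>, which \<open>TT\<close> satisfies.\<close>
    then obtain f g where "x = quot f" "y = quot g" using quot_surj by blast
    then show "app (sig (Lbr TYPE('m) x y)) v = app (sig x) (app (sig y) v) - app (sig y) (app (sig x) v)"
      by (simp add: quot_TB_br[symmetric] sig_quot TT_TB_br)
  qed
qed

lemma irreducible_sig: "lie_module.irreducible (Lsp TYPE('m)) sc V0 (\<lambda>x. app (sig x))"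
proof -
  interpret LM: lie_module lscale "Lsp TYPE('m)" "Lbr TYPE('m)" sc V0 "\<lambda>x. app (sig x)" by (rule lie_module_sig)
  show ?thesis
    unfolding LM.irreducible_def
  proof (intro conjI allI impI V0_nonzero)
    fix W assume W: "subspace W \<and> W \<subseteq> V0 \<and> (\<forall>x\<in>Lsp TYPE('m). \<forall>w\<in>W. app (sig x) w \<in> W)"
    have "app (\<tau> r) u \<in> W" if "u \<in> W" for r u
      using W that gen_mem[of r] sig_gen[of r] by metis
    with W show "W = {0} \<or> W = V0" by (intro irr) auto
  qed
qed

end

section \<open>The main theorem\<close>

lemma (in vector_space) exists_projection:
  assumes "subspace U"
  obtains p where "\<And>x y. p (x + y) = p x + p y" "\<And>c x. p (scale c x) = scale c (p x)"
    "\<And>x. p x \<in> U" "\<And>x. x \<in> U \<Longrightarrow> p x = x"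
proof -
  interpret vector_space_pair scale scale ..
  have "Vector_Spaces.linear scale scale (\<lambda>x. x)" by (rule linear_ident)
  then obtain p where p: "range p \<subseteq> U" "Vector_Spaces.linear scale scale p" "\<forall>v\<in>U. p v = v"
    using linear_exists_left_inverse_on[of "\<lambda>x. x" U] assms by (auto simp: inj_on_def)
  interpret p: Vector_Spaces.linear scale scale p by (rule p(2))
  show ?thesis using that p p.add p.scale by blast
qed

lemma (in jet_module) exists_nonzero_weight_space:
  assumes "direct_sum_of V weight_space" "V \<noteq> {0}"
  shows "\<exists>l. weight_space l \<noteq> {0}"
proof (rule ccontr)
  assume *: "\<not> ?thesis"
  obtain v where v: "v \<in> V" "v \<noteq> 0" using assms(2) V_closed(1) by blast
  from assms(1) v(1) obtain f where f: "\<forall>i. f i \<in> weight_space i" "v = (\<Sum>i | f i \<noteq> 0. f i)"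
    unfolding direct_sum_of_def by blast
  then have "f i = 0" for i using * by blast
  with f(2) v(2) show False by simp
qed

text \<open>The projection \<open>p\<close> extends the operators from the weight space to the whole
  type, as \<open>jet_core\<close> asks. Irreducibility comes from
  \<open>span_translates_submodule\<close>.\<close>

lemma (in jet_module) jet_core_weight_space:
  fixes b :: "complex^'n" and p :: "'v \<Rightarrow> 'v"
  defines "V0 \<equiv> weight_space b"
  assumes B: "transpose B = - B" "invertible B"
    and irr: jet_irreducible and ds: "direct_sum_of V weight_space" and fd: "fin_dim sc V0"
    and nz: "V0 \<noteq> {0}"
    and p: "\<And>x y. p (x + y) = p x + p y" "\<And>c x. p (sc c x) = sc c (p x)"
      "\<And>x. p x \<in> V0" "\<And>x. x \<in> V0 \<Longrightarrow> p x = x"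
    and \<tau>: "\<And>r v. app (\<tau> r) v = jet_op r (p v) - sc (scalar_product (B *v cvec r) b) (p v)"
    and Pr: "\<And>v. app Pr v = p v"
  shows "jet_core B sc V0 Pr \<tau>"
proof -
  interpret S: symplectic_lattice B by standard (fact B)+
  have pV0: "p x \<in> weight_space b" for x using p(3) by (simp add: V0_def)
  have pV: "p x \<in> V" for x by (rule weight_space_V[OF pV0])
  have sub: "V.subspace V0" by (simp add: V0_def weight_space_subspace)
  have jV0: "jet_op r (p x) \<in> V0" for r x using jet_op_weight[OF pV0] by (simp add: V0_def)
  have scV: "sc c (p x) \<in> V" for c x by (intro V_closed(4) pV)
  have \<tau>V0: "app (\<tau> r) v \<in> V0" for r v
    unfolding \<tau> by (intro V.subspace_diff[OF sub] V.subspace_scale[OF sub] jV0 p(3))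
  have pp: "p (p x) = p x" for x by (intro p(4) p(3))
  have pj: "p (jet_op r (p x)) = jet_op r (p x)" for r x by (intro p(4) jV0)
  have pdiff: "p (x - y) = p x - p y" for x y using p(1)[of "x - y" y] by simp
  show ?thesis
  proof
    show "V.subspace V0" by (rule sub)
    show "fin_dim sc V0" by (rule fd)
    show "app Pr v \<in> V0" for v by (simp add: Pr p)
    show "app (\<tau> r) (sc c v) = sc c (app (\<tau> r) v)" for r c v
      by (simp add: \<tau> p(2) jet_op_linear pV V.scale_right_diff_distrib mult.commute)
    show "app (\<tau> r) v \<in> V0" for r v by (rule \<tau>V0)
    show "\<tau> r * Pr = \<tau> r" for r by (rule aend_eqI) (simp add: \<tau> Pr pp)
    show "\<tau> 0 = 0" by (rule aend_eqI) (simp add: \<tau> jet_op_0 pV matrix_vector_mult_0_right)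
    show "V0 \<noteq> {0}" by (rule nz)
  next
    fix r s v
    define x where "x = p v"
    have x: "x \<in> V" "x \<in> V0" "p x = x" by (simp_all add: x_def pV p(3) pp)
    have jx: "jet_op r x \<in> V" "jet_op s x \<in> V" by (simp_all add: jet_op_V x)
    define c d where "c = scalar_product (B *v cvec r) b" and "d = scalar_product (B *v cvec s) b"
    have comp: "app (\<tau> r * \<tau> s) v
        = jet_op r (jet_op s (p v)) - sc (scalar_product (B *v cvec s) b) (jet_op r (p v))
          - sc (scalar_product (B *v cvec r) b) (jet_op s (p v))
          + sc (scalar_product (B *v cvec r) b * scalar_product (B *v cvec s) b) (p v)" for r s
      by (simp add: \<tau> pdiff p(2) pp pj jet_op_linear jet_op_V pV scV V.scale_right_diff_distrib)
    have "app (\<tau> r * \<tau> s - \<tau> s * \<tau> r) v = jet_op r (jet_op s x) - jet_op s (jet_op r x)"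
      unfolding app_simps(4) comp by (simp add: x_def mult.commute)
    also have "\<dots> = sc (scalar_product (B *v cvec r) (cvec s)) (jet_op (r + s) x - jet_op r x - jet_op s x)"
      by (rule jet_op_bracket[OF S.scalar_product_skew x(1)])
    \<comment> \<open>The subtracted scalar \<open>(Br|b)\<close> is additive in \<open>r\<close>
      and cancels in this combination.\<close>
    also have "jet_op (r + s) x - jet_op r x - jet_op s x = app (\<tau> (r + s) - \<tau> r - \<tau> s) v"
      by (simp add: \<tau> x_def matrix_vector_right_distrib V.scale_left_distrib)
    finally show "app (\<tau> r * \<tau> s - \<tau> s * \<tau> r) v = sc (S.w r s) (app (\<tau> (r + s) - \<tau> r - \<tau> s) v)"
      by (simp add: S.w_def)
  next
    fix U assume U: "V.subspace U" "U \<subseteq> V0" and inv: "\<And>r u. u \<in> U \<Longrightarrow> app (\<tau> r) u \<in> U"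
    have jU: "jet_op r u \<in> U" if u: "u \<in> U" for r u
    proof -
      have pu: "p u = u" using u U(2) p(4) by blast
      have "app (\<tau> r) u + sc (scalar_product (B *v cvec r) b) u \<in> U"
        by (intro V.subspace_add[OF U(1)] V.subspace_scale[OF U(1)] u inv)
      then show ?thesis by (simp add: \<tau> pu)
    qed
    have "U = {0} \<or> V = V.span {\<mu> (tpow k) u | k u. u \<in> U}"
      by (rule span_translates_submodule[OF irr U(1) _ jU]) (use U(2) in \<open>simp_all add: V0_def\<close>)
    moreover have "U = V0" if V: "V = V.span {\<mu> (tpow k) u | k u. u \<in> U}"
    proof
      show "V0 \<subseteq> U"
      proof
        fix v assume v: "v \<in> V0"
        then have vV: "v \<in> V" by (simp add: V0_def weight_space_V)
        have UV: "U \<subseteq> V" using U(2) weight_space_V by (auto simp: V0_def)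
        from V_subset_assemble[OF V U(1) UV] vV obtain x :: "('n, 'v) graded"
          where x: "x \<in> tensor_laurent U" "v = assemble x" by blast
        \<comment> \<open>\<open>v\<close> already has the expansion concentrated in degree 0. By
          injectivity of \<open>assemble\<close> it is the expansion over \<open>U\<close>, so its
          coefficient \<open>v\<close> lies in \<open>U\<close>.\<close>
        have "x = Poly_Mapping.single 0 v"
        proof (rule inj_onD[OF assemble_inj[OF ds, of b]])
          show "assemble x = assemble (Poly_Mapping.single 0 v)"
            using x(2) vV by (simp add: assemble_single mult_one)
          show "x \<in> tensor_laurent (weight_space b)"
            using x(1) U(2) by (auto simp: tensor_laurent_def V0_def)
          show "Poly_Mapping.single 0 v \<in> tensor_laurent (weight_space b)"
            using v V.subspace_0[OF sub] by (simp add: tensor_laurent_def V0_def lookup_single when_def)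
        qed
        then have "Poly_Mapping.lookup x 0 = v" by simp
        then show "v \<in> U" using x(1) by (auto simp: tensor_laurent_def)
      qed
    qed (rule U(2))
    ultimately show "U = {0} \<or> U = V0" by blast
  qed
qed

lemma (in jet_module) assemble_bij:
  assumes irr: jet_irreducible and ds: "direct_sum_of V weight_space" and nz: "weight_space b \<noteq> {0}"
  shows "bij_betw assemble (tensor_laurent (weight_space b) :: ('n, 'v) graded set) V"
    and "linear_on (pm_scale sc) (tensor_laurent (weight_space b)) sc V (assemble :: ('n, 'v) graded \<Rightarrow> 'v)"
proof -
  have sub: "(tensor_laurent (weight_space b) :: ('n, 'v) graded set) \<subseteq> tensor_laurent V"
    by (auto simp: tensor_laurent_def intro: weight_space_V)
  have W: "weight_space b \<subseteq> V" by (auto intro: weight_space_V)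
  have "V = V.span {\<mu> (tpow k) u | k u. u \<in> weight_space b}"
    using span_translates_submodule[OF irr weight_space_subspace subset_refl jet_op_weight] nz by blast
  from V_subset_assemble[OF this weight_space_subspace W] sub
  have "assemble ` (tensor_laurent (weight_space b) :: ('n, 'v) graded set) = V"
    using linear_onD(1)[OF assemble_linear] by blast
  then show "bij_betw assemble (tensor_laurent (weight_space b) :: ('n, 'v) graded set) V"
    using assemble_inj[OF ds] by (simp add: bij_betw_def)
  show "linear_on (pm_scale sc) (tensor_laurent (weight_space b)) sc V (assemble :: ('n, 'v) graded \<Rightarrow> 'v)"
    using linear_onD[OF assemble_linear] sub by (intro linear_onI) blast+
qed

theorem theorem1p1:
  fixes B :: "complex^('m::finite + 'm)^('m + 'm)"
    and sc :: "complex \<Rightarrow> 'v::ab_group_add \<Rightarrow> 'v"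
    and V :: "'v set"
    and \<rho> :: "(('m + 'm) laurent \<Rightarrow> ('m + 'm) laurent) \<Rightarrow> 'v \<Rightarrow> 'v"
    and \<mu> :: "('m + 'm) laurent \<Rightarrow> 'v \<Rightarrow> 'v"
  assumes "transpose B = - B"
    and "invertible B"
    and "jet_module B sc V \<rho> \<mu>"
    and "jet_module.jet_irreducible B sc V \<rho> \<mu>"
    and "direct_sum_of V (jet_module.weight_space sc V \<rho>)"
    and "\<And>wt. fin_dim sc (jet_module.weight_space sc V \<rho> wt)"
  shows "\<exists>(L :: (nat \<Rightarrow>\<^sub>0 complex) set) br \<pi> V0 \<sigma> \<beta> \<rho>' \<mu>' \<Phi>.
           lie_algebra lscale L br \<and>
           lie_algebra.reductive lscale L br \<and>
           lie_isomorphic lscale (lie_algebra.semisimple_part lscale L br) br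
             mat_scale (sp :: (complex^('m + 'm)^('m + 'm)) set) mat_br \<and>
           lie_hom lscale TB (TB_br B) lscale L br \<pi> \<and> \<pi> ` TB = L \<and>
           lie_module lscale L br sc V0 \<sigma> \<and>
           lie_module.irreducible L sc V0 \<sigma> \<and>
           tensor_jet_structure B sc V0 (\<lambda>x. \<sigma> (\<pi> x)) \<beta> \<rho>' \<mu>' \<and>
           jet_iso B sc V \<rho> \<mu> (pm_scale sc) (tensor_laurent V0) \<rho>' \<mu>' \<Phi>"
proof -
  interpret J: jet_module B sc V \<rho> \<mu> by (rule assms(3))
  have "V \<noteq> {0}" using assms(4) by (simp add: J.jet_irreducible_def)
  \<comment> \<open>Any weight with a nonzero weight space can serve as
    \<open>\<beta>\<close>.\<close>
  then obtain b where nz: "J.weight_space b \<noteq> {0}"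
    using J.exists_nonzero_weight_space assms(5) by blast
  let ?V0 = "J.weight_space b"
  obtain p where p: "\<And>x y. p (x + y) = p x + p y" "\<And>c x. p (sc c x) = sc c (p x)"
      "\<And>x. p x \<in> ?V0" "\<And>x. x \<in> ?V0 \<Longrightarrow> p x = x"
    using J.V.exists_projection[OF J.weight_space_subspace[of b]] by metis
  have pV: "p x \<in> V" for x using p(3) J.weight_space_V by blast
  define Pr where "Pr = Aend p"
  define \<tau> where "\<tau> r = Aend (\<lambda>v. J.jet_op r (p v) - sc (scalar_product (B *v cvec r) b) (p v))" for r
  have Pr: "app Pr v = p v" for v
    unfolding Pr_def by (subst app_Aend) (simp_all add: p)
  have \<tau>: "app (\<tau> r) v = J.jet_op r (p v) - sc (scalar_product (B *v cvec r) b) (p v)" for r v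
    unfolding \<tau>_def
    by (subst app_Aend) (simp_all add: p(1) J.jet_op_linear pV J.V.scale_right_distrib)
  interpret core: jet_core B sc ?V0 Pr \<tau>
    by (rule J.jet_core_weight_space[OF assms(1,2,4,5,6) nz p \<tau> Pr])
  obtain P M :: "'m smat" where PM: "M ** P = mat 1" "P ** M = mat 1"
    "\<And>x y. omega (P *v x) (P *v y) = scalar_product (B *v x) y"
    using exists_symplectic_change[OF assms(1,2)] by blast
  interpret Q: lie_quotient_module B P M sc ?V0 Pr \<tau>
    by standard (fact PM)+
  let ?W = "tensor_laurent ?V0 :: ('m + 'm, 'v) graded set"
  let ?\<Phi> = "inv_into ?W J.assemble"
  let ?\<rho> = "\<lambda>\<eta> x. ?\<Phi> (\<rho> \<eta> (J.assemble x))" and ?\<mu> = "\<lambda>f x. ?\<Phi> (\<mu> f (J.assemble x))"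
  note bij = J.assemble_bij[OF assms(4,5) nz]
  interpret pm: vector_space "pm_scale sc" by (rule vector_space_pm_scale[OF J.V.vector_space_axioms])
  have subW: "pm.subspace ?W"
    using J.weight_space_closed(2) J.weight_space_closed(4)
      J.weight_space_closed(1)
    by (intro pm.subspaceI)
      (simp_all add: tensor_laurent_def lookup_add lookup_pm_scale[OF J.V.vector_space_axioms])
  note transport = jet_module_transport[OF assms(3) pm.vector_space_axioms subW bij(2,1)]
  have single: "Poly_Mapping.single k v \<in> ?W" if "v \<in> ?V0" for k v
    using that J.weight_space_closed(1)
    by (simp add: tensor_laurent_def lookup_single when_def)
  have inv_single: "?\<Phi> (\<mu> (tpow k) v) = Poly_Mapping.single k v" if "v \<in> ?V0" for k v
    using inv_into_f_f[OF bij_betw_imp_inj_on[OF bij(1)] single[OF that], of k]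
    by (simp add: J.assemble_single)
  have "tensor_jet_structure B sc ?V0 (\<lambda>x. app (Q.sig (Q.quot x))) b ?\<rho> ?\<mu>"
    unfolding tensor_jet_structure_def
  proof (intro conjI ballI allI impI transport(1))
    fix v k assume v: "v \<in> ?V0"
    then have vV: "v \<in> V" by (rule J.weight_space_V)
    show "?\<mu> (tpow r) (Poly_Mapping.single k v) = Poly_Mapping.single (k + r) v" for r
      using inv_single[OF v, of "r + k"] by (simp add: J.assemble_single J.mu_tpow_add vV add.commute)
    show "?\<rho> (D u 0) (Poly_Mapping.single k v) = Poly_Mapping.single k (sc (scalar_product u (cvec k + b)) v)" for u
    proof -
      have "\<rho> (D u 0) (\<mu> (tpow k) v) = sc (scalar_product u (cvec k + b)) (\<mu> (tpow k) v)"
        using J.mu_tpow_weight[OF v, of k] by (simp add: J.weight_space_def add.commute)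
      also have "\<dots> = \<mu> (tpow k) (sc (scalar_product u (cvec k + b)) v)" by (simp only: J.mu(3)[OF vV])
      finally have "\<rho> (D u 0) (\<mu> (tpow k) v) = \<mu> (tpow k) (sc (scalar_product u (cvec k + b)) v)" .
      then show ?thesis
        using inv_single[OF J.weight_space_closed(4)[OF v]] by (simp only: J.assemble_single)
    qed
    fix r :: "int^('m + 'm)"
    let ?x = "sc (scalar_product (B *v cvec r) (cvec k + b)) v" and ?y = "app (Q.sig (Q.quot (T r))) v"
    have y: "?y = J.jet_op r v - sc (scalar_product (B *v cvec r) b) v"
      by (simp add: Q.quot_T Q.sig_gen \<tau> p(4)[OF v])
    have xy: "?x + ?y \<in> ?V0"
      unfolding y
      by (intro J.weight_space_closed(2) J.weight_space_closed(3)
          J.weight_space_closed(4) v J.jet_op_weight)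
    \<comment> \<open>The scalar \<open>(Br|\<beta>)\<close> removed from \<open>jet_op r\<close> is
      given back as the \<open>\<beta>\<close> in \<open>(Br|k + \<beta>)\<close>.\<close>
    have "sc (scalar_product (B *v cvec r) (cvec k)) v + J.jet_op r v = ?x + ?y"
      unfolding y by (simp add: J.V.scale_left_distrib)
    then have "\<rho> (J.ham r) (\<mu> (tpow k) v) = \<mu> (tpow (k + r)) (?x + ?y)"
      by (simp only: J.rho_ham_mu[OF vV])
    then show "?\<rho> (D (B *v cvec r) r) (Poly_Mapping.single k v) = Poly_Mapping.single (k + r) ?x + Poly_Mapping.single (k + r) ?y"
      using inv_single[OF xy] by (simp only: J.assemble_single single_add)
  qed
  then show ?thesis
    by (intro exI[of _ "Lsp TYPE('m)"] exI[of _ "Lbr TYPE('m)"] exI[of _ Q.quot] exI[of _ ?V0]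
        exI[of _ "\<lambda>x. app (Q.sig x)"] exI[of _ b] exI[of _ ?\<rho>] exI[of _ ?\<mu>] exI[of _ ?\<Phi>] conjI
        lie_algebra_Lsp reductive_Lsp semisimple_part_Lsp Q.lie_hom_quot Q.quot_surj
        Q.lie_module_sig Q.irreducible_sig transport(2))
qed

end
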